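(* Let $f = \exp\varphi$ be a log-concave probability density on $\mathbb{R}$, and for each $n>1$ let $\hat\varphi_n$ be the nonparametric maximum likelihood estimator of $\varphi$ over concave functions, based on a random sample of size $n$ from $f$. Assume that $\varphi \in \mathcal{H}^{\beta,L}(T)$ for some exponent $\beta \in [1,2]$, some constant $L>0$ and a compact subinterval $T=[A,B]$ (with $A<B$) of the interior of $\{f>0\}$. Then, with $\rho_n := \log(n)/n$ and $T(n,\beta) := [A + \rho_n^{1/(2\beta+1)},\, B - \rho_n^{1/(2\beta+1)}]$, as $n\to\infty$, $$\max_{t \in T}(\hat{\varphi}_n - \varphi)(t) = O_{\mathrm{p}}\bigl(\rho_n^{\beta/(2\beta+1)}\bigr),$$ $$\max_{t \in T(n,\beta)}(\varphi - \hat{\varphi}_n)(t) = O_{\mathrm{p}}\bigl(\rho_n^{\beta/(2\beta+1)}\bigr).$$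
   Context: A probability density $f$ on $\mathbb{R}$ is log-concave if $f=\exp\varphi$ for some concave $\varphi:\mathbb{R}\to[-\infty,\infty)$ (with $\exp(-\infty)=0$). For each $n>1$, let $X_1<X_2<\dots<X_n$ be the order statistics of an i.i.d. sample of size $n$ from $f$ (almost surely distinct), with empirical distribution function $\mathbb{F}_n$. For concave $\varphi:\mathbb{R}\to[-\infty,\infty)$ put $\Psi_n(\varphi):=\int\varphi\,d\mathbb{F}_n-\int_{\mathbb{R}}\exp\varphi(x)\,dx$. The estimator $\hat\varphi_n$ is the maximizer of $\Psi_n$ over all concave functions $\mathbb{R}\to[-\infty,\infty)$. It is known that it exists, is unique, is linear on each $[X_j,X_{j+1}]$, $1\le j<n$, and equals $-\infty$ on $\mathbb{R}\setminus[X_1,X_n]$. Hölder classes: for an interval $I$, $\beta\in[1,2]$, $L>0$, a function $g:I\to\mathbb{R}$ belongs to $\mathcal{H}^{\beta,L}(I)$ if for all $x,y\in I$: $|g(x)-g(y)|\le L|x-y|$ in case $\beta=1$; $g$ is differentiable and $|g'(x)-g'(y)|\le L|x-y|^{\beta-1}$ in case $\beta>1$. $Z_n=O_{\mathrm p}(a_n)$ means $\lim_{C\to\infty}\limsup_{n\to\infty}\mathbb{P}(|Z_n|>C a_n)=0$. The set $T(n,\beta)$ is a non-empty interval for all sufficiently large $n$. *)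

theory Defs
  imports "HOL-Probability.Probability"
begin

definition concave_ereal :: "(real \<Rightarrow> ereal) \<Rightarrow> bool" where
  "concave_ereal \<phi> \<longleftrightarrow>
     (\<forall>x. \<phi> x \<noteq> \<infinity>) \<and>
     (\<forall>x y t. 0 < t \<and> t < 1 \<longrightarrow>
        ereal (1 - t) * \<phi> x + ereal t * \<phi> y \<le> \<phi> ((1 - t) * x + t * y))"

definition exp_ereal :: "ereal \<Rightarrow> ennreal" where
  "exp_ereal a = (case a of ereal r \<Rightarrow> ennreal (exp r) | PInfty \<Rightarrow> \<infinity> | MInfty \<Rightarrow> 0)"

(* The functional Psi_n. The sample is x 0, ..., x (n - 1), in any order. The first summand is
   the integral of \<phi> with respect to the empirical distribution, which puts mass 1/n on each
   observation. The integral of exp \<phi> may be infinite. As concave functions never take the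
   value \<infinity>, no expression \<infinity> - \<infinity> arises. *)
definition log_lik :: "nat \<Rightarrow> (nat \<Rightarrow> real) \<Rightarrow> (real \<Rightarrow> ereal) \<Rightarrow> ereal" where
  "log_lik n x \<phi> =
     (\<Sum>i<n. \<phi> (x i)) / ereal (real n) - enn2ereal (\<integral>\<^sup>+ t. exp_ereal (\<phi> t) \<partial>lborel)"

definition log_concave_mle :: "nat \<Rightarrow> (nat \<Rightarrow> real) \<Rightarrow> (real \<Rightarrow> ereal) \<Rightarrow> bool" where
  "log_concave_mle n x \<psi> \<longleftrightarrow> is_arg_max (log_lik n x) concave_ereal \<psi>"

(* For \<beta> > 1 the derivative is taken within I, hence one-sided at endpoints belonging to I. *)
definition Hoelder_class :: "real \<Rightarrow> real \<Rightarrow> real set \<Rightarrow> (real \<Rightarrow> real) set" where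
  "Hoelder_class \<beta> L I =
     {g. (\<beta> = 1 \<and> (\<forall>x\<in>I. \<forall>y\<in>I. \<bar>g x - g y\<bar> \<le> L * \<bar>x - y\<bar>)) \<or>
         (\<beta> > 1 \<and> (\<exists>g'. (\<forall>x\<in>I. (g has_real_derivative g' x) (at x within I)) \<and>
                       (\<forall>x\<in>I. \<forall>y\<in>I. \<bar>g' x - g' y\<bar> \<le> L * \<bar>x - y\<bar> powr (\<beta> - 1))))}"

(* Z n = O_p(a n), for extended-real Z. The outer measure agrees with the measure on measurable
   sets; unlike measure, which is 0 on non-measurable sets, it never makes the condition
   trivially true. *)
definition bigO_prob :: "'a measure \<Rightarrow> (nat \<Rightarrow> 'a \<Rightarrow> ereal) \<Rightarrow> (nat \<Rightarrow> real) \<Rightarrow> bool" where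
  "bigO_prob M Z a \<longleftrightarrow>
     ((\<lambda>C::real. limsup (\<lambda>n. outer_measure_of M {\<omega> \<in> space M. \<bar>Z n \<omega>\<bar> > ereal (C * a n)}))
        \<longlongrightarrow> 0) at_top"

definition rho :: "nat \<Rightarrow> real" where
  "rho n = ln (real n) / real n"

definition inner_interval :: "real \<Rightarrow> real \<Rightarrow> real \<Rightarrow> nat \<Rightarrow> real set" where
  "inner_interval A B \<beta> n =
     {A + rho n powr (1 / (2 * \<beta> + 1)) .. B - rho n powr (1 / (2 * \<beta> + 1))}"

end

theory Submission
  imports Defs "HOL-Real_Asymp.Real_Asymp"
begin

text \<open>
  Suppose that the estimator deviates from \<open>\<phi>\<close> by more than a large multiple of
  \<open>\<delta> powr \<beta>\<close>, \<open>\<delta> = rho n powr (1 / (2 * \<beta> + 1))\<close>, at some point. Since the estimator is concave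
  and \<open>\<phi>\<close> is Hoelder continuous, the deviation then persists, with one of the two signs, on an interval
  of length \<open>\<delta>\<close>. The estimator is affine between its knots, so the deviation can be followed from this
  interval up to the neighbouring knots, and there is a concave, piecewise affine \<open>w\<close>, cut off at
  these knots, such that \<open>w\<close> times the difference of the two densities has a definite sign.
  Optimality gives \<open>\<integral>w d(empirical) \<le> \<integral>w d(estimated)\<close>, because the convex kinks of a perturbation
  may sit at the knots. Hence \<open>\<integral>w (exp \<phi> - estimated density)\<close> is bounded by the deviation of the
  empirical measure from its mean, which by Bernstein's inequality on a grid is of order
  \<open>sqrt (rho n * r) + rho n\<close> on all intervals of length \<open>r\<close> simultaneously. Comparing both sides bounds
  the deviation on the interval by a constant times \<open>sqrt (rho n / \<delta>) = \<delta> powr \<beta>\<close>.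
\<close>

subsection \<open>Integrals and concave functions on a compact interval\<close>

text \<open>The obstacle: nothing controls the distance from the interval to the neighbouring knots,
  which may be as far out as the extreme observations. So each bound has to hold for gaps of every
  length from \<open>\<delta>\<close> on, although the density is bounded below only near
  \<open>{A..B}\<close>; far knots enlarge the noise, hence the control of the sample range by
  exponential tails.

  The two signs need different \<open>w\<close>. Between knots the estimator is affine, so \<phi>
  minus the estimator is concave there. Where it is positive on the interval, it changes sign at
  most once on either side before the knot, and a tent vanishing at the sign changes is the right
  \<open>w\<close>. Where it is negative, the excess is convex up to the knot and does not fall
  again in a direction in which it has grown, so a one-sided ramp suffices.

  Ramps and tents are built from indicators of intervals, so the empirical measure is needed on
  intervals only. The analysis takes place on the range of the sample, where all functions are
  real-valued; cutting the estimator off outside does not lower the likelihood. The logarithm in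
  \<open>rho\<close> pays for a union over about \<open>n ^ 4\<close> pairs of grid points.\<close>

abbreviation lebesgue_Icc :: "real \<Rightarrow> real \<Rightarrow> real measure" where
  "lebesgue_Icc l u \<equiv> restrict_space lborel {l..u}"

lemma finite_measure_lebesgue_Icc: "finite_measure (lebesgue_Icc l u)"
  by (rule finite_measureI) (simp add: space_restrict_space emeasure_restrict_space emeasure_lborel_Icc_eq)

lemma integrable_lebesgue_IccI:
  fixes w :: "real \<Rightarrow> real"
  assumes "w \<in> borel_measurable (lebesgue_Icc l u)" "\<And>t. t \<in> {l..u} \<Longrightarrow> \<bar>w t\<bar> \<le> K"
  shows "integrable (lebesgue_Icc l u) w"
proof -
  interpret finite_measure "lebesgue_Icc l u" by (rule finite_measure_lebesgue_Icc)
  show ?thesis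
    by (rule integrable_const_bound[where B = K]) (use assms in \<open>auto intro!: AE_I2 simp: space_restrict_space\<close>)
qed

lemma integral_lebesgue_Icc_uminus:
  fixes w :: "real \<Rightarrow> real"
  shows "(\<integral>t. w t \<partial>lebesgue_Icc (-u) (-l)) = (\<integral>t. w (-t) \<partial>lebesgue_Icc l u)"
proof -
  have "(\<integral>t. w t \<partial>lebesgue_Icc (-u) (-l)) = (\<integral>t. indicator {-u..-l} t *\<^sub>R w t \<partial>lborel)"
    by (subst integral_restrict_space) auto
  also have "\<dots> = (\<integral>t. indicator {-u..-l} (-t) *\<^sub>R w (-t) \<partial>lborel)"
    by (subst lborel_integral_real_affine[where c = "-1" and t = 0]) auto
  also have "(\<lambda>t. indicator {-u..-l} (-t) *\<^sub>R w (-t)) = (\<lambda>t. indicator {l..u} t *\<^sub>R w (-t))"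
    by (auto simp: indicator_def fun_eq_iff)
  also have "(\<integral>t. indicator {l..u} t *\<^sub>R w (-t) \<partial>lborel) = (\<integral>t. w (-t) \<partial>lebesgue_Icc l u)"
    by (subst integral_restrict_space) auto
  finally show ?thesis .
qed

lemma integral_lebesgue_Icc_ge:
  fixes w :: "real \<Rightarrow> real"
  assumes int: "integrable (lebesgue_Icc l u) w" and nn: "\<And>t. t \<in> {l..u} \<Longrightarrow> 0 \<le> w t"
    and pq: "l \<le> p" "p \<le> q" "q \<le> u" and ge: "\<And>t. t \<in> {p..q} \<Longrightarrow> c \<le> w t"
  shows "c * (q - p) \<le> (\<integral>t. w t \<partial>lebesgue_Icc l u)"
proof -
  have "c * (q - p) = (\<integral>t. c * indicator {p..q} t \<partial>lebesgue_Icc l u)"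
  proof -
    have "(\<integral>t. c * indicator {p..q} t \<partial>lebesgue_Icc l u)
        = (\<integral>t. indicator {l..u} t *\<^sub>R (c * indicator {p..q} t) \<partial>lborel)"
      by (subst integral_restrict_space) auto
    also have "(\<lambda>t. indicator {l..u} t *\<^sub>R (c * indicator {p..q} t)) = (\<lambda>t. c * indicator {p..q} t)"
      using pq by (auto simp: indicator_def fun_eq_iff)
    finally have "(\<integral>t. c * indicator {p..q} t \<partial>lebesgue_Icc l u) = (\<integral>t. c * indicator {p..q} t \<partial>lborel)" .
    also have "\<dots> = c * (q - p)" using pq by simp
    finally show ?thesis ..
  qed
  also have "\<dots> \<le> (\<integral>t. w t \<partial>lebesgue_Icc l u)"
  proof (rule integral_mono[OF _ int])
    show "integrable (lebesgue_Icc l u) (\<lambda>t. c * indicator {p..q} t)"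
    proof (rule integrable_lebesgue_IccI[where K = "\<bar>c\<bar>"])
      show "(\<lambda>t. c * indicator {p..q} t) \<in> borel_measurable (lebesgue_Icc l u)"
        by (rule measurable_restrict_space1) simp
    qed (auto simp: indicator_def)
    show "c * indicator {p..q} t \<le> w t" if "t \<in> space (lebesgue_Icc l u)" for t
      using that nn[of t] ge[of t] by (auto simp: indicator_def space_restrict_space)
  qed
  finally show ?thesis .
qed

text \<open>The three-point inequality with denominators cleared: later steps only add and scale
  such inequalities, and the cases \<open>y = x\<close> and \<open>y = z\<close> need no separate
  treatment.\<close>

lemma concave_on_Icc_ineq:
  fixes g :: "real \<Rightarrow> real"
  assumes "concave_on S g" "x \<in> S" "z \<in> S" "x < z" "x \<le> y" "y \<le> z"
  shows "(z - y) * g x + (y - x) * g z \<le> (z - x) * g y"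
proof -
  define t where "t = (y - x) / (z - x)"
  have t: "0 \<le> t" "t \<le> 1" using assms by (auto simp: t_def)
  have *: "y = (1 - t) * x + t * z"
  proof -
    have "t * (z - x) = y - x" using assms(4) by (simp add: t_def)
    then show ?thesis by (simp add: algebra_simps)
  qed
  have "(1 - t) * g x + t * g z \<le> g ((1 - t) *\<^sub>R x + t *\<^sub>R z)"
    using assms t by (intro concave_onD) auto
  then have "(z - x) * ((1 - t) * g x + t * g z) \<le> (z - x) * g y"
    using * assms(4) by (intro mult_left_mono) auto
  moreover have "(z - x) * (1 - t) = z - y" "(z - x) * t = y - x"
    using assms(4) by (auto simp: t_def field_simps)
  ultimately show ?thesis by (simp add: distrib_left flip: mult.assoc)
qed

lemma concave_on_IccI:
  fixes g :: "real \<Rightarrow> real"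
  assumes "\<And>x y z. x \<in> {l..u} \<Longrightarrow> z \<in> {l..u} \<Longrightarrow> x < y \<Longrightarrow> y < z \<Longrightarrow>
     (z - y) * g x + (y - x) * g z \<le> (z - x) * g y"
  shows "concave_on {l..u} g"
  unfolding concave_on_def
proof (rule convex_on_linorderI)
  fix t x y :: real
  assume t: "0 < t" "t < 1" and xy: "x \<in> {l..u}" "y \<in> {l..u}" "x < y"
  let ?m = "(1 - t) * x + t * y"
  have m: "?m - x = t * (y - x)" "y - ?m = (1 - t) * (y - x)" by (auto simp: algebra_simps)
  have "x < ?m" "?m < y"
    using m t xy by (smt (verit) mult_pos_pos)+
  from assms[OF xy(1,2) this] have "(y - x) * ((1 - t) * g x + t * g y) \<le> (y - x) * g ?m"
    unfolding m by (simp add: algebra_simps)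
  then show "- g ((1 - t) *\<^sub>R x + t *\<^sub>R y) \<le> (1 - t) * - g x + t * - g y"
    using xy by simp
qed simp

lemma concave_on_Icc_ge_min:
  fixes g :: "real \<Rightarrow> real"
  assumes "concave_on {l..u} g" "t \<in> {l..u}"
  shows "min (g l) (g u) \<le> g t"
proof (cases "l < u")
  case True
  have "(u - l) * min (g l) (g u) = (u - t) * min (g l) (g u) + (t - l) * min (g l) (g u)"
    by (simp add: algebra_simps)
  also have "\<dots> \<le> (u - t) * g l + (t - l) * g u"
    using assms by (intro add_mono mult_left_mono) auto
  also have "\<dots> \<le> (u - l) * g t"
    using assms True by (intro concave_on_Icc_ineq) auto
  finally show ?thesis using True by simp
next
  case False
  then have "t = l" using assms(2) by auto
  then show ?thesis by simp
qed

text \<open>The lower bound comes from the end points. Reflection at the midpoint turns it into an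
  upper bound, since \<open>t\<close> and \<open>l + u - t\<close> average to the midpoint.\<close>

lemma concave_on_Icc_bounded:
  fixes g :: "real \<Rightarrow> real"
  assumes "concave_on {l..u} g"
  shows "\<exists>K. \<forall>t\<in>{l..u}. \<bar>g t\<bar> \<le> K"
proof -
  define b where "b = min (g l) (g u)"
  have *: "g t \<le> 2 * g ((l + u) / 2) - b" if t: "t \<in> {l..u}" for t
  proof -
    have "b \<le> g (l + u - t)"
      unfolding b_def by (rule concave_on_Icc_ge_min[OF assms]) (use t in auto)
    moreover have "g t + g (l + u - t) \<le> 2 * g ((l + u) / 2)"
      using concave_onD[OF assms, of "1/2" t "l + u - t"] t by (simp add: field_simps)
    ultimately show ?thesis by simp
  qed
  have "\<bar>g t\<bar> \<le> max (2 * g ((l + u) / 2) - b) (- b)" if t: "t \<in> {l..u}" for t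
    using *[OF t] concave_on_Icc_ge_min[OF assms t] unfolding b_def[symmetric] by linarith
  then show ?thesis by blast
qed

text \<open>Concavity gives continuity on the open interval only; at \<open>l\<close> and
  \<open>u\<close> the function may jump, so these two points are treated separately.\<close>

lemma borel_measurable_concave_Icc:
  fixes g :: "real \<Rightarrow> real"
  assumes "concave_on {l..u} g"
  shows "g \<in> borel_measurable (lebesgue_Icc l u)"
proof -
  have "convex_on {l<..<u} (\<lambda>t. - g t)"
    using assms unfolding concave_on_def by (rule convex_on_subset) auto
  then have "continuous_on {l<..<u} (\<lambda>t. - g t)"
    by (intro convex_on_continuous) auto
  then have "continuous_on {l<..<u} (\<lambda>t. - (- g t))"
    by (rule continuous_on_minus)
  then have "(\<lambda>t. indicator {l<..<u} t *\<^sub>R g t) \<in> borel_measurable borel"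
    by (intro borel_measurable_continuous_on_indicator) auto
  then have *: "(\<lambda>t. indicator {l<..<u} t * g t) \<in> borel_measurable borel" by simp
  have "(\<lambda>t. g t * indicator {l..u} t) =
      (\<lambda>t. indicator {l<..<u} t * g t + (if l \<le> u then indicator {l} t * g l + (if l < u then indicator {u} t * g u else 0) else 0))"
    by (auto simp: fun_eq_iff indicator_def)
  also have "\<dots> \<in> borel_measurable borel"
    using * by measurable
  finally show ?thesis
    by (subst borel_measurable_restrict_space_iff) (auto simp: mult.commute)
qed

text \<open>Concave pieces fit together if the slope does not increase at \<open>b\<close>; a common
  supporting line of slope \<open>p\<close> expresses this without one-sided derivatives.\<close>

lemma concave_on_Icc_glue:
  fixes h :: "real \<Rightarrow> real"
  assumes left: "concave_on {l..b} h" and right: "concave_on {b..u} h"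
    and supp: "\<And>x. x \<in> {l..u} \<Longrightarrow> h x \<le> h b + p * (x - b)"
    and b: "b \<in> {l..u}"
  shows "concave_on {l..u} h"
proof (rule concave_on_IccI)
  fix x y z assume xz: "x \<in> {l..u}" "z \<in> {l..u}" and y: "x < y" "y < z"
  have sx: "h x \<le> h b + p * (x - b)" and sz: "h z \<le> h b + p * (z - b)"
    using supp xz by auto
  consider "z \<le> b" | "b \<le> x" | "x < b" "b < z" "y \<le> b" | "x < b" "b < z" "b < y" by linarith
  then show "(z - y) * h x + (y - x) * h z \<le> (z - x) * h y"
  proof cases
    case 1
    show ?thesis by (rule concave_on_Icc_ineq[OF left]) (use xz y 1 in auto)
  next
    case 2
    show ?thesis by (rule concave_on_Icc_ineq[OF right]) (use xz y 2 in auto)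
  next
    case 3
    have "(b - y) * h x + (y - x) * h b \<le> (b - x) * h y"
      by (rule concave_on_Icc_ineq[OF left]) (use xz y 3 b in auto)
    then have "(z - x) * ((b - y) * h x + (y - x) * h b) \<le> (z - x) * ((b - x) * h y)"
      using y by (intro mult_left_mono) auto
    moreover have "(y - x) * (b - x) * h z \<le> (y - x) * (b - x) * (h b + p * (z - b))"
      using sz y 3 by (intro mult_left_mono) auto
    moreover have "(y - x) * (z - b) * h x \<le> (y - x) * (z - b) * (h b + p * (x - b))"
      using sx y 3 by (intro mult_left_mono) auto
    ultimately have "(b - x) * ((z - y) * h x + (y - x) * h z) \<le> (b - x) * ((z - x) * h y)"
      by (simp add: algebra_simps)
    then show ?thesis using 3 by simp
  next
    case 4
    have "(z - y) * h b + (y - b) * h z \<le> (z - b) * h y"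
      by (rule concave_on_Icc_ineq[OF right]) (use xz y 4 b in auto)
    then have "(z - x) * ((z - y) * h b + (y - b) * h z) \<le> (z - x) * ((z - b) * h y)"
      using y by (intro mult_left_mono) auto
    moreover have "(z - y) * (z - b) * h x \<le> (z - y) * (z - b) * (h b + p * (x - b))"
      using sx y 4 by (intro mult_left_mono) auto
    moreover have "(z - y) * (b - x) * h z \<le> (z - y) * (b - x) * (h b + p * (z - b))"
      using sz y 4 by (intro mult_left_mono) auto
    ultimately have "(z - b) * ((z - y) * h x + (y - x) * h z) \<le> (z - b) * ((z - x) * h y)"
      by (simp add: algebra_simps)
    then show ?thesis using 4 by simp
  qed
qed

lemma concave_on_min:
  fixes g h :: "real \<Rightarrow> real"
  assumes "concave_on {l..u} g" "concave_on {l..u} h"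
  shows "concave_on {l..u} (\<lambda>t. min (g t) (h t))"
proof (rule concave_on_IccI)
  fix x y z assume *: "x \<in> {l..u}" "z \<in> {l..u}" "x < y" "y < z"
  have "(z - y) * g x + (y - x) * g z \<le> (z - x) * g y" "(z - y) * h x + (y - x) * h z \<le> (z - x) * h y"
    using concave_on_Icc_ineq[of "{l..u}"] assms * by auto
  moreover have "(z - y) * min (g x) (h x) \<le> (z - y) * g x" "(z - y) * min (g x) (h x) \<le> (z - y) * h x"
     "(y - x) * min (g z) (h z) \<le> (y - x) * g z" "(y - x) * min (g z) (h z) \<le> (y - x) * h z"
    using * by (auto intro!: mult_left_mono)
  ultimately show "(z - y) * min (g x) (h x) + (y - x) * min (g z) (h z) \<le> (z - x) * min (g y) (h y)"
    by (auto simp: min_def)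
qed

lemma concave_on_uminus_arg:
  fixes g :: "real \<Rightarrow> real"
  assumes "concave_on {l..u} g"
  shows "concave_on {-u..-l} (\<lambda>t. g (-t))"
proof (rule concave_on_IccI)
  fix x y z assume "x \<in> {-u..-l}" "z \<in> {-u..-l}" "x < y" "y < z"
  then have "(-x - -y) * g (-z) + (-y - -z) * g (-x) \<le> (-x - -z) * g (-y)"
    by (intro concave_on_Icc_ineq[OF assms]) auto
  then show "(z - y) * g (-x) + (y - x) * g (-z) \<le> (z - x) * g (-y)"
    by (simp add: algebra_simps)
qed

text \<open>\<open>g + \<epsilon> D\<close> is a convex combination of \<open>g\<close> and
  \<open>g + \<kappa> D\<close>, so an admissible direction stays admissible for all smaller
  steps.\<close>

lemma concave_on_add_scaled:
  fixes g D :: "real \<Rightarrow> real"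
  assumes "concave_on {l..u} g" "concave_on {l..u} (\<lambda>t. g t + \<kappa> * D t)" "0 \<le> \<epsilon>" "\<epsilon> \<le> \<kappa>"
  shows "concave_on {l..u} (\<lambda>t. g t + \<epsilon> * D t)"
proof (cases "\<kappa> = 0")
  case True
  then show ?thesis using assms by simp
next
  case False
  show ?thesis
  proof (rule concave_on_IccI)
    fix r s t assume *: "r \<in> {l..u}" "t \<in> {l..u}" "r < s" "s < t"
    have 1: "(t - s) * g r + (s - r) * g t \<le> (t - r) * g s"
      using concave_on_Icc_ineq[OF assms(1), of r t s] * by auto
    have 2: "(t - s) * (g r + \<kappa> * D r) + (s - r) * (g t + \<kappa> * D t) \<le> (t - r) * (g s + \<kappa> * D s)"
      using concave_on_Icc_ineq[OF assms(2), of r t s] * by auto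
    define \<theta> where "\<theta> = \<epsilon> / \<kappa>"
    have th: "0 \<le> \<theta>" "\<theta> \<le> 1" "\<epsilon> = \<theta> * \<kappa>" using assms False by (auto simp: \<theta>_def)
    have "(1 - \<theta>) * ((t - s) * g r + (s - r) * g t) + \<theta> * ((t - s) * (g r + \<kappa> * D r) + (s - r) * (g t + \<kappa> * D t))
       \<le> (1 - \<theta>) * ((t - r) * g s) + \<theta> * ((t - r) * (g s + \<kappa> * D s))"
      using 1 2 th by (intro add_mono mult_left_mono) auto
    then show "(t - s) * (g r + \<epsilon> * D r) + (s - r) * (g t + \<epsilon> * D t) \<le> (t - r) * (g s + \<epsilon> * D s)"
      unfolding th(3) by (simp add: algebra_simps)
  qed
qed

lemma integrable_exp_concave:
  fixes w :: "real \<Rightarrow> real"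
  assumes g: "concave_on {l..u} g" and w: "w \<in> borel_measurable (lebesgue_Icc l u)"
    and K: "\<And>t. t \<in> {l..u} \<Longrightarrow> \<bar>w t\<bar> \<le> K"
  shows "integrable (lebesgue_Icc l u) (\<lambda>t. w t * exp (g t))"
proof -
  note [measurable] = w borel_measurable_concave_Icc[OF g]
  obtain K' where K': "\<And>t. t \<in> {l..u} \<Longrightarrow> \<bar>g t\<bar> \<le> K'"
    using concave_on_Icc_bounded[OF g] by blast
  show ?thesis
  proof (rule integrable_lebesgue_IccI)
    fix t assume t: "t \<in> {l..u}"
    have "\<bar>w t\<bar> * exp (g t) \<le> K * exp K'"
      using K[OF t] K'[OF t] by (intro mult_mono) auto
    then show "\<bar>w t * exp (g t)\<bar> \<le> K * exp K'" by (simp add: abs_mult)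
  qed measurable
qed

lemma concave_on_affine: "concave_on S (\<lambda>t::real. p + q * t)" if "convex S"
proof -
  have "p + q * (a * x + b * y) = a * (p + q * x) + b * (p + q * y)" if "a + b = 1" for a b x y :: real
    using that by algebra
  then show ?thesis using that by (simp add: concave_on_iff)
qed

lemma exp_le_quadratic: "exp v \<le> 1 + v + v\<^sup>2" if "\<bar>v\<bar> \<le> 1" for v :: real
proof (cases "0 \<le> v")
  case True
  then show ?thesis using that by (intro exp_bound) auto
next
  case False
  have "exp v = 1 / exp (- v)" by (simp add: exp_minus field_simps)
  also have "\<dots> \<le> 1 / (1 + - v)"
    using False exp_ge_add_one_self[of "- v"] by (intro divide_left_mono) auto
  also have "\<dots> \<le> 1 + v + v\<^sup>2"
  proof -
    have "0 \<le> - (v * v\<^sup>2)" using False by (simp add: mult_nonpos_nonneg)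
    then have "1 \<le> (1 + v + v\<^sup>2) * (1 + - v)" by (simp add: algebra_simps power2_eq_square)
    then show ?thesis using False by (simp add: divide_le_eq)
  qed
  finally show ?thesis .
qed

text \<open>Meant for tents: the two sides of the peak contribute different lower bounds, and both
  are needed because the noise to be beaten has one part from each side.\<close>

lemma integral_lebesgue_Icc_ge2:
  fixes w :: "real \<Rightarrow> real"
  assumes int: "integrable (lebesgue_Icc l u) w" and nn: "\<And>t. t \<in> {l..u} \<Longrightarrow> 0 \<le> w t"
    and pq: "l \<le> p" "p \<le> q" "q < p'" "p' \<le> q'" "q' \<le> u"
    and ge: "\<And>t. t \<in> {p..q} \<Longrightarrow> c \<le> w t" "\<And>t. t \<in> {p'..q'} \<Longrightarrow> c' \<le> w t"
  shows "c * (q - p) + c' * (q' - p') \<le> (\<integral>t. w t \<partial>lebesgue_Icc l u)"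
proof -
  have [measurable]: "w \<in> borel_measurable (lebesgue_Icc l u)" using int by auto
  have m [measurable]: "indicat_real {y..z} \<in> borel_measurable (lebesgue_Icc l u)" for y z
    by (rule measurable_restrict_space1) simp
  have i: "integrable (lebesgue_Icc l u) (\<lambda>t. indicator {y..z} t * w t)" for y z
  proof (rule Bochner_Integration.integrable_bound[OF int])
    show "(\<lambda>t. indicator {y..z} t * w t) \<in> borel_measurable (lebesgue_Icc l u)" by measurable
  qed (simp add: indicator_def)
  have "c * (q - p) \<le> (\<integral>t. indicator {p..q} t * w t \<partial>lebesgue_Icc l u)"
    by (rule integral_lebesgue_Icc_ge[OF i]) (use nn pq ge in \<open>auto simp: indicator_def\<close>)
  moreover have "c' * (q' - p') \<le> (\<integral>t. indicator {p'..q'} t * w t \<partial>lebesgue_Icc l u)"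
    by (rule integral_lebesgue_Icc_ge[OF i]) (use nn pq ge in \<open>auto simp: indicator_def\<close>)
  moreover have "(\<integral>t. indicator {p..q} t * w t + indicator {p'..q'} t * w t \<partial>lebesgue_Icc l u) \<le> (\<integral>t. w t \<partial>lebesgue_Icc l u)"
    using i int nn pq by (intro integral_mono Bochner_Integration.integrable_add) (auto simp: indicator_def space_restrict_space)
  ultimately show ?thesis using i by simp
qed

subsection \<open>Knots of the estimator and its variational inequality\<close>

text \<open>The maximum likelihood problem in real-valued form: the competitors are finite concave
  functions on \<open>{l..u}\<close>. In the application \<open>l\<close> and \<open>u\<close> are
  the extreme observations.\<close>

locale concave_mle =
  fixes n :: nat and x :: "nat \<Rightarrow> real" and l u :: real and g :: "real \<Rightarrow> real"
  assumes n_pos: "0 < n" and l_less_u: "l < u"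
    and sample: "\<And>i. i < n \<Longrightarrow> x i \<in> {l..u}"
    and concave: "concave_on {l..u} g"
    and optimal: "\<And>k. concave_on {l..u} k \<Longrightarrow>
      (\<Sum>i<n. k (x i)) / n - (\<integral>t. exp (k t) \<partial>lebesgue_Icc l u)
        \<le> (\<Sum>i<n. g (x i)) / n - (\<integral>t. exp (g t) \<partial>lebesgue_Icc l u)"
begin

text \<open>Reflection at 0 preserves optimality, so statements about the left side follow from
  their right-hand twins.\<close>

lemma mirror: "concave_mle n (\<lambda>i. - x i) (-u) (-l) (\<lambda>t. g (-t))"
proof
  show "0 < n" "-u < -l" using n_pos l_less_u by auto
  show "- x i \<in> {-u..-l}" if "i < n" for i using sample[OF that] by auto
  show "concave_on {-u..-l} (\<lambda>t. g (-t))" by (rule concave_on_uminus_arg[OF concave])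
  fix k :: "real \<Rightarrow> real" assume "concave_on {-u..-l} k"
  from concave_on_uminus_arg[OF this] have "concave_on {l..u} (\<lambda>t. k (-t))" by simp
  from optimal[OF this]
  show "(\<Sum>i<n. k (- x i)) / n - (\<integral>t. exp (k t) \<partial>lebesgue_Icc (-u) (-l))
      \<le> (\<Sum>i<n. g (- (- x i))) / n - (\<integral>t. exp (g (-t)) \<partial>lebesgue_Icc (-u) (-l))"
    by (simp add: integral_lebesgue_Icc_uminus)
qed

lemma concave_ineq:
  assumes "a \<in> {l..u}" "c \<in> {l..u}" "a < c" "a \<le> b" "b \<le> c"
  shows "(c - b) * g a + (b - a) * g c \<le> (c - a) * g b"
  by (rule concave_on_Icc_ineq[OF concave]) (use assms in auto)

lemma measurable_g [measurable]: "g \<in> borel_measurable (lebesgue_Icc l u)"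
  by (rule borel_measurable_concave_Icc[OF concave])

lemma integrable_exp_g: "integrable (lebesgue_Icc l u) (\<lambda>t. exp (g t))"
  using integrable_exp_concave[OF concave, of "\<lambda>_. 1" 1] by simp

text \<open>Cutting \<open>g\<close> down to the chord over a gap without observations leaves its
  values at the observations unchanged and lowers the integral, so optimality forbids
  \<open>g\<close> to exceed the chord.\<close>

lemma gap_affine:
  assumes ab: "a \<in> {l..u}" "b \<in> {l..u}" "a < b"
    and gap: "\<And>i. i < n \<Longrightarrow> x i \<notin> {a<..<b}"
  shows "\<exists>s. \<forall>t\<in>{a..b}. g t = g a + s * (t - a)"
proof -
  define s where "s = (g b - g a) / (b - a)"
  define c where "c t = g a + s * (t - a)" for t
  define k where "k t = min (g t) (c t)" for t
  have s: "s * (b - a) = g b - g a" using ab by (simp add: s_def)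
  have "c = (\<lambda>t. (g a - s * a) + s * t)" by (auto simp: c_def fun_eq_iff algebra_simps)
  then have "concave_on {l..u} c" by (simp add: concave_on_affine)
  then have k: "concave_on {l..u} k" unfolding k_def using concave by (intro concave_on_min)
  have c_eq: "(b - a) * c t = (b - t) * g a + (t - a) * g b" for t
  proof -
    have "(b - a) * c t = (b - a) * g a + (s * (b - a)) * (t - a)" by (simp add: c_def algebra_simps)
    then show ?thesis unfolding s by (simp add: algebra_simps)
  qed
  \<comment> \<open>Beyond the gap the extended chord lies above \<open>g\<close>, so taking the
    minimum changes \<open>g\<close> inside the gap only.\<close>
  have out: "g t \<le> c t" if t: "t \<in> {l..u}" "t \<notin> {a<..<b}" for t
  proof -
    have "(b - a) * g t \<le> (b - a) * c t"
    proof (cases "t \<le> a")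
      case True
      then show ?thesis using concave_ineq[of t b a] t ab unfolding c_eq by (simp add: algebra_simps)
    next
      case False
      then show ?thesis using concave_ineq[of a t b] t ab unfolding c_eq by (simp add: algebra_simps)
    qed
    then show ?thesis using ab by simp
  qed
  have inn: "c t \<le> g t" if t: "t \<in> {a..b}" for t
  proof -
    have "(b - a) * c t \<le> (b - a) * g t"
      using concave_ineq[of a b t] t ab unfolding c_eq by (simp add: algebra_simps)
    then show ?thesis using ab by simp
  qed
  have int_k: "integrable (lebesgue_Icc l u) (\<lambda>t. exp (k t))"
    using integrable_exp_concave[OF k, of "\<lambda>_. 1" 1] by simp
  have int_d: "integrable (lebesgue_Icc l u) (\<lambda>t. exp (g t) - exp (k t))"
    using integrable_exp_g int_k by (rule Bochner_Integration.integrable_diff)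
  have "k (x i) = g (x i)" if "i < n" for i
    using out[OF sample[OF that] gap[OF that]] by (simp add: k_def)
  then have le0: "(\<integral>t. exp (g t) - exp (k t) \<partial>lebesgue_Icc l u) \<le> 0"
    using optimal[OF k] integrable_exp_g int_k by simp
  have "g t = c t" if t: "t \<in> {a..b}" for t
  proof (rule ccontr)
    assume "g t \<noteq> c t"
    with inn[OF t] have pos: "0 < g t - c t" by simp
    then have "t \<noteq> a" by (auto simp: c_def)
    with t have ta: "a < t" by simp
    \<comment> \<open>The excess at a single point has to be turned into positive measure: by
      concavity at least half of it persists on \<open>{(a + t) / 2..t}\<close>.\<close>
    define \<eta> where "\<eta> = (g t - c t) / 2"
    have ge: "exp (min (g a) (g b)) * \<eta> \<le> exp (g y) - exp (k y)" if y: "y \<in> {(a + t) / 2..t}" for y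
    proof -
      have yab: "y \<in> {a..b}" using y t ta by auto
      have "(t - y) * g a + (y - a) * g t \<le> (t - a) * g y"
        using concave_ineq[of a t y] t ab y ta by auto
      moreover have "(t - y) * g a + (y - a) * c t = (t - a) * c y"
        by (simp add: c_def algebra_simps)
      ultimately have "(y - a) * (g t - c t) \<le> (t - a) * (g y - c y)"
        by (simp add: algebra_simps)
      moreover have "((t - a) / 2) * (g t - c t) \<le> (y - a) * (g t - c t)"
        using y pos by (intro mult_right_mono) auto
      ultimately have "(t - a) * \<eta> \<le> (t - a) * (g y - c y)"
        by (simp add: \<eta>_def field_simps)
      then have *: "\<eta> \<le> g y - c y" using ta by simp
      have "k y = c y" using inn[OF yab] by (simp add: k_def)
      have cm: "min (g a) (g b) \<le> c y"
      proof -
        have "(b - a) * min (g a) (g b) = (b - y) * min (g a) (g b) + (y - a) * min (g a) (g b)"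
          by (simp add: algebra_simps)
        also have "\<dots> \<le> (b - y) * g a + (y - a) * g b"
          using yab by (intro add_mono mult_left_mono) auto
        finally show ?thesis using ab unfolding c_eq[symmetric] by simp
      qed
      have "exp (min (g a) (g b)) * \<eta> \<le> exp (c y) * (g y - c y)"
        using cm * pos by (intro mult_mono) (auto simp: \<eta>_def)
      also have "\<dots> \<le> exp (c y) * (exp (g y - c y) - 1)"
      proof (intro mult_left_mono)
        show "g y - c y \<le> exp (g y - c y) - 1" using exp_ge_add_one_self[of "g y - c y"] by linarith
      qed simp
      also have "\<dots> = exp (g y) - exp (c y)"
        by (simp add: right_diff_distrib flip: exp_add)
      finally show ?thesis using \<open>k y = c y\<close> by simp
    qed
    have "exp (min (g a) (g b)) * \<eta> * (t - (a + t) / 2) \<le> (\<integral>t. exp (g t) - exp (k t) \<partial>lebesgue_Icc l u)"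
    proof (rule integral_lebesgue_Icc_ge[OF int_d _ _ _ _ ge])
      show "0 \<le> exp (g t) - exp (k t)" for t by (simp add: k_def)
    qed (use ta t ab in auto)
    moreover have "0 < exp (min (g a) (g b)) * \<eta> * (t - (a + t) / 2)"
      using pos ta by (intro mult_pos_pos) (auto simp: \<eta>_def)
    ultimately show False using le0 by simp
  qed
  then show ?thesis unfolding c_def by blast
qed

text \<open>
  A node is a point at which a small convex kink may be added. The end points \<open>l\<close> and \<open>u\<close> are nodes
  as well, as only the values of \<open>g\<close> on \<open>{l..u}\<close> matter.
\<close>

definition node :: "real \<Rightarrow> bool" where
  "node b \<longleftrightarrow> (\<exists>\<kappa>>0. concave_on {l..u} (\<lambda>t. g t + \<kappa> * \<bar>t - b\<bar>))"

lemma node_mirror: "concave_mle.node (-u) (-l) (\<lambda>t. g (-t)) (-b) \<longleftrightarrow> node b"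
proof -
  interpret m: concave_mle n "\<lambda>i. - x i" "-u" "-l" "\<lambda>t. g (-t)" by (rule mirror)
  have "concave_on {-u..-l} (\<lambda>t. g (-t) + \<kappa> * \<bar>t - -b\<bar>) \<longleftrightarrow> concave_on {l..u} (\<lambda>t. g t + \<kappa> * \<bar>t - b\<bar>)" for \<kappa>
  proof
    assume "concave_on {-u..-l} (\<lambda>t. g (-t) + \<kappa> * \<bar>t - -b\<bar>)"
    from concave_on_uminus_arg[OF this] show "concave_on {l..u} (\<lambda>t. g t + \<kappa> * \<bar>t - b\<bar>)"
      by (simp add: abs_minus_commute)
  next
    assume "concave_on {l..u} (\<lambda>t. g t + \<kappa> * \<bar>t - b\<bar>)"
    from concave_on_uminus_arg[OF this] show "concave_on {-u..-l} (\<lambda>t. g (-t) + \<kappa> * \<bar>t - -b\<bar>)"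
      by (simp add: abs_minus_commute add.commute)
  qed
  then show ?thesis unfolding node_def m.node_def by simp
qed

text \<open>On \<open>{l..u}\<close> the function \<open>\<bar>t - u\<bar>\<close> is affine, so any
  multiple of it may be added.\<close>

lemma node_right_end: "node u"
  unfolding node_def
proof (intro exI[of _ 1] conjI concave_on_IccI)
  fix a b c assume *: "a \<in> {l..u}" "c \<in> {l..u}" "a < b" "b < c"
  then have "(c - b) * g a + (b - a) * g c \<le> (c - a) * g b"
    by (intro concave_ineq) auto
  moreover have "\<bar>a - u\<bar> = u - a" "\<bar>b - u\<bar> = u - b" "\<bar>c - u\<bar> = u - c" using * by auto
  ultimately show "(c - b) * (g a + 1 * \<bar>a - u\<bar>) + (b - a) * (g c + 1 * \<bar>c - u\<bar>) \<le> (c - a) * (g b + 1 * \<bar>b - u\<bar>)"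
    by (simp add: algebra_simps)
qed simp

text \<open>A strict drop of the slope at \<open>b\<close> leaves room for a convex kink. With
  \<open>\<kappa> = (p - q) / 2\<close> the new slopes \<open>p - \<kappa>\<close> and
  \<open>q + \<kappa>\<close> on the two sides coincide, and this common slope supports the sum at
  \<open>b\<close>.\<close>

lemma node_kink:
  assumes a: "a \<in> {l..u}" and c: "c \<in> {l..u}" and abc: "a < b" "b < c"
    and p: "\<And>t. t \<in> {a..b} \<Longrightarrow> g t = g b + p * (t - b)"
    and q: "\<And>t. t \<in> {b..c} \<Longrightarrow> g t = g b + q * (t - b)"
    and ne: "p \<noteq> q"
  shows "node b"
proof -
  have b: "b \<in> {l..u}" using a c abc by auto
  have left: "g t \<le> g b + p * (t - b)" if t: "t \<in> {l..b}" for t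
  proof (cases "t < a")
    case True
    have "(b - a) * g t + (a - t) * g b \<le> (b - t) * g a"
      using concave_ineq[of t b a] True abc b t by auto
    moreover have "g a = g b + p * (a - b)" using p[of a] abc by auto
    ultimately have "(b - a) * g t \<le> (b - a) * (g b + p * (t - b))" by (simp add: algebra_simps)
    then show ?thesis using abc by simp
  next
    case False
    then show ?thesis using p[of t] t by auto
  qed
  have right: "g t \<le> g b + q * (t - b)" if t: "t \<in> {b..u}" for t
  proof (cases "c < t")
    case True
    have "(t - c) * g b + (c - b) * g t \<le> (t - b) * g c"
      using concave_ineq[of b t c] True abc b t by auto
    moreover have "g c = g b + q * (c - b)" using q[of c] abc by auto
    ultimately have "(c - b) * g t \<le> (c - b) * (g b + q * (t - b))" by (simp add: algebra_simps)
    then show ?thesis using abc by simp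
  next
    case False
    then show ?thesis using q[of t] t by auto
  qed
  have "(c - b) * g a + (b - a) * g c \<le> (c - a) * g b"
    using concave_ineq[of a c b] a c abc by auto
  moreover have "g a = g b + p * (a - b)" "g c = g b + q * (c - b)"
    using p[of a] q[of c] abc by auto
  ultimately have "(b - a) * (c - b) * q \<le> (b - a) * (c - b) * p" by (simp add: algebra_simps)
  then have pq: "q < p" using abc ne by simp
  define \<kappa> where "\<kappa> = (p - q) / 2"
  have "concave_on {l..u} (\<lambda>t. g t + \<kappa> * \<bar>t - b\<bar>)"
  proof (rule concave_on_Icc_glue[where b = b and p = "p - \<kappa>"])
    show "concave_on {l..b} (\<lambda>t. g t + \<kappa> * \<bar>t - b\<bar>)"
    proof (rule concave_on_IccI)
      fix r s t assume *: "r \<in> {l..b}" "t \<in> {l..b}" "r < s" "s < t"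
      then have "(t - s) * g r + (s - r) * g t \<le> (t - r) * g s" using b by (intro concave_ineq) auto
      then show "(t - s) * (g r + \<kappa> * \<bar>r - b\<bar>) + (s - r) * (g t + \<kappa> * \<bar>t - b\<bar>) \<le> (t - r) * (g s + \<kappa> * \<bar>s - b\<bar>)"
        using * by (simp add: algebra_simps)
    qed
    show "concave_on {b..u} (\<lambda>t. g t + \<kappa> * \<bar>t - b\<bar>)"
    proof (rule concave_on_IccI)
      fix r s t assume *: "r \<in> {b..u}" "t \<in> {b..u}" "r < s" "s < t"
      then have "(t - s) * g r + (s - r) * g t \<le> (t - r) * g s" using b by (intro concave_ineq) auto
      then show "(t - s) * (g r + \<kappa> * \<bar>r - b\<bar>) + (s - r) * (g t + \<kappa> * \<bar>t - b\<bar>) \<le> (t - r) * (g s + \<kappa> * \<bar>s - b\<bar>)"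
        using * by (simp add: algebra_simps)
    qed
    show "b \<in> {l..u}" by fact
    fix t assume t: "t \<in> {l..u}"
    show "g t + \<kappa> * \<bar>t - b\<bar> \<le> g b + \<kappa> * \<bar>b - b\<bar> + (p - \<kappa>) * (t - b)"
    proof (cases "t \<le> b")
      case True
      then show ?thesis using left[of t] t by (simp add: algebra_simps)
    next
      case False
      have "p - \<kappa> = q + \<kappa>" by (simp add: \<kappa>_def field_simps)
      then show ?thesis using right[of t] t False by (simp add: algebra_simps)
    qed
  qed
  moreover have "0 < \<kappa>" using pq by (simp add: \<kappa>_def)
  ultimately show ?thesis unfolding node_def by blast
qed

text \<open>The argument moves from observation to observation. At an observation that is no node
  the slope cannot change, so the affine pieces before and after it merge; the process ends at
  \<open>u\<close> at the latest.\<close>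

lemma next_node:
  assumes "d \<in> {l..u}"
  shows "\<exists>b\<in>{d..u}. node b \<and> (\<exists>s. \<forall>t\<in>{d..b}. g t = g d + s * (t - d))"
  using assms
proof (induction "card {i. i < n \<and> d < x i}" arbitrary: d rule: less_induct)
  case (less d)
  show ?case
  proof (cases "d = u")
    case True
    then show ?thesis using node_right_end by auto
  next
    case False
    \<comment> \<open>\<open>u\<close> is inserted so that a minimum exists even if no observation
      lies to the right of \<open>d\<close>.\<close>
    define Y where "Y = insert u (x ` {i. i < n \<and> d < x i})"
    define y where "y = Min Y"
    have fin: "finite Y" "Y \<noteq> {}" by (auto simp: Y_def)
    have yY: "y \<in> Y" using Min_in[OF fin] by (simp add: y_def)
    have dy: "d < y" using yY False less.prems by (auto simp: Y_def)
    have yu: "y \<le> u" using fin by (auto simp: y_def Y_def)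
    have gap: "x i \<notin> {d<..<y}" if "i < n" for i
      using Min_le[OF fin(1), of "x i"] that by (auto simp: y_def[symmetric]) (auto simp: Y_def)
    obtain s where s: "\<And>t. t \<in> {d..y} \<Longrightarrow> g t = g d + s * (t - d)"
    proof -
      have "d \<in> {l..u}" "y \<in> {l..u}" using dy yu less.prems by auto
      from gap_affine[OF this dy gap] show ?thesis using that by blast
    qed
    show ?thesis
    proof (cases "node y")
      case True
      moreover have "y \<in> {d..u}" using dy yu by simp
      ultimately show ?thesis using s by blast
    next
      case noy: False
      then have "y \<noteq> u" using node_right_end by auto
      with yY obtain j where j: "j < n" "y = x j" by (auto simp: Y_def)
      have "card {i. i < n \<and> y < x i} < card {i. i < n \<and> d < x i}"
        using j dy by (intro psubset_card_mono) auto
      moreover have "y \<in> {l..u}" using dy yu less.prems by auto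
      ultimately obtain b s' where b: "b \<in> {y..u}" "node b" "\<And>t. t \<in> {y..b} \<Longrightarrow> g t = g y + s' * (t - y)"
        using less.hyps[of y] by blast
      have "y < b" using b(1,2) noy by (cases "y = b") auto
      have gd: "g y = g d + s * (y - d)" using s[of y] dy by simp
      have "s = s'"
      proof (rule ccontr)
        assume "s \<noteq> s'"
        have "node y"
        proof (rule node_kink[OF _ _ dy \<open>y < b\<close> _ b(3) \<open>s \<noteq> s'\<close>])
          show "g t = g y + s * (t - y)" if "t \<in> {d..y}" for t
            using s[OF that] gd by (simp add: algebra_simps)
        qed (use less.prems b(1) dy yu in auto)
        with noy show False ..
      qed
      have "g t = g d + s * (t - d)" if "t \<in> {d..b}" for t
      proof (cases "t \<le> y")
        case True
        then show ?thesis using s[of t] that by simp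
      next
        case False
        then show ?thesis using b(3)[of t] gd that \<open>s = s'\<close> by (simp add: algebra_simps)
      qed
      moreover have "b \<in> {d..u}" using b(1) dy by simp
      ultimately show ?thesis using b(2) by blast
    qed
  qed
qed

text \<open>The one-sided derivative of the functional at \<open>g\<close>, in a direction that
  preserves concavity for small steps, is not positive. The quadratic remainder of
  \<open>exp\<close> disappears after division by \<epsilon>.\<close>

lemma variational:
  assumes D [measurable]: "D \<in> borel_measurable (lebesgue_Icc l u)"
    and K: "\<And>t. t \<in> {l..u} \<Longrightarrow> \<bar>D t\<bar> \<le> K"
    and \<mu>: "0 < \<mu>0" "concave_on {l..u} (\<lambda>t. g t + \<mu>0 * D t)"
  shows "(\<Sum>i<n. D (x i)) / n \<le> (\<integral>t. D t * exp (g t) \<partial>lebesgue_Icc l u)"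
proof -
  define c where "c = K\<^sup>2 * (\<integral>t. exp (g t) \<partial>lebesgue_Icc l u)"
  \<comment> \<open>The second bound ensures \<open>\<bar>\<epsilon> * D t\<bar> \<le> 1\<close>, as
    the quadratic estimate of \<open>exp\<close> requires.\<close>
  define \<mu>1 where "\<mu>1 = min \<mu>0 (1 / (\<bar>K\<bar> + 1))"
  have pos: "0 < \<mu>1" using \<mu> by (simp add: \<mu>1_def)
  have "0 \<le> K" using K[of l] l_less_u by force
  note intD = integrable_exp_concave[OF concave D K]
  have main: "(\<Sum>i<n. D (x i)) / n \<le> (\<integral>t. D t * exp (g t) \<partial>lebesgue_Icc l u) + \<epsilon> * c"
    if e: "0 < \<epsilon>" "\<epsilon> \<le> \<mu>1" for \<epsilon>
  proof -
    have conc: "concave_on {l..u} (\<lambda>t. g t + \<epsilon> * D t)"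
      by (rule concave_on_add_scaled[OF concave \<mu>(2)]) (use e in \<open>auto simp: \<mu>1_def\<close>)
    have int1: "integrable (lebesgue_Icc l u) (\<lambda>t. exp (g t + \<epsilon> * D t))"
      using integrable_exp_concave[OF conc, of "\<lambda>_. 1" 1] by simp
    from optimal[OF conc]
    have "\<epsilon> * ((\<Sum>i<n. D (x i)) / n)
        \<le> (\<integral>t. exp (g t + \<epsilon> * D t) \<partial>lebesgue_Icc l u) - (\<integral>t. exp (g t) \<partial>lebesgue_Icc l u)"
      by (simp add: sum.distrib add_divide_distrib sum_distrib_left)
    also have "\<dots> = (\<integral>t. exp (g t + \<epsilon> * D t) - exp (g t) \<partial>lebesgue_Icc l u)"
      using int1 integrable_exp_g by simp
    also have "\<dots> \<le> (\<integral>t. \<epsilon> * (D t * exp (g t)) + \<epsilon>\<^sup>2 * K\<^sup>2 * exp (g t) \<partial>lebesgue_Icc l u)"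
    proof (rule integral_mono)
      show "integrable (lebesgue_Icc l u) (\<lambda>t. exp (g t + \<epsilon> * D t) - exp (g t))"
        using int1 integrable_exp_g by simp
      show "integrable (lebesgue_Icc l u) (\<lambda>t. \<epsilon> * (D t * exp (g t)) + \<epsilon>\<^sup>2 * K\<^sup>2 * exp (g t))"
        using intD integrable_exp_g by simp
      fix t assume "t \<in> space (lebesgue_Icc l u)"
      then have t: "\<bar>D t\<bar> \<le> K" using K by (simp add: space_restrict_space)
      define v where "v = \<epsilon> * D t"
      have "\<bar>v\<bar> \<le> \<epsilon> * K" using t e by (simp add: v_def abs_mult)
      also have "\<epsilon> * K \<le> (1 / (\<bar>K\<bar> + 1)) * (\<bar>K\<bar> + 1)"
        using e \<open>0 \<le> K\<close> by (intro mult_mono) (auto simp: \<mu>1_def)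
      also have "\<dots> = 1" by (smt (verit) nonzero_eq_divide_eq)
      finally have v1: "\<bar>v\<bar> \<le> 1" .
      have "\<bar>v\<bar> \<le> \<bar>\<epsilon> * K\<bar>" using \<open>\<bar>v\<bar> \<le> \<epsilon> * K\<close> by simp
      then have v2: "v\<^sup>2 \<le> \<epsilon>\<^sup>2 * K\<^sup>2" unfolding power_mult_distrib[symmetric] abs_le_square_iff .
      have "exp v \<le> 1 + v + v\<^sup>2" using v1 by (intro exp_le_quadratic) auto
      with v2 have "exp (g t) * (exp v - 1) \<le> exp (g t) * (v + \<epsilon>\<^sup>2 * K\<^sup>2)"
        by (intro mult_left_mono) auto
      then show "exp (g t + \<epsilon> * D t) - exp (g t) \<le> \<epsilon> * (D t * exp (g t)) + \<epsilon>\<^sup>2 * K\<^sup>2 * exp (g t)"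
        by (simp add: exp_add v_def algebra_simps)
    qed
    also have "\<dots> = \<epsilon> * ((\<integral>t. D t * exp (g t) \<partial>lebesgue_Icc l u) + \<epsilon> * c)"
      using intD integrable_exp_g by (simp add: c_def algebra_simps power2_eq_square)
    finally show ?thesis using e(1) by (rule mult_left_le_imp_le)
  qed
  have "((\<lambda>\<epsilon>. (\<integral>t. D t * exp (g t) \<partial>lebesgue_Icc l u) + \<epsilon> * c) \<longlongrightarrow>
      (\<integral>t. D t * exp (g t) \<partial>lebesgue_Icc l u) + 0 * c) (at_right 0)"
    by (intro tendsto_intros)
  moreover have "eventually (\<lambda>\<epsilon>. (\<Sum>i<n. D (x i)) / n \<le> (\<integral>t. D t * exp (g t) \<partial>lebesgue_Icc l u) + \<epsilon> * c) (at_right 0)"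
    using pos main unfolding eventually_at_right_field by (intro exI[of _ \<mu>1]) auto
  ultimately have "(\<Sum>i<n. D (x i)) / n \<le> (\<integral>t. D t * exp (g t) \<partial>lebesgue_Icc l u) + 0 * c"
    by (rule tendsto_lowerbound) simp
  then show ?thesis by simp
qed

end

subsection \<open>Test functions cut off at knots\<close>

context concave_mle begin

lemma node_left_end: "node l"
proof -
  interpret m: concave_mle n "\<lambda>i. - x i" "-u" "-l" "\<lambda>t. g (-t)" by (rule mirror)
  show ?thesis using m.node_right_end node_mirror[of l] by simp
qed

text \<open>
  As \<open>S\<close> grows, the perturbations \<open>D S\<close> below converge to \<open>w\<close> cut off outside \<open>{a..b}\<close>; their only convex
  kinks are those at the nodes \<open>a\<close> and \<open>b\<close>.
\<close>

lemma test_inequality: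
  assumes a: "node a" "a \<in> {l..u}" and b: "node b" "b \<in> {l..u}" and ab: "a \<le> b"
    and w: "concave_on {l..u} w" "w a \<le> 0" "w b \<le> 0"
    and lip: "\<And>s t. s \<in> {l..u} \<Longrightarrow> t \<in> {l..u} \<Longrightarrow> \<bar>w s - w t\<bar> \<le> \<Lambda> * \<bar>s - t\<bar>"
  shows "(\<Sum>i<n. indicator {a..b} (x i) * w (x i)) / n
    \<le> (\<integral>t. (indicator {a..b} t * w t) * exp (g t) \<partial>lebesgue_Icc l u)"
proof -
  obtain K where K: "\<And>t. t \<in> {l..u} \<Longrightarrow> \<bar>w t\<bar> \<le> K"
    using concave_on_Icc_bounded[OF w(1)] by blast
  obtain \<kappa>a where \<kappa>a: "0 < \<kappa>a" "concave_on {l..u} (\<lambda>t. g t + \<kappa>a * \<bar>t - a\<bar>)"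
    using a unfolding node_def by blast
  obtain \<kappa>b where \<kappa>b: "0 < \<kappa>b" "concave_on {l..u} (\<lambda>t. g t + \<kappa>b * \<bar>t - b\<bar>)"
    using b unfolding node_def by blast
  \<comment> \<open>Outside \<open>{a..b}\<close> the concave \<open>C S\<close> falls with slope of
    order \<open>S\<close>. The summands added in \<open>D S\<close> are convex hinges at
    \<open>b\<close> and \<open>a\<close> that lift it back to 0 as \<open>S\<close> grows.\<close>
  define C where "C S t = min (w t) (min (S * (b - t)) (S * (t - a)))" for S t :: real
  define D where "D S t = C S t + S * max 0 (t - b) + S * max 0 (a - t)" for S t :: real
  have concC: "concave_on {l..u} (C S)" for S
  proof -
    have "concave_on {l..u} (\<lambda>t. S * b + (- S) * t)" "concave_on {l..u} (\<lambda>t. - S * a + S * t)"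
      by (intro concave_on_affine; simp)+
    then show ?thesis
      unfolding C_def using w(1) by (intro concave_on_min) (auto simp: algebra_simps)
  qed
  \<comment> \<open>As \<open>w\<close> is at most 0 at both ends, its Lipschitz bound puts the two
    steep lines above \<open>w\<close> on \<open>{a..b}\<close> once \<open>S\<close> reaches
    \<Lambda>.\<close>
  have D_in: "D S t = w t" if S: "\<Lambda> \<le> S" and t: "t \<in> {a..b}" for S t
  proof -
    have tl: "t \<in> {l..u}" using t a b by auto
    have "w t \<le> w b + \<Lambda> * (b - t)" using lip[OF tl b(2)] t by auto
    moreover have "w t \<le> w a + \<Lambda> * (t - a)" using lip[OF tl a(2)] t by auto
    moreover have "\<Lambda> * (b - t) \<le> S * (b - t)" "\<Lambda> * (t - a) \<le> S * (t - a)"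
      using S t by (auto intro!: mult_right_mono)
    ultimately show ?thesis using t w unfolding D_def C_def by auto
  qed
  have D_right: "D S t = min 0 (w t + S * (t - b))" if S: "0 < S" and t: "b < t" for S t
  proof -
    have "S * (t - a) > 0" "S * (b - t) < 0" using S t ab by (auto simp: mult_pos_neg)
    then have "min (S * (b - t)) (S * (t - a)) = S * (b - t)" by linarith
    then show ?thesis using t ab unfolding D_def C_def by (auto simp: min_def algebra_simps)
  qed
  have D_left: "D S t = min 0 (w t + S * (a - t))" if S: "0 < S" and t: "t < a" for S t
  proof -
    have "S * (b - t) > 0" "S * (t - a) < 0" using S t ab by (auto simp: mult_pos_neg)
    then have "min (S * (b - t)) (S * (t - a)) = S * (t - a)" by linarith
    then show ?thesis using t ab unfolding D_def C_def by (auto simp: min_def algebra_simps)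
  qed
  have D_bound: "\<bar>D S t\<bar> \<le> K" if S: "\<Lambda> \<le> S" "0 < S" and t: "t \<in> {l..u}" for S t
  proof -
    consider "t \<in> {a..b}" | "b < t" | "t < a" by force
    then show ?thesis
    proof cases
      case 1
      then show ?thesis using D_in[OF S(1) 1] K[OF t] by simp
    next
      case 2
      have "\<Lambda> * (t - b) \<le> S * (t - b)" using S 2 by (auto intro!: mult_right_mono)
      moreover have "\<bar>w t - w b\<bar> \<le> \<Lambda> * (t - b)" using lip[OF t b(2)] 2 by simp
      ultimately have "w b \<le> w t + S * (t - b)" by linarith
      then show ?thesis using K[OF b(2)] D_right[OF S(2) 2] by auto
    next
      case 3
      have "\<Lambda> * (a - t) \<le> S * (a - t)" using S 3 by (auto intro!: mult_right_mono)
      moreover have "\<bar>w t - w a\<bar> \<le> \<Lambda> * (a - t)" using lip[OF t a(2)] 3 by simp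
      ultimately have "w a \<le> w t + S * (a - t)" by linarith
      then show ?thesis using K[OF a(2)] D_left[OF S(2) 3] by auto
    qed
  qed
  have [measurable]: "D S \<in> borel_measurable (lebesgue_Icc l u)" for S
    using borel_measurable_concave_Icc[OF concC[of S]] unfolding D_def
    by (intro borel_measurable_add) (auto intro!: measurable_restrict_space1)
  have ineq: "(\<Sum>i<n. D S (x i)) / n \<le> (\<integral>t. D S t * exp (g t) \<partial>lebesgue_Icc l u)"
    if S: "\<Lambda> \<le> S" "0 < S" for S
  proof (rule variational)
    define \<mu> where "\<mu> = min \<kappa>a \<kappa>b"
    have \<mu>: "0 < \<mu>" "\<mu> \<le> \<kappa>a" "\<mu> \<le> \<kappa>b" using \<kappa>a(1) \<kappa>b(1) by (auto simp: \<mu>_def)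
    then show "0 < \<mu> / S" using S by simp
    have ca: "concave_on {l..u} (\<lambda>t. g t + \<mu> * \<bar>t - a\<bar>)" and cb: "concave_on {l..u} (\<lambda>t. g t + \<mu> * \<bar>t - b\<bar>)"
      using concave_on_add_scaled[OF concave \<kappa>a(2), of \<mu>] concave_on_add_scaled[OF concave \<kappa>b(2), of \<mu>] \<mu>
      by simp_all
    \<comment> \<open>\<open>max 0 (t - b)\<close> is half of
      \<open>\<bar>t - b\<bar> + (t - b)\<close>, and similarly at \<open>a\<close>. So half of each
      admissible kink is spent, and the linear parts add up to the constant
      \<open>\<mu> / 2 * (a - b)\<close>.\<close>
    have "concave_on {l..u} (\<lambda>t. (1/2) * (g t + \<mu> * \<bar>t - a\<bar>) + (1/2) * (g t + \<mu> * \<bar>t - b\<bar>)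
        + (\<mu> / S) * C S t + (\<mu> / 2 * (a - b) + 0 * t))"
      by (rule concave_on_add[OF concave_on_add[OF concave_on_add[OF concave_on_cmul[OF _ ca] concave_on_cmul[OF _ cb]]
            concave_on_cmul[OF _ concC[of S]]] concave_on_affine]) (use \<open>0 < \<mu> / S\<close> in auto)
    also have "(\<lambda>t. (1/2) * (g t + \<mu> * \<bar>t - a\<bar>) + (1/2) * (g t + \<mu> * \<bar>t - b\<bar>)
        + (\<mu> / S) * C S t + (\<mu> / 2 * (a - b) + 0 * t)) = (\<lambda>t. g t + \<mu> / S * D S t)"
    proof
      fix t
      have abs: "\<bar>t - b\<bar> = 2 * max 0 (t - b) - (t - b)" "\<bar>t - a\<bar> = 2 * max 0 (a - t) - (a - t)"
        by (auto simp: max_def abs_if)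
      have "\<mu> / S * D S t = \<mu> / S * C S t + \<mu> * max 0 (t - b) + \<mu> * max 0 (a - t)"
        using S by (simp add: D_def distrib_left)
      then show "(1/2) * (g t + \<mu> * \<bar>t - a\<bar>) + (1/2) * (g t + \<mu> * \<bar>t - b\<bar>)
        + (\<mu> / S) * C S t + (\<mu> / 2 * (a - b) + 0 * t) = g t + \<mu> / S * D S t"
        unfolding abs by (simp add: algebra_simps diff_divide_distrib)
    qed
    finally show "concave_on {l..u} (\<lambda>t. g t + \<mu> / S * D S t)" .
  qed (use D_bound[OF S] in auto)
  have lim: "(\<lambda>k. D (real k) t) \<longlonglongrightarrow> indicator {a..b} t * w t" for t
  proof (rule tendsto_eventually)
    have ev: "\<forall>\<^sub>F k in sequentially. c \<le> real k" for c
      using filterlim_real_sequentially unfolding filterlim_at_top by auto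
    consider "t \<in> {a..b}" | "b < t" | "t < a" by force
    then show "\<forall>\<^sub>F k in sequentially. D (real k) t = indicator {a..b} t * w t"
    proof cases
      case 1
      show ?thesis using ev[of \<Lambda>] by eventually_elim (use D_in[OF _ 1] 1 in simp)
    next
      case 2
      show ?thesis using ev[of 1] ev[of "- w t / (t - b)"]
      proof eventually_elim
        case (elim k)
        then have "0 \<le> w t + real k * (t - b)" using 2 by (simp add: field_simps)
        then show ?case using D_right[of "real k" t] elim 2 by simp
      qed
    next
      case 3
      show ?thesis using ev[of 1] ev[of "- w t / (a - t)"]
      proof eventually_elim
        case (elim k)
        then have "0 \<le> w t + real k * (a - t)" using 3 by (simp add: field_simps)
        then show ?case using D_left[of "real k" t] elim 3 by simp
      qed
    qed
  qed
  define k0 where "k0 = nat \<lceil>max \<Lambda> 1\<rceil>"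
  have k0: "\<Lambda> \<le> real (k + k0)" "0 < real (k + k0)" for k
    unfolding k0_def by linarith+
  have "(\<lambda>k. (\<Sum>i<n. D (real (k + k0)) (x i)) / n) \<longlonglongrightarrow> (\<Sum>i<n. indicator {a..b} (x i) * w (x i)) / n"
    using lim by (intro tendsto_intros LIMSEQ_ignore_initial_segment) (use n_pos in auto)
  moreover have "(\<lambda>k. \<integral>t. D (real (k + k0)) t * exp (g t) \<partial>lebesgue_Icc l u)
      \<longlonglongrightarrow> (\<integral>t. (indicator {a..b} t * w t) * exp (g t) \<partial>lebesgue_Icc l u)"
  proof (rule integral_dominated_convergence[where w = "\<lambda>t. K * exp (g t)"])
    note [measurable] = borel_measurable_concave_Icc[OF w(1)]
    have [measurable]: "indicat_real {a..b} \<in> borel_measurable (lebesgue_Icc l u)"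
      by (intro measurable_restrict_space1) simp
    show "(\<lambda>t. (indicator {a..b} t * w t) * exp (g t)) \<in> borel_measurable (lebesgue_Icc l u)"
      by measurable
    show "(\<lambda>t. D (real (k + k0)) t * exp (g t)) \<in> borel_measurable (lebesgue_Icc l u)" for k
      by measurable
    show "integrable (lebesgue_Icc l u) (\<lambda>t. K * exp (g t))"
      using integrable_exp_g by simp
    show "AE t in lebesgue_Icc l u. (\<lambda>k. D (real (k + k0)) t * exp (g t)) \<longlonglongrightarrow> (indicator {a..b} t * w t) * exp (g t)"
      using lim by (intro AE_I2 tendsto_intros LIMSEQ_ignore_initial_segment)
    show "AE t in lebesgue_Icc l u. norm (D (real (k + k0)) t * exp (g t)) \<le> K * exp (g t)" for k
      using D_bound[OF k0] by (intro AE_I2) (auto simp: space_restrict_space abs_mult)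
  qed
  ultimately show ?thesis
    by (rule LIMSEQ_le) (use ineq[OF k0] in auto)
qed

end

text \<open>The whole stochastic input in deterministic form: the sample is fixed, and its empirical
  measure is close to the true one on all intervals. The summand
  \<open>sqrt (\<rho> * (z - y))\<close> is on the scale of the standard deviation; \<rho> itself
  takes over on very short intervals.\<close>

locale mle_deviation = concave_mle +
  fixes \<phi> :: "real \<Rightarrow> real" and C \<rho> :: real
  assumes concave_\<phi>: "concave_on {l..u} \<phi>"
    and C_nonneg: "0 \<le> C" and \<rho>_nonneg: "0 \<le> \<rho>"
    and deviation: "\<And>y z. l \<le> y \<Longrightarrow> y \<le> z \<Longrightarrow> z \<le> u \<Longrightarrow>
      \<bar>(\<Sum>i<n. indicator {y..z} (x i)) / n - (\<integral>t. indicator {y..z} t * exp (\<phi> t) \<partial>lebesgue_Icc l u)\<bar>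
        \<le> C * (sqrt (\<rho> * (z - y)) + \<rho>)"
begin

lemma mirror_deviation: "mle_deviation n (\<lambda>i. - x i) (-u) (-l) (\<lambda>t. g (-t)) (\<lambda>t. \<phi> (-t)) C \<rho>"
proof (intro mle_deviation.intro mirror mle_deviation_axioms.intro)
  show "concave_on {-u..-l} (\<lambda>t. \<phi> (-t))" by (rule concave_on_uminus_arg[OF concave_\<phi>])
  fix y z assume *: "-u \<le> y" "y \<le> z" "z \<le> -l"
  have ind: "indicat_real {y..z} (-t) = indicator {-z..-y} t" for t by (auto simp: indicator_def)
  show "\<bar>(\<Sum>i<n. indicator {y..z} (- x i)) / n - (\<integral>t. indicator {y..z} t * exp (\<phi> (-t)) \<partial>lebesgue_Icc (-u) (-l))\<bar>
        \<le> C * (sqrt (\<rho> * (z - y)) + \<rho>)"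
    using deviation[of "-z" "-y"] * by (simp add: integral_lebesgue_Icc_uminus ind)
qed (use C_nonneg \<rho>_nonneg in auto)

lemma measurable_\<phi> [measurable]: "\<phi> \<in> borel_measurable (lebesgue_Icc l u)"
  by (rule borel_measurable_concave_Icc[OF concave_\<phi>])

lemma measurable_indicator_Icc [measurable]: "indicat_real {y..z} \<in> borel_measurable (lebesgue_Icc l u)"
  by (rule measurable_restrict_space1) simp

definition dev :: "(real \<Rightarrow> real) \<Rightarrow> real" where
  "dev w = (\<Sum>i<n. w (x i)) / n - (\<integral>t. w t * exp (\<phi> t) \<partial>lebesgue_Icc l u)"

definition err :: "real \<Rightarrow> real" where
  "err r = C * (sqrt (\<rho> * r) + \<rho>)"

lemma err_mono: "0 \<le> r \<Longrightarrow> r \<le> s \<Longrightarrow> err r \<le> err s"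
  unfolding err_def using C_nonneg \<rho>_nonneg by (intro mult_left_mono add_mono real_sqrt_le_mono) auto

lemma err_nonneg: "0 \<le> r \<Longrightarrow> 0 \<le> err r"
  unfolding err_def using C_nonneg \<rho>_nonneg by auto

lemma err_add: "0 \<le> r \<Longrightarrow> 0 \<le> s \<Longrightarrow> err (r + s) \<le> err r + err s"
proof -
  assume "0 \<le> r" "0 \<le> s"
  then have "sqrt (\<rho> * r + \<rho> * s) \<le> sqrt (\<rho> * r) + sqrt (\<rho> * s)"
    using \<rho>_nonneg by (intro sqrt_add_le_add_sqrt) auto
  then have "C * (sqrt (\<rho> * (r + s)) + \<rho>) \<le> C * ((sqrt (\<rho> * r) + \<rho>) + (sqrt (\<rho> * s) + \<rho>))"
    using C_nonneg \<rho>_nonneg by (intro mult_left_mono) (auto simp: distrib_left)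
  then show ?thesis by (simp add: err_def algebra_simps)
qed

lemma dev_indicator: "l \<le> y \<Longrightarrow> y \<le> z \<Longrightarrow> z \<le> u \<Longrightarrow> \<bar>dev (indicator {y..z})\<bar> \<le> err (z - y)"
  using deviation[of y z] by (simp add: dev_def err_def)

lemma integrable_exp_\<phi>:
  "w \<in> borel_measurable (lebesgue_Icc l u) \<Longrightarrow> (\<And>t. t \<in> {l..u} \<Longrightarrow> \<bar>w t\<bar> \<le> K) \<Longrightarrow>
    integrable (lebesgue_Icc l u) (\<lambda>t. w t * exp (\<phi> t))"
  by (rule integrable_exp_concave[OF concave_\<phi>])

lemma dev_add:
  "integrable (lebesgue_Icc l u) (\<lambda>t. v t * exp (\<phi> t)) \<Longrightarrow> integrable (lebesgue_Icc l u) (\<lambda>t. w t * exp (\<phi> t)) \<Longrightarrow>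
    dev (\<lambda>t. v t + w t) = dev v + dev w"
  by (simp add: dev_def sum.distrib add_divide_distrib distrib_right)

lemma dev_scale: "dev (\<lambda>t. c * w t) = c * dev w"
  by (simp add: dev_def sum_distrib_left right_diff_distrib mult.assoc flip: sum_distrib_left)

lemma dev_sum:
  assumes "finite J" "\<And>j. j \<in> J \<Longrightarrow> integrable (lebesgue_Icc l u) (\<lambda>t. w j t * exp (\<phi> t))"
  shows "dev (\<lambda>t. \<Sum>j\<in>J. w j t) = (\<Sum>j\<in>J. dev (w j))"
proof -
  have "(\<Sum>i<n. \<Sum>j\<in>J. w j (x i)) = (\<Sum>j\<in>J. \<Sum>i<n. w j (x i))" by (rule sum.swap)
  then show ?thesis
    using assms by (simp add: dev_def sum_subtractf sum_divide_distrib sum_distrib_right)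
qed

text \<open>A crude bound; it absorbs the vanishing discretisation error of a ramp.\<close>

lemma dev_bound:
  assumes "w \<in> borel_measurable (lebesgue_Icc l u)" "\<And>t. t \<in> {l..u} \<Longrightarrow> \<bar>w t\<bar> \<le> K"
  shows "\<bar>dev w\<bar> \<le> K * (1 + (\<integral>t. exp (\<phi> t) \<partial>lebesgue_Icc l u))"
proof -
  have "\<bar>\<Sum>i<n. w (x i)\<bar> \<le> (\<Sum>i<n. K)"
    by (rule order_trans[OF sum_abs sum_mono]) (use assms(2) sample in auto)
  then have 1: "\<bar>(\<Sum>i<n. w (x i)) / n\<bar> \<le> K" using n_pos by (simp add: field_simps abs_mult)
  have "\<bar>\<integral>t. w t * exp (\<phi> t) \<partial>lebesgue_Icc l u\<bar> \<le> (\<integral>t. K * exp (\<phi> t) \<partial>lebesgue_Icc l u)"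
  proof (rule integral_abs_bound_integral)
    show "integrable (lebesgue_Icc l u) (\<lambda>t. w t * exp (\<phi> t))"
      using assms by (rule integrable_exp_\<phi>)
    show "integrable (lebesgue_Icc l u) (\<lambda>t. K * exp (\<phi> t))"
      by (rule integrable_exp_\<phi>[where K = "\<bar>K\<bar>"]) auto
  qed (use assms(2) in \<open>auto simp: space_restrict_space abs_mult\<close>)
  then have 2: "\<bar>\<integral>t. w t * exp (\<phi> t) \<partial>lebesgue_Icc l u\<bar> \<le> K * (\<integral>t. exp (\<phi> t) \<partial>lebesgue_Icc l u)" by simp
  show ?thesis unfolding dev_def distrib_left using abs_triangle_ineq4 1 2 by (smt (verit))
qed

text \<open>The ramp is \<open>b - m\<close> times the average of the indicators of
  \<open>{y..b}\<close> over \<open>y\<close> in \<open>{m..b}\<close>. Each of them deviates by at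
  most \<open>err (b - m)\<close>, hence so does the average. Riemann sums replace the integral over
  \<open>y\<close>.\<close>

lemma dev_ramp_right:
  assumes "l \<le> m" "m \<le> b" "b \<le> u"
  shows "\<bar>dev (\<lambda>t. indicator {m..b} t * (t - m))\<bar> \<le> (b - m) * err (b - m)"
proof (cases "m = b")
  case True
  have "(\<lambda>t. indicat_real {m..b} t * (t - m)) = (\<lambda>t. 0)" using True by (auto simp: fun_eq_iff indicator_def)
  then show ?thesis using True by (simp add: dev_def)
next
  case False
  with assms have mb: "m < b" by simp
  define I where "I = 1 + (\<integral>t. exp (\<phi> t) \<partial>lebesgue_Icc l u)"
  define r where "r t = indicat_real {m..b} t * (t - m)" for t
  have *: "\<bar>dev r\<bar> \<le> (b - m) * err (b - m) + (b - m) * I / real N" if N: "0 < N" for N :: nat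
  proof -
    define v where "v = (b - m) / N"
    have v: "0 < v" "N * v = b - m" using mb N by (auto simp: v_def)
    define s where "s t = v * (\<Sum>j\<in>{1..N}. indicat_real {m + j * v..b} t)" for t
    have [measurable]: "r \<in> borel_measurable (lebesgue_Icc l u)" "s \<in> borel_measurable (lebesgue_Icc l u)"
      unfolding r_def s_def by (intro measurable_restrict_space1; simp)+
    \<comment> \<open>The staircase counts the steps already passed, so it lags behind the ramp by
      at most one step \<open>v\<close>.\<close>
    have rs: "\<bar>r t - s t\<bar> \<le> v" for t
    proof (cases "t \<in> {m..b}")
      case True
      define k where "k = nat \<lfloor>(t - m) / v\<rfloor>"
      have q0: "0 \<le> (t - m) / v" using True v by simp
      then have k: "real k \<le> (t - m) / v" "(t - m) / v < real k + 1" unfolding k_def by linarith+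
      have "t - m \<le> N * v" using True v by simp
      then have "(t - m) / v \<le> N" using v by (simp add: divide_le_eq)
      then have kN: "k \<le> N" using k by linarith
      have iff: "m + j * v \<le> t \<longleftrightarrow> j \<le> k" for j :: nat
      proof -
        have "m + j * v \<le> t \<longleftrightarrow> j \<le> (t - m) / v" using v by (simp add: le_divide_eq algebra_simps)
        also have "\<dots> \<longleftrightarrow> j \<le> k" using k by linarith
        finally show ?thesis .
      qed
      have "(\<Sum>j\<in>{1..N}. indicat_real {m + j * v..b} t) = (\<Sum>j\<in>{1..N}. if j \<le> k then 1 else 0)"
        using True iff by (intro sum.cong) (auto simp: indicator_def)
      also have "\<dots> = real (card {j \<in> {1..N}. j \<le> k})" by (simp add: sum.If_cases Int_def)
      also have "{j \<in> {1..N}. j \<le> k} = {1..k}" using kN by auto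
      finally have "s t = v * k" by (simp add: s_def)
      moreover have "r t = t - m" using True by (simp add: r_def)
      moreover have "k * v \<le> t - m" "t - m < (k + 1) * v"
        using k v by (auto simp: field_simps)
      ultimately show ?thesis by (simp add: algebra_simps)
    next
      case False
      have "indicat_real {m + j * v..b} t = 0" for j :: nat
        using False v by (auto simp: indicator_def) (smt (verit) mult_nonneg_nonneg of_nat_0_le_iff)
      then show ?thesis using False v by (simp add: r_def s_def)
    qed
    have int_s: "integrable (lebesgue_Icc l u) (\<lambda>t. s t * exp (\<phi> t))"
    proof (rule integrable_exp_\<phi>)
      show "\<bar>s t\<bar> \<le> \<bar>v\<bar> * N" for t
      proof -
        have "\<bar>\<Sum>j\<in>{1..N}. indicat_real {m + j * v..b} t\<bar> \<le> (\<Sum>j\<in>{1..N}. 1)"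
          by (rule order_trans[OF sum_abs sum_mono]) (auto simp: indicator_def)
        then show ?thesis by (simp add: s_def abs_mult mult_left_mono)
      qed
    qed measurable
    have int_d: "integrable (lebesgue_Icc l u) (\<lambda>t. (r t - s t) * exp (\<phi> t))"
      by (rule integrable_exp_\<phi>[where K = v]) (use rs in auto)
    have "dev r = dev (\<lambda>t. s t + (r t - s t))" by simp
    also have "\<dots> = dev s + dev (\<lambda>t. r t - s t)" by (rule dev_add[OF int_s int_d])
    finally have "\<bar>dev r\<bar> \<le> \<bar>dev s\<bar> + \<bar>dev (\<lambda>t. r t - s t)\<bar>" by linarith
    moreover have "\<bar>dev (\<lambda>t. r t - s t)\<bar> \<le> v * I"
      unfolding I_def by (rule dev_bound) (use rs in auto)
    moreover have "\<bar>dev s\<bar> \<le> (b - m) * err (b - m)"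
    proof -
      have "dev s = v * (\<Sum>j\<in>{1..N}. dev (indicator {m + real j * v..b}))"
        unfolding s_def[abs_def]
        by (subst dev_scale, subst dev_sum) (auto intro!: integrable_exp_\<phi>[where K = 1] simp: indicator_le_1)
      also have "\<bar>\<dots>\<bar> \<le> v * (\<Sum>j\<in>{1..N}. err (b - m))"
        unfolding abs_mult
      proof (intro mult_mono order_trans[OF sum_abs] sum_mono)
        fix j assume j: "j \<in> {1..N}"
        have jv: "j * v \<le> b - m" "0 \<le> j * v"
          unfolding v(2)[symmetric] using j v(1) by (auto intro!: mult_right_mono)
        have "\<bar>dev (indicator {m + j * v..b})\<bar> \<le> err (b - (m + j * v))"
          by (rule dev_indicator) (use jv assms in linarith)+
        also have "\<dots> \<le> err (b - m)" by (rule err_mono) (use jv in linarith)+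
        finally show "\<bar>dev (indicator {m + real j * v..b})\<bar> \<le> err (b - m)" .
      qed (use v in auto)
      also have "\<dots> = (b - m) * err (b - m)" using v by (simp add: mult.assoc[symmetric] mult.commute)
      finally show ?thesis .
    qed
    ultimately show ?thesis by (simp add: v_def)
  qed
  have "(\<lambda>N. (b - m) * err (b - m) + (b - m) * I / real N) \<longlonglongrightarrow> (b - m) * err (b - m) + 0"
    by (intro tendsto_intros lim_const_over_n)
  then have "\<bar>dev r\<bar> \<le> (b - m) * err (b - m) + 0"
    by (rule LIMSEQ_le_const) (use * in \<open>auto intro!: exI[of _ 1]\<close>)
  then show ?thesis by (simp add: r_def[abs_def])
qed

lemma dev_ramp_left:
  assumes "l \<le> a" "a \<le> m" "m \<le> u"
  shows "\<bar>dev (\<lambda>t. indicator {a..m} t * (m - t))\<bar> \<le> (m - a) * err (m - a)"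
proof -
  interpret r: mle_deviation n "\<lambda>i. - x i" "-u" "-l" "\<lambda>t. g (-t)" "\<lambda>t. \<phi> (-t)" C \<rho>
    by (rule mirror_deviation)
  have ind: "indicat_real {-m..-a} (-t) = indicator {a..m} t" for t by (auto simp: indicator_def)
  show ?thesis
    using r.dev_ramp_right[of "-m" "-a"] assms
    by (simp add: r.dev_def dev_def r.err_def err_def integral_lebesgue_Icc_uminus ind)
qed

text \<open>\<open>w\<close> is a tent with peak \<gamma> at \<open>m\<close>. Optimality bounds the
  integral by \<open>- dev\<close>, and the cut-off tent is one indicator minus two ramps, whose
  deviations are known. For \<gamma> = 0 it can degenerate to a ramp, which serves an excess; a
  deficit needs \<gamma> = 1.\<close>

lemma test_bound:
  fixes \<gamma> \<alpha> \<alpha>' m :: real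
  defines "w \<equiv> \<lambda>t. \<gamma> - \<alpha> * max 0 (t - m) - \<alpha>' * max 0 (m - t)"
  assumes a: "node a" "a \<in> {l..u}" and b: "node b" "b \<in> {l..u}" and m: "m \<in> {a..b}"
    and nn: "0 \<le> \<gamma>" "0 \<le> \<alpha>" "0 \<le> \<alpha>'" and ends: "\<gamma> \<le> \<alpha> * (b - m)" "\<gamma> \<le> \<alpha>' * (m - a)"
  shows "(\<integral>t. indicator {a..b} t * w t * (exp (\<phi> t) - exp (g t)) \<partial>lebesgue_Icc l u)
    \<le> \<gamma> * err (b - a) + \<alpha> * ((b - m) * err (b - m)) + \<alpha>' * ((m - a) * err (m - a))"
proof -
  have lip: "\<bar>w s - w t\<bar> \<le> (\<alpha> + \<alpha>') * \<bar>s - t\<bar>" for s t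
  proof -
    have "\<bar>max 0 (t - m) - max 0 (s - m)\<bar> \<le> \<bar>s - t\<bar>" "\<bar>max 0 (m - t) - max 0 (m - s)\<bar> \<le> \<bar>s - t\<bar>" by auto
    then have "\<alpha> * \<bar>max 0 (t - m) - max 0 (s - m)\<bar> + \<alpha>' * \<bar>max 0 (m - t) - max 0 (m - s)\<bar> \<le> \<alpha> * \<bar>s - t\<bar> + \<alpha>' * \<bar>s - t\<bar>"
      using nn by (intro add_mono mult_left_mono) auto
    moreover have "w s - w t = \<alpha> * (max 0 (t - m) - max 0 (s - m)) + \<alpha>' * (max 0 (m - t) - max 0 (m - s))"
      by (simp add: w_def algebra_simps)
    moreover have "\<bar>\<alpha> * (max 0 (t - m) - max 0 (s - m)) + \<alpha>' * (max 0 (m - t) - max 0 (m - s))\<bar>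
       \<le> \<alpha> * \<bar>max 0 (t - m) - max 0 (s - m)\<bar> + \<alpha>' * \<bar>max 0 (m - t) - max 0 (m - s)\<bar>"
      using nn by (intro order_trans[OF abs_triangle_ineq]) (simp add: abs_mult)
    ultimately show ?thesis by (simp add: distrib_right)
  qed
  have concw: "concave_on {l..u} w"
  proof (rule concave_on_IccI)
    fix r s t :: real assume *: "r \<in> {l..u}" "t \<in> {l..u}" "r < s" "s < t"
    have p: "(t - r) * max 0 (s - m) \<le> (t - s) * max 0 (r - m) + (s - r) * max 0 (t - m)"
      if "r < s" "s < t" for r s t m :: real
    proof (cases "s \<le> m")
      case True
      then show ?thesis using that by auto
    next
      case False
      have "(t - s) * (r - m) + (s - r) * (t - m) \<le> (t - s) * max 0 (r - m) + (s - r) * max 0 (t - m)"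
        using that by (intro add_mono mult_left_mono) auto
      then show ?thesis using False by (simp add: algebra_simps)
    qed
    have 1: "\<alpha> * ((t - r) * max 0 (s - m)) \<le> \<alpha> * ((t - s) * max 0 (r - m) + (s - r) * max 0 (t - m))"
      using p[of r s t m] * nn by (intro mult_left_mono) auto
    have 2: "\<alpha>' * ((t - r) * max 0 (m - s)) \<le> \<alpha>' * ((t - s) * max 0 (m - r) + (s - r) * max 0 (m - t))"
      using p[of "-t" "-s" "-r" "-m"] * nn by (intro mult_left_mono) (auto simp: algebra_simps)
    show "(t - s) * w r + (s - r) * w t \<le> (t - r) * w s"
      using 1 2 by (simp add: w_def algebra_simps)
  qed
  have wa: "w a \<le> 0" "w b \<le> 0" using ends m by (auto simp: w_def max_def)
  have ab: "a \<le> b" using m by auto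
  define W where "W t = indicat_real {a..b} t * w t" for t
  note [measurable] = borel_measurable_concave_Icc[OF concw]
  have [measurable]: "W \<in> borel_measurable (lebesgue_Icc l u)" unfolding W_def by measurable
  obtain K where K: "\<And>t. t \<in> {l..u} \<Longrightarrow> \<bar>w t\<bar> \<le> K"
    using concave_on_Icc_bounded[OF concw] by blast
  have WK: "\<bar>W t\<bar> \<le> K" if "t \<in> {l..u}" for t using K[OF that] by (auto simp: W_def indicator_def)
  have int: "integrable (lebesgue_Icc l u) (\<lambda>t. W t * exp (\<phi> t))" "integrable (lebesgue_Icc l u) (\<lambda>t. W t * exp (g t))"
    by (rule integrable_exp_concave[OF concave_\<phi>] integrable_exp_concave[OF concave]; use WK in \<open>auto\<close>)+
  have "(\<integral>t. W t * (exp (\<phi> t) - exp (g t)) \<partial>lebesgue_Icc l u)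
      = (\<integral>t. W t * exp (\<phi> t) \<partial>lebesgue_Icc l u) - (\<integral>t. W t * exp (g t) \<partial>lebesgue_Icc l u)"
    using int by (simp add: right_diff_distrib)
  also have "\<dots> \<le> - dev W"
    using test_inequality[OF a b ab concw wa, of "\<alpha> + \<alpha>'"] lip by (simp add: dev_def W_def)
  finally have upper: "(\<integral>t. W t * (exp (\<phi> t) - exp (g t)) \<partial>lebesgue_Icc l u) \<le> - dev W" .
  have W_eq: "W = (\<lambda>t. \<gamma> * indicator {a..b} t + ((-\<alpha>) * (indicator {m..b} t * (t - m)) + (-\<alpha>') * (indicator {a..m} t * (m - t))))"
    using m by (auto simp: W_def w_def fun_eq_iff indicator_def)
  have "dev W = \<gamma>  * dev (indicator {a..b}) + ((-\<alpha>) * dev (\<lambda>t. indicator {m..b} t * (t - m)) + (-\<alpha>') * dev (\<lambda>t. indicator {a..m} t * (m - t)))"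
  proof -
    have i1: "integrable (lebesgue_Icc l u) (\<lambda>t. (\<gamma> * indicator {a..b} t) * exp (\<phi> t))"
    proof (rule integrable_exp_\<phi>[where K = "\<bar>\<gamma>\<bar>"])
      show "\<bar>\<gamma> * indicator {a..b} t\<bar> \<le> \<bar>\<gamma>\<bar>" for t by (simp add: indicator_def)
    qed measurable
    have i2: "integrable (lebesgue_Icc l u) (\<lambda>t. ((-\<alpha>) * (indicator {m..b} t * (t - m))) * exp (\<phi> t))"
    proof (rule integrable_exp_\<phi>[where K = "\<bar>\<alpha>\<bar> * (b - m)"])
      show "(\<lambda>t. (-\<alpha>) * (indicator {m..b} t * (t - m))) \<in> borel_measurable (lebesgue_Icc l u)"
        by (rule measurable_restrict_space1) simp
      show "\<bar>(-\<alpha>) * (indicator {m..b} t * (t - m))\<bar> \<le> \<bar>\<alpha>\<bar> * (b - m)" for t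
        unfolding abs_mult abs_minus_cancel by (rule mult_left_mono) (use m in \<open>auto simp: indicator_def\<close>)
    qed
    have i3: "integrable (lebesgue_Icc l u) (\<lambda>t. ((-\<alpha>') * (indicator {a..m} t * (m - t))) * exp (\<phi> t))"
    proof (rule integrable_exp_\<phi>[where K = "\<bar>\<alpha>'\<bar> * (m - a)"])
      show "(\<lambda>t. (-\<alpha>') * (indicator {a..m} t * (m - t))) \<in> borel_measurable (lebesgue_Icc l u)"
        by (rule measurable_restrict_space1) simp
      show "\<bar>(-\<alpha>') * (indicator {a..m} t * (m - t))\<bar> \<le> \<bar>\<alpha>'\<bar> * (m - a)" for t
        unfolding abs_mult abs_minus_cancel by (rule mult_left_mono) (use m in \<open>auto simp: indicator_def\<close>)
    qed
    have i23: "integrable (lebesgue_Icc l u) (\<lambda>t. ((-\<alpha>) * (indicator {m..b} t * (t - m)) + (-\<alpha>') * (indicator {a..m} t * (m - t))) * exp (\<phi> t))"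
      unfolding distrib_right[of _ _ "exp _"] by (rule Bochner_Integration.integrable_add[OF i2 i3])
    have "dev (\<lambda>t. \<gamma> * indicator {a..b} t + ((-\<alpha>) * (indicator {m..b} t * (t - m)) + (-\<alpha>') * (indicator {a..m} t * (m - t))))
      = dev (\<lambda>t. \<gamma> * indicator {a..b} t) + (dev (\<lambda>t. (-\<alpha>) * (indicator {m..b} t * (t - m))) + dev (\<lambda>t. (-\<alpha>') * (indicator {a..m} t * (m - t))))"
      by (simp only: dev_add[OF i1 i23] dev_add[OF i2 i3])
    then show ?thesis unfolding W_eq by (simp only: dev_scale)
  qed
  then have "- dev W = - (\<gamma> * dev (indicator {a..b}) + ((-\<alpha>) * dev (\<lambda>t. indicator {m..b} t * (t - m)) + (-\<alpha>') * dev (\<lambda>t. indicator {a..m} t * (m - t))))"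
    by simp
  also have "\<dots> \<le> \<gamma> * \<bar>dev (indicator {a..b})\<bar> + (\<alpha> * \<bar>dev (\<lambda>t. indicator {m..b} t * (t - m))\<bar> + \<alpha>' * \<bar>dev (\<lambda>t. indicator {a..m} t * (m - t))\<bar>)"
  proof -
    have "- (\<gamma> * p + ((-\<alpha>) * q + (-\<alpha>') * r)) \<le> \<gamma> * \<bar>p\<bar> + (\<alpha> * \<bar>q\<bar> + \<alpha>' * \<bar>r\<bar>)" for p q r :: real
    proof -
      have "\<gamma> * (- p) + (\<alpha> * q + \<alpha>' * r) \<le> \<gamma> * \<bar>p\<bar> + (\<alpha> * \<bar>q\<bar> + \<alpha>' * \<bar>r\<bar>)"
        using nn by (intro add_mono mult_left_mono) auto
      then show ?thesis by simp
    qed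
    then show ?thesis .
  qed
  also have "\<dots> \<le> \<gamma> * err (b - a) + (\<alpha> * ((b - m) * err (b - m)) + \<alpha>' * ((m - a) * err (m - a)))"
    using nn m a b by (intro add_mono mult_left_mono dev_indicator dev_ramp_left dev_ramp_right) auto
  finally show ?thesis using upper by (simp add: W_def add.assoc)
qed

end

subsection \<open>Deviation bounds on an interval\<close>

text \<open>
  The first summand covers knots at distance at most \<open>H\<close> from the interval of length \<open>\<delta>\<close> under
  consideration, where the density is at least \<open>f\<^sub>0\<close>; the second one covers knots further out, which are only
  known to lie in \<open>{-s..s}\<close>.
\<close>

definition error_rate :: "real \<Rightarrow> real \<Rightarrow> real \<Rightarrow> real \<Rightarrow> real \<Rightarrow> real \<Rightarrow> real" where
  "error_rate C \<rho> \<delta> H f\<^sub>0 s =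
    256 * C / f\<^sub>0 * (sqrt (\<rho> / \<delta>) + \<rho> / \<delta>) + 1024 * C * s / (f\<^sub>0 * H\<^sup>2) * (sqrt (2 * \<rho> * s) + \<rho>)"

section \<open>Sign change of a concave difference, and the ramp adapted to it\<close>

lemma affine_nonpos_at_left_end:
  fixes p q z :: real
  assumes "z < y" "\<And>t. z < t \<Longrightarrow> t < y \<Longrightarrow> p + q * t \<le> 0"
  shows "p + q * z \<le> 0"
proof (rule tendsto_upperbound)
  show "((\<lambda>t. p + q * t) \<longlongrightarrow> p + q * z) (at_right z)" by (intro tendsto_intros)
  show "\<forall>\<^sub>F t in at_right z. p + q * t \<le> 0"
    using assms unfolding eventually_at_right_field by blast
qed simp

lemma affine_nonpos_at_right_end:
  fixes p q z :: real
  assumes "y < z" "\<And>t. y < t \<Longrightarrow> t < z \<Longrightarrow> p + q * t \<le> 0"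
  shows "p + q * z \<le> 0"
proof (rule tendsto_upperbound)
  show "((\<lambda>t. p + q * t) \<longlongrightarrow> p + q * z) (at_left z)" by (intro tendsto_intros)
  show "\<forall>\<^sub>F t in at_left z. p + q * t \<le> 0"
    using assms unfolding eventually_at_left_field by blast
qed simp

text \<open>A concave \<open>h\<close> that is nonnegative at \<open>d\<close> changes sign at most
  once. The ramp with value 1 at \<open>m\<close> and 0 at the crossing \<open>z\<close> has the
  sign of \<open>h\<close>, and its modulus times \<epsilon> stays below that of \<open>h\<close>:
  before \<open>z\<close> the graph lies above the line through \<open>(d, \<epsilon>)\<close> and
  \<open>(z, 0)\<close>, after \<open>z\<close> below it. Without a crossing \<open>z\<close> is
  \<open>b\<close>.\<close>

lemma concave_crossing:
  fixes h :: "real \<Rightarrow> real"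
  assumes h: "concave_on {d..b} h" and db: "d \<le> b" and md: "m < d" and \<epsilon>: "0 \<le> \<epsilon>"
    and ge: "\<And>t. t \<in> {m..d} \<Longrightarrow> \<epsilon> \<le> h t"
  shows "\<exists>z\<in>{d..b}. \<forall>t\<in>{m..b}. \<epsilon> * (1 - (t - m) / (z - m))\<^sup>2 \<le> (1 - (t - m) / (z - m)) * h t"
proof -
  define S where "S = {t \<in> {d..b}. 0 \<le> h t}"
  define z where "z = Sup S"
  have hd: "\<epsilon> \<le> h d" using ge[of d] md by simp
  have dS: "d \<in> S" using hd \<epsilon> db by (simp add: S_def)
  have bdd: "bdd_above S" by (rule bdd_aboveI[of _ b]) (simp add: S_def)
  have z: "d \<le> z" "z \<le> b"
    unfolding z_def using dS bdd by (auto intro!: cSup_upper cSup_least simp: S_def)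
  have before: "0 \<le> h t" if t: "d \<le> t" "t < z" for t
  proof -
    obtain y where y: "y \<in> S" "t < y" using t less_cSup_iff[of S t] dS bdd unfolding z_def by blast
    have "(y - t) * h d + (t - d) * h y \<le> (y - d) * h t"
      by (rule concave_on_Icc_ineq[OF h]) (use y t db in \<open>auto simp: S_def\<close>)
    moreover have "0 \<le> (y - t) * h d + (t - d) * h y"
      using y t hd \<epsilon> by (intro add_nonneg_nonneg mult_nonneg_nonneg) (auto simp: S_def)
    ultimately have "0 \<le> (y - d) * h t" by linarith
    then show ?thesis using y t by (simp add: zero_le_mult_iff)
  qed
  have after: "h t < 0" if t: "z < t" "t \<le> b" for t
    using cSup_upper[OF _ bdd, of t] t z unfolding z_def[symmetric] by (force simp: S_def)
  define w where "w = z - m"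
  have w: "0 < w" using z md by (simp add: w_def)
  have "\<epsilon> * (1 - (t - m) / w)\<^sup>2 \<le> (1 - (t - m) / w) * h t" if t: "t \<in> {m..b}" for t
  proof -
    have \<ell>: "w * (1 - (t - m) / w) = z - t" using w by (simp add: w_def field_simps)
    define k where "k = 1 - (t - m) / w"
    have k: "w * k = z - t" using \<ell> by (simp add: k_def)
    have "\<epsilon> * k\<^sup>2 \<le> k * h t"
    proof (cases "t = z")
      case True
      then have "k = 0" using k w by simp
      then show ?thesis by simp
    next
      case False
      consider "t < d" | "d \<le> t" "t < z" | "z < t" using False by linarith
      then show ?thesis
      proof cases
        case 1
        have kk: "0 \<le> k" "k \<le> 1" using t 1 z w by (auto simp: k_def w_def divide_le_eq)
        have "\<epsilon> * k\<^sup>2 = k * (k * \<epsilon>)" by (simp add: power2_eq_square)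
        also have "\<dots> \<le> k * (1 * \<epsilon>)" using kk \<epsilon> by (intro mult_left_mono mult_right_mono) auto
        also have "\<dots> \<le> k * h t" using kk ge[of t] t 1 by (intro mult_left_mono) auto
        finally show ?thesis .
      next
        case 2
        \<comment> \<open>\<open>h\<close> may jump at the end point \<open>b\<close>, so its value
          at \<open>z\<close> is of no use. The chord inequality is applied at points
          \<open>y\<close> before \<open>z\<close>; as the resulting bound is affine in
          \<open>y\<close>, it passes to the limit.\<close>
        have "(z - t) * \<epsilon> \<le> (z - d) * h t"
        proof -
          have "(t * - \<epsilon> + d * h t) + (\<epsilon> - h t) * z \<le> 0"
          proof (rule affine_nonpos_at_right_end[OF 2(2)])
            fix y assume y: "t < y" "y < z"
            have "(y - t) * h d + (t - d) * h y \<le> (y - d) * h t"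
              by (rule concave_on_Icc_ineq[OF h]) (use y z 2 in auto)
            moreover have "(y - t) * \<epsilon> \<le> (y - t) * h d" using y hd by (intro mult_left_mono) auto
            moreover have "0 \<le> (t - d) * h y" using before[of y] y 2 by simp
            ultimately show "(t * - \<epsilon> + d * h t) + (\<epsilon> - h t) * y \<le> 0" by (simp add: algebra_simps)
          qed
          then show ?thesis by (simp add: algebra_simps)
        qed
        also have "\<dots> \<le> w * h t" using before[OF 2] md by (intro mult_right_mono) (auto simp: w_def)
        finally have "w * (k * \<epsilon>) \<le> w * h t" using k by (simp flip: mult.assoc)
        then have "k * \<epsilon> \<le> h t" using w by simp
        moreover have "0 \<le> k"
        proof (rule ccontr)
          assume "\<not> 0 \<le> k"
          then have "w * k < 0" using w by (simp add: mult_pos_neg)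
          then show False using k 2 by simp
        qed
        ultimately have "k * (k * \<epsilon>) \<le> k * h t" by (intro mult_left_mono)
        then show ?thesis by (simp add: power2_eq_square algebra_simps)
      next
        case 3
        have tb: "t \<le> b" using t by simp
        have "(z - d) * h t \<le> - (\<epsilon> * (t - z))"
        proof -
          have "(- d * h t + \<epsilon> * t) + (h t - \<epsilon>) * z \<le> 0"
          proof (rule affine_nonpos_at_left_end[OF 3])
            fix y assume y: "z < y" "y < t"
            have "(t - y) * h d + (y - d) * h t \<le> (t - d) * h y"
              by (rule concave_on_Icc_ineq[OF h]) (use y z tb in auto)
            moreover have "(t - y) * \<epsilon> \<le> (t - y) * h d" using y hd by (intro mult_left_mono) auto
            moreover have "(t - d) * h y \<le> 0" using after[of y] y tb z by (simp add: mult_le_0_iff)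
            ultimately show "(- d * h t + \<epsilon> * t) + (h t - \<epsilon>) * y \<le> 0" by (simp add: algebra_simps)
          qed
          then show ?thesis by (simp add: algebra_simps)
        qed
        moreover have "w * h t \<le> (z - d) * h t"
          using after[OF 3 tb] md by (intro mult_right_mono_neg) (auto simp: w_def)
        moreover have "- (\<epsilon> * (t - z)) = w * (k * \<epsilon>)"
          unfolding mult.assoc[symmetric] k by (simp add: algebra_simps)
        ultimately have "w * h t \<le> w * (k * \<epsilon>)" by linarith
        then have "h t \<le> k * \<epsilon>" using w by simp
        moreover have "k \<le> 0"
        proof (rule ccontr)
          assume "\<not> k \<le> 0"
          then have "0 < w * k" using w by simp
          then show False using k 3 by simp
        qed
        ultimately have "k * (k * \<epsilon>) \<le> k * h t" by (intro mult_left_mono_neg)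
        then show ?thesis by (simp add: power2_eq_square algebra_simps)
      qed
    qed
    then show ?thesis by (simp add: k_def)
  qed
  then show ?thesis using z by (intro bexI[of _ z]) (auto simp: w_def)
qed

text \<open>In effect a lower bound for the integral of the squared ramp over \<open>{0..H}\<close>.
  It has to grow like \<open>(H / w)\<^sup>2\<close> when the zero \<open>w\<close> is close,
  because the noise grows with the slope \<open>1 / w\<close>. If \<open>w\<close> is at least
  \<open>H / 2\<close>, the ramp is at least 1/2 up to \<open>H / 4\<close>; otherwise it is far
  below 0 on the last quarter. The condition \<open>0 < p\<close> keeps the two sides of a tent
  disjoint.\<close>

lemma square_ramp_lower:
  fixes w H :: real
  assumes "0 < w" "0 < H"
  shows "\<exists>p q k. 0 < p \<and> p \<le> q \<and> q \<le> H \<and> 0 \<le> k \<and> (\<forall>s\<in>{p..q}. k \<le> (1 - s / w)\<^sup>2) \<and>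
    H / 128 * max 1 ((H / w)\<^sup>2) \<le> k * (q - p)"
proof (cases "H / w \<le> 2")
  case True
  have "1/4 \<le> (1 - s / w)\<^sup>2" if s: "s \<in> {H/8..H/4}" for s
  proof -
    have "s / w \<le> (H / 4) / w" using s assms by (intro divide_right_mono) auto
    then have "1/2 \<le> 1 - s / w" using True by simp
    then have "(1/2)\<^sup>2 \<le> (1 - s / w)\<^sup>2" by (intro power_mono) auto
    then show ?thesis by (simp add: power2_eq_square)
  qed
  moreover have "H / 128 * max 1 ((H / w)\<^sup>2) \<le> 1/4 * (H/4 - H/8)"
  proof -
    have "(H / w)\<^sup>2 \<le> 2\<^sup>2" using True assms by (intro power_mono) auto
    then have "H / 128 * max 1 ((H / w)\<^sup>2) \<le> H / 128 * 4" using assms by (intro mult_left_mono) auto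
    then show ?thesis by simp
  qed
  ultimately show ?thesis using assms
    by (intro exI[of _ "H/8"] exI[of _ "H/4"] exI[of _ "1/4"]) auto
next
  case False
  define r where "r = H / w"
  have r: "2 < r" using False by (simp add: r_def)
  have "(r / 4)\<^sup>2 \<le> (1 - s / w)\<^sup>2" if s: "s \<in> {3*H/4..H}" for s
  proof -
    have "(3*H/4) / w \<le> s / w" using s assms by (intro divide_right_mono) auto
    then have "3/4 * r \<le> s / w" by (simp add: r_def)
    then have "r / 4 \<le> s / w - 1" using r by simp
    then have "(r/4)\<^sup>2 \<le> (s / w - 1)\<^sup>2" using r by (intro power_mono) auto
    then show ?thesis by (simp add: power2_commute)
  qed
  moreover have "H / 128 * max 1 (r\<^sup>2) \<le> (r / 4)\<^sup>2 * (H - 3*H/4)"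
  proof -
    have "1 \<le> r\<^sup>2" using r by (intro one_le_power) auto
    then have "max 1 (r\<^sup>2) = r\<^sup>2" by simp
    then show ?thesis using assms by (simp add: power_divide)
  qed
  ultimately show ?thesis using assms unfolding r_def
    by (intro exI[of _ "3*H/4"] exI[of _ H] exI[of _ "(H / w / 4)\<^sup>2"]) auto
qed

text \<open>For a log-ratio \<open>h\<close> of densities, \<open>1 - exp (- h)\<close> is their
  relative difference. It stays below 1 however large \<open>h\<close> is, so the lower bound
  involves \<open>1 - exp (- \<epsilon>)\<close> instead of \<epsilon>. For \<open>k > 0\<close> the
  factor \<open>k\<close> comes from convexity of \<open>exp\<close> between
  \<open>- \<epsilon>\<close> and 0; for \<open>k < 0\<close> tangents to \<open>exp\<close>
  suffice.\<close>

lemma exp_increment_lower: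
  fixes k \<epsilon> h v :: real
  assumes "\<epsilon> * k\<^sup>2 \<le> k * h" "k \<le> 1" "0 \<le> \<epsilon>"
  shows "(1 - exp (- \<epsilon>)) * k\<^sup>2 \<le> k * (1 - exp (- h))"
proof -
  consider "k = 0" | "0 < k" | "k < 0" by linarith
  then show ?thesis
  proof cases
    case 1
    then show ?thesis by simp
  next
    case 2
    have "k * (k * \<epsilon>) \<le> k * h" using assms by (simp add: power2_eq_square algebra_simps)
    then have h: "k * \<epsilon> \<le> h" using 2 by simp
    have "exp ((1 - k) *\<^sub>R 0 + k *\<^sub>R (- \<epsilon>)) \<le> (1 - k) * exp 0 + k * exp (- \<epsilon>)"
      using 2 assms by (intro convex_onD[OF exp_convex]) auto
    then have "exp (- (k * \<epsilon>)) \<le> 1 - k * (1 - exp (- \<epsilon>))" by (simp add: algebra_simps)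
    moreover have "exp (- h) \<le> exp (- (k * \<epsilon>))" using h by simp
    ultimately have "k * (1 - exp (- \<epsilon>)) \<le> 1 - exp (- h)" by linarith
    then have "k * (k * (1 - exp (- \<epsilon>))) \<le> k * (1 - exp (- h))"
      using 2 by (intro mult_left_mono) auto
    then show ?thesis by (simp add: power2_eq_square algebra_simps)
  next
    case 3
    have "k * (k * \<epsilon>) \<le> k * h" using assms by (simp add: power2_eq_square algebra_simps)
    then have h: "h \<le> k * \<epsilon>" using 3 by simp
    have "1 + - \<epsilon> \<le> exp (- \<epsilon>)" by (rule exp_ge_add_one_self)
    then have "k * \<epsilon> \<le> k * (1 - exp (- \<epsilon>))" using 3 by (intro mult_left_mono_neg) auto
    moreover have "1 + - (k * \<epsilon>) \<le> exp (- (k * \<epsilon>))" by (rule exp_ge_add_one_self)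
    moreover have "exp (- (k * \<epsilon>)) \<le> exp (- h)" using h by simp
    ultimately have "1 - exp (- h) \<le> k * (1 - exp (- \<epsilon>))" by linarith
    then have "k * (k * (1 - exp (- \<epsilon>))) \<le> k * (1 - exp (- h))" using 3 by (intro mult_left_mono_neg) auto
    then show ?thesis by (simp add: power2_eq_square algebra_simps)
  qed
qed

section \<open>Noise against signal, for near and for distant knots\<close>

context mle_deviation begin

text \<open>One side of a tent: \<open>r\<close> is the distance from the peak to the knot and
  \<open>w\<close> that to the zero. The left-hand side is the noise, the factor after
  \<open>error_rate\<close> the signal found by \<open>square_ramp_lower\<close>, which counts only
  up to distance \<open>H\<close>, where the density bound ends. The constants in
  \<open>error_rate\<close> are 256 = 2 * 128 and 1024 = 8 * 128.\<close>

lemma error_rate_lower_side: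
  assumes pos: "0 < \<delta>" "0 < H" "0 < f\<^sub>0" and r: "\<delta> \<le> w" "w \<le> r" "r \<le> 2 * s"
  shows "err r * (1 + r / w) \<le> error_rate C \<rho> \<delta> H f\<^sub>0 s * (f\<^sub>0 * (min r H / 128 * max 1 ((min r H / w)\<^sup>2)))"
proof -
  have w: "0 < w" "0 < r" "0 < s" using assms by auto
  have rw: "1 \<le> r / w" using r w by simp
  have sq: "0 \<le> sqrt (\<rho> / \<delta>)" "0 \<le> \<rho> / \<delta>" "0 \<le> sqrt (2 * \<rho> * s)" using \<rho>_nonneg pos w by auto
  have q1: "0 \<le> 256 * C / f\<^sub>0 * (sqrt (\<rho> / \<delta>) + \<rho> / \<delta>)"
    using C_nonneg pos sq by (intro mult_nonneg_nonneg add_nonneg_nonneg) auto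
  have q2: "0 \<le> 1024 * C * s / (f\<^sub>0 * H\<^sup>2) * (sqrt (2 * \<rho> * s) + \<rho>)"
    using C_nonneg \<rho>_nonneg pos sq w by (intro mult_nonneg_nonneg add_nonneg_nonneg divide_nonneg_nonneg) auto
  have e0: "0 \<le> err r" using err_nonneg w by simp
  have "err r * (1 + r / w) \<le> err r * (2 * (r / w))" using rw e0 by (intro mult_left_mono) auto
  also have "\<dots> = 2 * C * (r / w) * (sqrt (\<rho> * r) + \<rho>)" by (simp add: err_def)
  also have "\<dots> \<le> error_rate C \<rho> \<delta> H f\<^sub>0 s * (f\<^sub>0 * (min r H / 128 * max 1 ((min r H / w)\<^sup>2)))"
  proof (cases "r \<le> H")
    case True
    \<comment> \<open>Per unit of length the noise decreases in \<open>r\<close>, so the shortest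
      admissible length \<delta> is the worst case.\<close>
    have "sqrt (\<rho> * r) \<le> r * sqrt (\<rho> / \<delta>)"
    proof -
      have "\<rho> * r \<le> r\<^sup>2 * (\<rho> / \<delta>)"
      proof -
        have "\<rho> * r * \<delta> \<le> \<rho> * r * r" using \<rho>_nonneg w r by (intro mult_left_mono) auto
        then show ?thesis using pos by (simp add: field_simps power2_eq_square)
      qed
      then have "sqrt (\<rho> * r) \<le> sqrt (r\<^sup>2 * (\<rho> / \<delta>))" by simp
      also have "\<dots> = r * sqrt (\<rho> / \<delta>)" by (subst real_sqrt_mult) (use w in simp)
      finally show ?thesis .
    qed
    moreover have "\<rho> \<le> r * (\<rho> / \<delta>)"
    proof -
      have "\<rho> * \<delta> \<le> \<rho> * r" using \<rho>_nonneg r by (intro mult_left_mono) auto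
      then show ?thesis using pos by (simp add: field_simps)
    qed
    ultimately have "sqrt (\<rho> * r) + \<rho> \<le> r * (sqrt (\<rho> / \<delta>) + \<rho> / \<delta>)" by (simp add: distrib_left)
    also have "\<dots> \<le> (r / w) * (r * (sqrt (\<rho> / \<delta>) + \<rho> / \<delta>))"
    proof -
      have "0 \<le> r * (sqrt (\<rho> / \<delta>) + \<rho> / \<delta>)" using w sq by simp
      from mult_right_mono[OF rw this] show ?thesis by simp
    qed
    finally have "2 * C * (r / w) * (sqrt (\<rho> * r) + \<rho>) \<le> 2 * C * (r / w) * ((r / w) * (r * (sqrt (\<rho> / \<delta>) + \<rho> / \<delta>)))"
      using C_nonneg w by (intro mult_left_mono) auto
    also have "\<dots> = 256 * C / f\<^sub>0 * (sqrt (\<rho> / \<delta>) + \<rho> / \<delta>) * (f\<^sub>0 * (r / 128 * (r / w)\<^sup>2))"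
      using pos by (simp add: power2_eq_square)
    also have "\<dots> \<le> error_rate C \<rho> \<delta> H f\<^sub>0 s * (f\<^sub>0 * (r / 128 * max 1 ((r / w)\<^sup>2)))"
      unfolding error_rate_def using q1 q2 pos w by (intro mult_mono) auto
    finally show ?thesis using True by simp
  next
    case False
    \<comment> \<open>The noise is linear and the signal quadratic in \<open>H / w\<close>; the
      maximum with 1 covers small values of \<open>H / w\<close>.\<close>
    have y: "H / w \<le> 2 * max 1 ((H / w)\<^sup>2)"
    proof (cases "H / w \<le> 1")
      case False
      then have "H / w * 1 \<le> H / w * (H / w)" by (intro mult_left_mono) auto
      then show ?thesis using False by (auto simp: power2_eq_square)
    qed auto
    have "sqrt (\<rho> * r) \<le> sqrt (2 * \<rho> * s)"
      using r \<rho>_nonneg mult_left_mono[of r "2 * s" \<rho>] by (simp add: mult_ac)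
    then have "2 * C * (r / w) * (sqrt (\<rho> * r) + \<rho>) \<le> 2 * C * (2 * s / w) * (sqrt (2 * \<rho> * s) + \<rho>)"
      using C_nonneg w r \<rho>_nonneg by (intro mult_mono divide_right_mono) auto
    also have "\<dots> = 4 * C * s / H * (H / w) * (sqrt (2 * \<rho> * s) + \<rho>)" using pos by simp
    also have "\<dots> \<le> 4 * C * s / H * (2 * max 1 ((H / w)\<^sup>2)) * (sqrt (2 * \<rho> * s) + \<rho>)"
      using C_nonneg w pos \<rho>_nonneg y by (intro mult_right_mono mult_left_mono) auto
    also have "\<dots> = 1024 * C * s / (f\<^sub>0 * H\<^sup>2) * (sqrt (2 * \<rho> * s) + \<rho>) * (f\<^sub>0 * (H / 128 * max 1 ((H / w)\<^sup>2)))"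
      using pos by (simp add: power2_eq_square)
    also have "\<dots> \<le> error_rate C \<rho> \<delta> H f\<^sub>0 s * (f\<^sub>0 * (H / 128 * max 1 ((H / w)\<^sup>2)))"
      unfolding error_rate_def using q1 q2 pos w by (intro mult_right_mono) auto
    finally show ?thesis using False by simp
  qed
  finally show ?thesis .
qed

text \<open>For a pure ramp the signal is of the order of \<open>min r H\<close> squared. The
  constants arising here are at most 8, so the rate made for tents absorbs them.\<close>

lemma error_rate_upper_side:
  assumes pos: "0 < \<delta>" "0 < H" "0 < f\<^sub>0" and r: "\<delta> \<le> r" "r \<le> 2 * s"
    and le: "\<epsilon> * (f\<^sub>0 * (min r H)\<^sup>2 / 4) \<le> r * err r"
  shows "\<epsilon> \<le> error_rate C \<rho> \<delta> H f\<^sub>0 s"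
proof -
  have w: "0 < r" "0 < s" using assms by auto
  have sq: "0 \<le> sqrt (\<rho> / \<delta>)" "0 \<le> \<rho> / \<delta>" "0 \<le> sqrt (2 * \<rho> * s)" using \<rho>_nonneg pos w by auto
  have q1: "0 \<le> C / f\<^sub>0 * (sqrt (\<rho> / \<delta>) + \<rho> / \<delta>)"
    using C_nonneg pos sq by (intro mult_nonneg_nonneg add_nonneg_nonneg) auto
  have q2: "0 \<le> C * s / (f\<^sub>0 * H\<^sup>2) * (sqrt (2 * \<rho> * s) + \<rho>)"
    using C_nonneg \<rho>_nonneg pos sq w by (intro mult_nonneg_nonneg add_nonneg_nonneg divide_nonneg_nonneg) auto
  have dominated: "a \<le> error_rate C \<rho> \<delta> H f\<^sub>0 s"
    if "a \<le> 8 * (C / f\<^sub>0 * (sqrt (\<rho> / \<delta>) + \<rho> / \<delta>)) \<or>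
      a \<le> 8 * (C * s / (f\<^sub>0 * H\<^sup>2) * (sqrt (2 * \<rho> * s) + \<rho>))" for a
  proof -
    have "a \<le> 256 * p + 1024 * q" if "0 \<le> p" "0 \<le> q" "a \<le> 8 * p \<or> a \<le> 8 * q" for p q :: real
      using that by linarith
    from this[OF q1 q2 that] show ?thesis by (simp add: error_rate_def)
  qed
  show ?thesis
  proof (cases "r \<le> H")
    case True
    have "\<epsilon> \<le> 4 * C / f\<^sub>0 * ((sqrt (\<rho> * r) + \<rho>) / r)"
    proof -
      have "r * (\<epsilon> * (f\<^sub>0 * r / 4)) \<le> r * (C * (sqrt (\<rho> * r) + \<rho>))"
        using le True by (simp add: err_def power2_eq_square algebra_simps)
      then have "\<epsilon> * (f\<^sub>0 * r / 4) \<le> C * (sqrt (\<rho> * r) + \<rho>)"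
        using w(1) by (rule mult_left_le_imp_le)
      then have "\<epsilon> \<le> (C * (sqrt (\<rho> * r) + \<rho>)) / (f\<^sub>0 * r / 4)"
        by (rule iffD2[OF pos_le_divide_eq, rotated]) (use pos w in simp)
      also have "\<dots> = 4 * C / f\<^sub>0 * ((sqrt (\<rho> * r) + \<rho>) / r)" by simp
      finally show ?thesis .
    qed
    also have "(sqrt (\<rho> * r) + \<rho>) / r = sqrt (\<rho> / r) + \<rho> / r"
    proof -
      have "\<rho> * r = r\<^sup>2 * (\<rho> / r)" using w by (simp add: power2_eq_square)
      then have "sqrt (\<rho> * r) = sqrt (r\<^sup>2 * (\<rho> / r))" by (rule arg_cong)
      also have "\<dots> = r * sqrt (\<rho> / r)" using w by (subst real_sqrt_mult) simp
      finally show ?thesis using w by (simp add: add_divide_distrib)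
    qed
    also have "4 * C / f\<^sub>0 * (sqrt (\<rho> / r) + \<rho> / r) \<le> 4 * C / f\<^sub>0 * (sqrt (\<rho> / \<delta>) + \<rho> / \<delta>)"
      using C_nonneg pos \<rho>_nonneg r w by (intro mult_left_mono add_mono real_sqrt_le_mono divide_left_mono) auto
    also have "\<dots> \<le> 8 * (C / f\<^sub>0 * (sqrt (\<rho> / \<delta>) + \<rho> / \<delta>))"
      using mult_right_mono[OF _ q1, of 4 8] by simp
    finally show ?thesis by (intro dominated disjI1)
  next
    case False
    have "r * err r \<le> (2 * s) * (C * (sqrt (2 * \<rho> * s) + \<rho>))"
    proof (rule mult_mono)
      have "sqrt (\<rho> * r) \<le> sqrt (2 * \<rho> * s)"
        using r \<rho>_nonneg mult_left_mono[of r "2 * s" \<rho>] by (simp add: mult_ac)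
      then show "err r \<le> C * (sqrt (2 * \<rho> * s) + \<rho>)"
        unfolding err_def using C_nonneg by (intro mult_left_mono) auto
    qed (use r w err_nonneg[of r] in auto)
    with le False have "\<epsilon> * (f\<^sub>0 * H\<^sup>2 / 4) \<le> (2 * s) * (C * (sqrt (2 * \<rho> * s) + \<rho>))" by simp
    then have "\<epsilon> \<le> 8 * (C * s / (f\<^sub>0 * H\<^sup>2) * (sqrt (2 * \<rho> * s) + \<rho>))"
      using pos by (simp add: field_simps)
    then show ?thesis by (intro dominated disjI2)
  qed
qed

end

section \<open>Bounds for an excess and for a deficit over a whole interval\<close>

context mle_deviation begin

lemma integrable_difference:
  assumes "w \<in> borel_measurable (lebesgue_Icc l u)" "\<And>t. t \<in> {l..u} \<Longrightarrow> \<bar>w t\<bar> \<le> K"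
  shows "integrable (lebesgue_Icc l u) (\<lambda>t. w t * (exp (\<phi> t) - exp (g t)))"
  unfolding right_diff_distrib
  by (intro Bochner_Integration.integrable_diff integrable_exp_concave[OF concave_\<phi>] integrable_exp_concave[OF concave])
     (use assms in auto)

text \<open>The test function is the negative ramp that starts at \<open>c\<close> and is cut off at
  the node \<open>b\<close>. It vanishes to the left of \<open>c\<close>, so \<open>l\<close> can
  serve as the left node.\<close>

lemma excess_right_bound:
  assumes b: "node b" "b \<in> {l..u}" and c: "c \<in> {l..u}" and \<epsilon>: "0 \<le> \<epsilon>"
    and ge: "\<And>t. t \<in> {c..b} \<Longrightarrow> \<phi> t + \<epsilon> \<le> g t"
    and H: "0 < H" "c + H \<le> b" and f\<^sub>0: "0 \<le> f\<^sub>0" "\<And>t. t \<in> {c..c + H} \<Longrightarrow> f\<^sub>0 \<le> exp (\<phi> t)"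
  shows "\<epsilon> * (f\<^sub>0 * H\<^sup>2 / 4) \<le> (b - c) * err (b - c)"
proof -
  define w where "w t = indicator {l..b} t * (0 - 1 * max 0 (t - c) - 0 * max 0 (c - t))" for t :: real
  have meas [measurable]: "w \<in> borel_measurable (lebesgue_Icc l u)"
    unfolding w_def by (intro measurable_restrict_space1) simp
  have wK: "\<bar>w t\<bar> \<le> b - c" for t using H by (simp add: w_def indicator_def)
  have int: "integrable (lebesgue_Icc l u) (\<lambda>t. w t * (exp (\<phi> t) - exp (g t)))"
    by (rule integrable_difference[OF meas wK])
  have le: "(\<integral>t. w t * (exp (\<phi> t) - exp (g t)) \<partial>lebesgue_Icc l u) \<le> (b - c) * err (b - c)"
    using test_bound[OF node_left_end _ b, of c 0 1 0] c H l_less_u by (simp add: w_def)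
  have w_nonpos: "w t \<le> 0" for t by (simp add: w_def indicator_def)
  have w_eq: "w t = - (t - c)" if "t \<in> {c..b}" for t using that c by (simp add: w_def)
  have diff: "exp (\<phi> t) * \<epsilon> \<le> exp (g t) - exp (\<phi> t)" if "t \<in> {c..b}" for t
  proof -
    have "exp (\<phi> t) * (1 + \<epsilon>) \<le> exp (\<phi> t) * exp \<epsilon>"
      by (intro mult_left_mono exp_ge_add_one_self) auto
    also have "\<dots> = exp (\<phi> t + \<epsilon>)" by (simp add: exp_add)
    also have "\<dots> \<le> exp (g t)" using ge[OF that] by simp
    finally show ?thesis by (simp add: algebra_simps)
  qed
  \<comment> \<open>On the upper half of \<open>{c..c + H}\<close> the ramp is at least
    \<open>H / 2\<close>.\<close>
  have "(H / 2 * (f\<^sub>0 * \<epsilon>)) * ((c + H) - (c + H / 2)) \<le> (\<integral>t. w t * (exp (\<phi> t) - exp (g t)) \<partial>lebesgue_Icc l u)"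
  proof (rule integral_lebesgue_Icc_ge[OF int])
    fix t assume t: "t \<in> {l..u}"
    show "0 \<le> w t * (exp (\<phi> t) - exp (g t))"
    proof (cases "t \<in> {c..b}")
      case True
      have "0 \<le> exp (\<phi> t) * \<epsilon>" using \<epsilon> by simp
      with diff[OF True] have "exp (\<phi> t) - exp (g t) \<le> 0" by linarith
      then show ?thesis using w_nonpos[of t] by (rule mult_nonpos_nonpos[rotated])
    next
      case False
      then have "w t = 0" by (auto simp: w_def indicator_def)
      then show ?thesis by simp
    qed
  next
    fix t assume t: "t \<in> {c + H / 2..c + H}"
    then have tb: "t \<in> {c..b}" using H by auto
    have "H / 2 * (f\<^sub>0 * \<epsilon>) \<le> (t - c) * (exp (\<phi> t) * \<epsilon>)"
      using t H f\<^sub>0 \<epsilon> by (intro mult_mono mult_right_mono mult_nonneg_nonneg) auto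
    also have "\<dots> \<le> (t - c) * (exp (g t) - exp (\<phi> t))"
      using diff[OF tb] tb by (intro mult_left_mono) auto
    also have "\<dots> = w t * (exp (\<phi> t) - exp (g t))" unfolding w_eq[OF tb] by (simp add: algebra_simps)
    finally show "H / 2 * (f\<^sub>0 * \<epsilon>) \<le> w t * (exp (\<phi> t) - exp (g t))" .
  qed (use c H b in auto)
  then show ?thesis using le by (simp add: power2_eq_square algebra_simps)
qed

lemma excess_right:
  assumes b: "node b" "b \<in> {l..u}" and c: "c \<in> {l..u}" and \<epsilon>: "0 \<le> \<epsilon>"
    and ge: "\<And>t. t \<in> {c..b} \<Longrightarrow> \<phi> t + \<epsilon> \<le> g t"
    and pos: "0 < \<delta>" "0 < H" "0 < f\<^sub>0" and f\<^sub>0: "\<And>t. t \<in> {c..c + H} \<Longrightarrow> f\<^sub>0 \<le> exp (\<phi> t)"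
    and \<delta>: "\<delta> \<le> b - c" and s: "u - l \<le> 2 * s"
  shows "\<epsilon> \<le> error_rate C \<rho> \<delta> H f\<^sub>0 s"
proof (rule error_rate_upper_side[OF pos \<delta>])
  show "b - c \<le> 2 * s" using s b c by auto
  show "\<epsilon> * (f\<^sub>0 * (min (b - c) H)\<^sup>2 / 4) \<le> (b - c) * err (b - c)"
    by (rule excess_right_bound[OF b c \<epsilon> ge]) (use pos \<delta> f\<^sub>0 in auto)
qed

lemma excess_left:
  assumes a: "node a" "a \<in> {l..u}" and d: "d \<in> {l..u}" and \<epsilon>: "0 \<le> \<epsilon>"
    and ge: "\<And>t. t \<in> {a..d} \<Longrightarrow> \<phi> t + \<epsilon> \<le> g t"
    and pos: "0 < \<delta>" "0 < H" "0 < f\<^sub>0" and f\<^sub>0: "\<And>t. t \<in> {d - H..d} \<Longrightarrow> f\<^sub>0 \<le> exp (\<phi> t)"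
    and \<delta>: "\<delta> \<le> d - a" and s: "u - l \<le> 2 * s"
  shows "\<epsilon> \<le> error_rate C \<rho> \<delta> H f\<^sub>0 s"
proof -
  interpret r: mle_deviation n "\<lambda>i. - x i" "-u" "-l" "\<lambda>t. g (-t)" "\<lambda>t. \<phi> (-t)" C \<rho>
    by (rule mirror_deviation)
  show ?thesis
    by (rule r.excess_right[of "-a" "-d"]) (use assms node_mirror[of a] in auto)
qed

text \<open>On the affine piece \<open>g - \<phi>\<close> is convex. As it is no smaller at
  \<open>d\<close> than at \<open>c\<close>, it stays above its value at \<open>d\<close> as far as
  the node \<open>b\<close>, where the ramp may be cut off.\<close>

lemma excess_affine_right:
  assumes b: "node b" "b \<in> {l..u}" and c: "c \<in> {l..u}" and \<epsilon>: "0 \<le> \<epsilon>"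
    and cd: "c < d" "d \<le> b"
    and affine: "\<And>t. t \<in> {c..b} \<Longrightarrow> g t = g c + p * (t - c)"
    and up: "g c - \<phi> c \<le> g d - \<phi> d"
    and ge: "\<And>t. t \<in> {c..d} \<Longrightarrow> \<phi> t + \<epsilon> \<le> g t"
    and pos: "0 < \<delta>" "0 < H" "0 < f\<^sub>0" and f\<^sub>0: "\<And>t. t \<in> {c..c + H} \<Longrightarrow> f\<^sub>0 \<le> exp (\<phi> t)"
    and \<delta>: "\<delta> \<le> d - c" and s: "u - l \<le> 2 * s"
  shows "\<epsilon> \<le> error_rate C \<rho> \<delta> H f\<^sub>0 s"
proof (rule excess_right[OF b c \<epsilon> _ pos f\<^sub>0 _ s])
  show "\<delta> \<le> b - c" using \<delta> cd by simp
  fix t assume t: "t \<in> {c..b}"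
  show "\<phi> t + \<epsilon> \<le> g t"
  proof (cases "t \<le> d")
    case True
    then show ?thesis using ge t by simp
  next
    case False
    have "(t - d) * \<phi> c + (d - c) * \<phi> t \<le> (t - c) * \<phi> d"
      by (rule concave_on_Icc_ineq[OF concave_\<phi>]) (use c b t False cd in auto)
    moreover have "(t - d) * g c + (d - c) * g t = (t - c) * g d"
    proof -
      have eqs: "g t = g c + p * (t - c)" "g d = g c + p * (d - c)" using affine[OF t] affine[of d] cd by auto
      show ?thesis by (simp only: eqs) (simp add: algebra_simps)
    qed
    ultimately have "(t - c) * (g d - \<phi> d) \<le> (t - d) * (g c - \<phi> c) + (d - c) * (g t - \<phi> t)"
      by (simp add: algebra_simps)
    also have "(t - d) * (g c - \<phi> c) \<le> (t - d) * (g d - \<phi> d)"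
      using up False by (intro mult_left_mono) auto
    finally have "(d - c) * (g d - \<phi> d) \<le> (d - c) * (g t - \<phi> t)" by (simp add: algebra_simps)
    then have "g d - \<phi> d \<le> g t - \<phi> t" using cd by simp
    then show ?thesis using ge[of d] cd by simp
  qed
qed auto

lemma excess_affine_left:
  assumes a: "node a" "a \<in> {l..u}" and d: "d \<in> {l..u}" and \<epsilon>: "0 \<le> \<epsilon>"
    and cd: "a \<le> c" "c < d"
    and affine: "\<And>t. t \<in> {a..d} \<Longrightarrow> g t = g d + p * (t - d)"
    and up: "g d - \<phi> d \<le> g c - \<phi> c"
    and ge: "\<And>t. t \<in> {c..d} \<Longrightarrow> \<phi> t + \<epsilon> \<le> g t"
    and pos: "0 < \<delta>" "0 < H" "0 < f\<^sub>0" and f\<^sub>0: "\<And>t. t \<in> {d - H..d} \<Longrightarrow> f\<^sub>0 \<le> exp (\<phi> t)"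
    and \<delta>: "\<delta> \<le> d - c" and s: "u - l \<le> 2 * s"
  shows "\<epsilon> \<le> error_rate C \<rho> \<delta> H f\<^sub>0 s"
proof -
  interpret r: mle_deviation n "\<lambda>i. - x i" "-u" "-l" "\<lambda>t. g (-t)" "\<lambda>t. \<phi> (-t)" C \<rho>
    by (rule mirror_deviation)
  show ?thesis
  proof (rule r.excess_affine_right[of "-a" "-d" \<epsilon> "-c" "-p"])
    show "g (-t) = g (- (-d)) + (-p) * (t - (-d))" if "t \<in> {-d..-a}" for t
      using affine[of "-t"] that by (simp add: algebra_simps)
  qed (use a d \<epsilon> cd up ge pos f\<^sub>0 \<delta> s node_mirror[of a] in auto)
qed

lemma prev_node:
  assumes "d \<in> {l..u}"
  shows "\<exists>a\<in>{l..d}. node a \<and> (\<exists>s. \<forall>t\<in>{a..d}. g t = g d + s * (t - d))"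
proof -
  interpret r: concave_mle n "\<lambda>i. - x i" "-u" "-l" "\<lambda>t. g (-t)" by (rule mirror)
  obtain b s where b: "b \<in> {-d..-l}" "r.node b" and s: "\<And>t. t \<in> {-d..b} \<Longrightarrow> g (-t) = g (- (-d)) + s * (t - (-d))"
  proof -
    have "-d \<in> {-u..-l}" using assms by simp
    from r.next_node[OF this] show ?thesis using that by blast
  qed
  have "node (-b)" using b node_mirror[of "-b"] by simp
  moreover have "g t = g d + (-s) * (t - d)" if "t \<in> {-b..d}" for t
    using s[of "-t"] that by (simp add: algebra_simps)
  moreover have "-b \<in> {l..d}" using b by auto
  ultimately show ?thesis by blast
qed

text \<open>A node inside \<open>{c..d}\<close> has distance at least \<delta> from one of the ends,
  and a ramp fits in between. Without such a node, \<open>g\<close> is affine on the interval and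
  beyond both ends, and the excess is followed towards the end at which it is larger.\<close>

lemma excess_bound:
  assumes cd: "c < d" "2 * \<delta> \<le> d - c" and pos: "0 < \<delta>" "0 < H" "0 < f\<^sub>0"
    and sub: "l \<le> c - H" "d + H \<le> u" and f\<^sub>0: "\<And>t. t \<in> {c - H..d + H} \<Longrightarrow> f\<^sub>0 \<le> exp (\<phi> t)"
    and s: "u - l \<le> 2 * s" and \<epsilon>: "0 \<le> \<epsilon>"
    and ge: "\<And>t. t \<in> {c..d} \<Longrightarrow> \<phi> t + \<epsilon> \<le> g t"
  shows "\<epsilon> \<le> error_rate C \<rho> \<delta> H f\<^sub>0 s"
proof -
  have c: "c \<in> {l..u}" and d: "d \<in> {l..u}" using cd sub pos by auto
  have node_in: ?thesis if e: "node e" "e \<in> {c..d}" for e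
  proof (cases "(c + d) / 2 \<le> e")
    case True
    show ?thesis
      by (rule excess_right[OF e(1) _ c \<epsilon> ge pos f\<^sub>0 _ s]) (use e c d cd True pos in auto)
  next
    case False
    show ?thesis
      by (rule excess_left[OF e(1) _ d \<epsilon> ge pos f\<^sub>0 _ s]) (use e c d cd False pos in auto)
  qed
  obtain b p where b: "b \<in> {c..u}" "node b" and p: "\<And>t. t \<in> {c..b} \<Longrightarrow> g t = g c + p * (t - c)"
    using next_node[OF c] by blast
  obtain a q where a: "a \<in> {l..d}" "node a" and q: "\<And>t. t \<in> {a..d} \<Longrightarrow> g t = g d + q * (t - d)"
    using prev_node[OF d] by blast
  consider "b \<le> d" | "c \<le> a" | "d < b" "a < c" by linarith
  then show ?thesis
  proof cases
    case 1
    then show ?thesis using node_in[of b] b by auto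
  next
    case 2
    then show ?thesis using node_in[of a] a by auto
  next
    case 3
    show ?thesis
    proof (cases "g c - \<phi> c \<le> g d - \<phi> d")
      case True
      show ?thesis
        by (rule excess_affine_right[OF b(2) _ c \<epsilon> cd(1) _ p True ge pos f\<^sub>0 _ s]) (use 3 b c d cd pos in auto)
    next
      case False
      then have up: "g d - \<phi> d \<le> g c - \<phi> c" by simp
      show ?thesis
        by (rule excess_affine_left[OF a(2) _ d \<epsilon> _ cd(1) q up ge pos f\<^sub>0 _ s]) (use 3 a c d cd pos in auto)
    qed
  qed
qed

text \<open>The tent has its peak at the midpoint \<open>m\<close> and its zeros where
  \<open>\<phi> - g\<close> changes sign on the way to the next node outside, so tent times density
  difference is nowhere negative. Kinks of \<open>g\<close> within \<open>{c..d}\<close> do no harm,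
  as the deficit is given there.\<close>

lemma deficit_bound:
  assumes cd: "c < d" "2 * \<delta> \<le> d - c" and pos: "0 < \<delta>" "0 < H" "0 < f\<^sub>0"
    and sub: "l \<le> c - H" "d + H \<le> u" and f\<^sub>0: "\<And>t. t \<in> {c - H..d + H} \<Longrightarrow> f\<^sub>0 \<le> exp (\<phi> t)"
    and s: "u - l \<le> 2 * s" and \<epsilon>: "0 \<le> \<epsilon>"
    and ge: "\<And>t. t \<in> {c..d} \<Longrightarrow> g t + \<epsilon> \<le> \<phi> t"
  shows "1 - exp (- \<epsilon>) \<le> error_rate C \<rho> \<delta> H f\<^sub>0 s"
proof -
  have c: "c \<in> {l..u}" and d: "d \<in> {l..u}" using cd sub pos by auto
  define m where "m = (c + d) / 2"
  have m: "c + \<delta> \<le> m" "m + \<delta> \<le> d" using cd by (auto simp: m_def field_simps)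
  obtain b p where b: "b \<in> {d..u}" "node b" and p: "\<And>t. t \<in> {d..b} \<Longrightarrow> g t = g d + p * (t - d)"
    using next_node[OF d] by blast
  obtain a q where a: "a \<in> {l..c}" "node a" and q: "\<And>t. t \<in> {a..c} \<Longrightarrow> g t = g c + q * (t - c)"
    using prev_node[OF c] by blast
  have "concave_on {d..b} (\<lambda>t. \<phi> t - g t)"
  proof (rule concave_on_IccI)
    fix r v t assume *: "r \<in> {d..b}" "t \<in> {d..b}" "r < v" "v < t"
    have "(t - v) * \<phi> r + (v - r) * \<phi> t \<le> (t - r) * \<phi> v"
      by (rule concave_on_Icc_ineq[OF concave_\<phi>]) (use * b d in auto)
    moreover have "(t - v) * g r + (v - r) * g t = (t - r) * g v"
    proof -
      have eqs: "g r = g d + p * (r - d)" "g v = g d + p * (v - d)" "g t = g d + p * (t - d)"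
        using p[of r] p[of v] p[of t] * by auto
      show ?thesis by (simp only: eqs) (simp add: algebra_simps)
    qed
    ultimately show "(t - v) * (\<phi> r - g r) + (v - r) * (\<phi> t - g t) \<le> (t - r) * (\<phi> v - g v)"
      by (simp add: algebra_simps)
  qed
  note conc_right = this
  have db: "d \<le> b" "m < d" using b m pos by auto
  have "\<epsilon> \<le> \<phi> t - g t" if "t \<in> {m..d}" for t using ge[of t] that m pos by simp
  from concave_crossing[OF conc_right db \<epsilon> this] obtain z where z: "z \<in> {d..b}"
    and zh: "\<And>t. t \<in> {m..b} \<Longrightarrow> \<epsilon> * (1 - (t - m) / (z - m))\<^sup>2 \<le> (1 - (t - m) / (z - m)) * (\<phi> t - g t)"
    by blast
  have "concave_on {-c..-a} (\<lambda>t. \<phi> (-t) - g (-t))"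
  proof (rule concave_on_IccI)
    fix r v t assume *: "r \<in> {-c..-a}" "t \<in> {-c..-a}" "r < v" "v < t"
    have "(-r - (-v)) * \<phi> (-t) + (-v - (-t)) * \<phi> (-r) \<le> (-r - (-t)) * \<phi> (-v)"
      by (rule concave_on_Icc_ineq[OF concave_\<phi>]) (use * a c in auto)
    moreover have "(-r - (-v)) * g (-t) + (-v - (-t)) * g (-r) = (-r - (-t)) * g (-v)"
    proof -
      have eqs: "g (-r) = g c + q * (-r - c)" "g (-v) = g c + q * (-v - c)" "g (-t) = g c + q * (-t - c)"
        using q[of "-r"] q[of "-v"] q[of "-t"] * by auto
      show ?thesis by (simp only: eqs) (simp add: algebra_simps)
    qed
    ultimately show "(t - v) * (\<phi> (-r) - g (-r)) + (v - r) * (\<phi> (-t) - g (-t)) \<le> (t - r) * (\<phi> (-v) - g (-v))"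
      by (simp add: algebra_simps)
  qed
  note conc_left = this
  have ca: "-c \<le> -a" "-m < -c" using a m pos by auto
  have "\<epsilon> \<le> \<phi> (-t) - g (-t)" if "t \<in> {-m..-c}" for t using ge[of "-t"] that m pos by simp
  from concave_crossing[OF conc_left ca \<epsilon> this] obtain y where y: "y \<in> {-c..-a}"
    and yh: "\<And>t. t \<in> {-m..-a} \<Longrightarrow> \<epsilon> * (1 - (t + m) / (y + m))\<^sup>2 \<le> (1 - (t + m) / (y + m)) * (\<phi> (-t) - g (-t))"
    unfolding diff_minus_eq_add by blast
  define wr where "wr = z - m"
  define wl where "wl = y + m"
  have wr: "\<delta> \<le> wr" "wr \<le> b - m" and wl: "\<delta> \<le> wl" "wl \<le> m - a" using z y m by (auto simp: wr_def wl_def)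
  have w0: "0 < wr" "0 < wl" using wr wl pos by auto
  have amb: "a < m" "m < b" using wr wl pos by auto
  \<comment> \<open>Zeros at \<open>m + wr\<close> and \<open>m - wl\<close>. Both nodes lie at or
    beyond them, so \<open>k\<close> is at most 0 at the nodes, as the cut-off requires.\<close>
  define k where "k t = 1 - (1 / wr) * max 0 (t - m) - (1 / wl) * max 0 (m - t)" for t
  have k_right: "k t = 1 - (t - m) / wr" if "m \<le> t" for t using that by (simp add: k_def)
  have k_left: "k t = 1 - (m - t) / wl" if "t \<le> m" for t using that by (simp add: k_def)
  have k1: "k t \<le> 1" for t
  proof -
    have "0 \<le> (1 / wr) * max 0 (t - m)" "0 \<le> (1 / wl) * max 0 (m - t)" using w0 by auto
    then show ?thesis unfolding k_def by linarith
  qed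
  have kh: "\<epsilon> * (k t)\<^sup>2 \<le> k t * (\<phi> t - g t)" if t: "t \<in> {a..b}" for t
  proof (cases "m \<le> t")
    case True
    then show ?thesis using zh[of t] t by (simp add: k_right wr_def)
  next
    case False
    then show ?thesis using yh[of "-t"] t by (simp add: k_left wl_def)
  qed
  define D where "D t = (indicator {a..b} t * k t) * (exp (\<phi> t) - exp (g t))" for t
  have meas: "(\<lambda>t. indicator {a..b} t * k t) \<in> borel_measurable (lebesgue_Icc l u)"
    unfolding k_def by (intro measurable_restrict_space1) simp
  have bounded: "\<bar>indicator {a..b} t * k t\<bar> \<le> 1 + (1 / wr) * (b - m) + (1 / wl) * (m - a)" for t
  proof (cases "t \<in> {a..b}")
    case True
    have "(1 / wr) * max 0 (t - m) \<le> (1 / wr) * (b - m)" "(1 / wl) * max 0 (m - t) \<le> (1 / wl) * (m - a)"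
      using True amb w0 by (auto intro!: mult_left_mono divide_right_mono)
    moreover have "0 \<le> (1 / wr) * max 0 (t - m)" "0 \<le> (1 / wl) * max 0 (m - t)" using w0 by auto
    ultimately have "\<bar>k t\<bar> \<le> 1 + (1 / wr) * (b - m) + (1 / wl) * (m - a)"
      unfolding k_def by linarith
    then show ?thesis using True by simp
  next
    case False
    then show ?thesis using w0 amb by (simp add: add_nonneg_nonneg)
  qed
  have intD: "integrable (lebesgue_Icc l u) D"
    unfolding D_def by (rule integrable_difference[OF meas bounded])
  define \<eta> where "\<eta> = 1 - exp (- \<epsilon>)"
  have \<eta>: "0 \<le> \<eta>" using \<epsilon> by (simp add: \<eta>_def)
  have D_ge: "\<eta> * (k t)\<^sup>2 * exp (\<phi> t) \<le> D t" if t: "t \<in> {a..b}" for t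
  proof -
    have "\<eta> * (k t)\<^sup>2 \<le> k t * (1 - exp (- (\<phi> t - g t)))"
      unfolding \<eta>_def by (rule exp_increment_lower[OF kh[OF t] k1 \<epsilon>])
    then have "\<eta> * (k t)\<^sup>2 * exp (\<phi> t) \<le> k t * (1 - exp (- (\<phi> t - g t))) * exp (\<phi> t)"
      by (intro mult_right_mono) auto
    also have "\<dots> = k t * (exp (\<phi> t) - exp (g t))"
      by (simp add: algebra_simps flip: exp_add)
    finally show ?thesis using t by (simp add: D_def)
  qed
  define Hr where "Hr = min (b - m) H"
  define Hl where "Hl = min (m - a) H"
  have HH: "0 < Hr" "Hr \<le> b - m" "Hr \<le> H" "0 < Hl" "Hl \<le> m - a" "Hl \<le> H"
    using amb pos by (auto simp: Hr_def Hl_def)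
  obtain p1 q1 k1 where r1: "0 < p1" "p1 \<le> q1" "q1 \<le> Hr" "0 \<le> k1" "\<And>s. s \<in> {p1..q1} \<Longrightarrow> k1 \<le> (1 - s / wr)\<^sup>2"
    "Hr / 128 * max 1 ((Hr / wr)\<^sup>2) \<le> k1 * (q1 - p1)"
    using square_ramp_lower[OF w0(1) HH(1)] by blast
  obtain p2 q2 k2 where r2: "0 < p2" "p2 \<le> q2" "q2 \<le> Hl" "0 \<le> k2" "\<And>s. s \<in> {p2..q2} \<Longrightarrow> k2 \<le> (1 - s / wl)\<^sup>2"
    "Hl / 128 * max 1 ((Hl / wl)\<^sup>2) \<le> k2 * (q2 - p2)"
    using square_ramp_lower[OF w0(2) HH(4)] by blast
  have f0t: "f\<^sub>0 \<le> exp (\<phi> t)" if "t \<in> {m - H..m + H}" for t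
    by (rule f\<^sub>0) (use that m pos in auto)
  define Q where "Q = error_rate C \<rho> \<delta> H f\<^sub>0 s"
  \<comment> \<open>The signals of the two sides, up to the factor \<open>\<eta>\<close>. The noise
    of each side is compared with the signal of the same side, so the two gaps may have entirely
    different lengths.\<close>
  define Br where "Br = f\<^sub>0 * (Hr / 128 * max 1 ((Hr / wr)\<^sup>2))"
  define Bl where "Bl = f\<^sub>0 * (Hl / 128 * max 1 ((Hl / wl)\<^sup>2))"
  have B0: "0 < Br" "0 < Bl" using pos HH by (auto simp: Br_def Bl_def intro!: mult_pos_pos)
  have "(\<eta> * k2 * f\<^sub>0) * ((m - p2) - (m - q2)) + (\<eta> * k1 * f\<^sub>0) * ((m + q1) - (m + p1))
    \<le> (\<integral>t. D t \<partial>lebesgue_Icc l u)"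
  proof (rule integral_lebesgue_Icc_ge2[OF intD])
    fix t assume "t \<in> {l..u}"
    show "0 \<le> D t"
    proof (cases "t \<in> {a..b}")
      case True
      have "0 \<le> \<eta> * (k t)\<^sup>2 * exp (\<phi> t)" using \<eta> by simp
      also note D_ge[OF True]
      finally show ?thesis .
    qed (simp add: D_def)
  next
    fix t assume t: "t \<in> {m - q2..m - p2}"
    have "k2 \<le> (1 - (m - t) / wl)\<^sup>2" by (rule r2(5)) (use t in auto)
    then have "k2 \<le> (k t)\<^sup>2" using k_left[of t] t r2 by simp
    moreover have "f\<^sub>0 \<le> exp (\<phi> t)" by (rule f0t) (use t r2 HH in auto)
    ultimately have "\<eta> * k2 * f\<^sub>0 \<le> \<eta> * (k t)\<^sup>2 * exp (\<phi> t)"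
      using \<eta> pos r2 by (intro mult_mono mult_left_mono mult_nonneg_nonneg) auto
    also have "\<dots> \<le> D t" by (rule D_ge) (use t r2 HH amb in auto)
    finally show "\<eta> * k2 * f\<^sub>0 \<le> D t" .
  next
    fix t assume t: "t \<in> {m + p1..m + q1}"
    have "k1 \<le> (1 - (t - m) / wr)\<^sup>2" by (rule r1(5)) (use t in auto)
    then have "k1 \<le> (k t)\<^sup>2" using k_right[of t] t r1 by simp
    moreover have "f\<^sub>0 \<le> exp (\<phi> t)" by (rule f0t) (use t r1 HH in auto)
    ultimately have "\<eta> * k1 * f\<^sub>0 \<le> \<eta> * (k t)\<^sup>2 * exp (\<phi> t)"
      using \<eta> pos r1 by (intro mult_mono mult_left_mono mult_nonneg_nonneg) auto
    also have "\<dots> \<le> D t" by (rule D_ge) (use t r1 HH amb in auto)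
    finally show "\<eta> * k1 * f\<^sub>0 \<le> D t" .
  qed (use r1 r2 HH m a b sub in auto)
  moreover have "\<eta> * (Bl + Br) \<le> (\<eta> * k2 * f\<^sub>0) * ((m - p2) - (m - q2)) + (\<eta> * k1 * f\<^sub>0) * ((m + q1) - (m + p1))"
  proof -
    have Bl: "f\<^sub>0 * (Hl / 128 * max 1 ((Hl / wl)\<^sup>2)) \<le> f\<^sub>0 * (k2 * (q2 - p2))"
      and Br: "f\<^sub>0 * (Hr / 128 * max 1 ((Hr / wr)\<^sup>2)) \<le> f\<^sub>0 * (k1 * (q1 - p1))"
      using pos by (intro mult_left_mono r1(6) r2(6); simp)+
    have "\<eta> * (Bl + Br) \<le> \<eta> * (f\<^sub>0 * (k2 * (q2 - p2)) + f\<^sub>0 * (k1 * (q1 - p1)))"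
      unfolding Br_def Bl_def by (rule mult_left_mono[OF add_mono[OF Bl Br] \<eta>])
    then show ?thesis by (simp add: algebra_simps)
  qed
  moreover have "(\<integral>t. D t \<partial>lebesgue_Icc l u) \<le> Q * (Bl + Br)"
  proof -
    have "(\<integral>t. D t \<partial>lebesgue_Icc l u)
      \<le> 1 * err (b - a) + (1 / wr) * ((b - m) * err (b - m)) + (1 / wl) * ((m - a) * err (m - a))"
      unfolding D_def k_def
      by (rule test_bound[OF a(2) _ b(2)]) (use a b c d amb wr wl w0 in \<open>auto simp: le_divide_eq\<close>)
    \<comment> \<open>The indicator extends over both gaps; its noise is shared out between the two
      sides.\<close>
    also have "err (b - a) \<le> err (b - m) + err (m - a)"
      using err_add[of "b - m" "m - a"] amb by simp
    finally have "(\<integral>t. D t \<partial>lebesgue_Icc l u)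
      \<le> err (b - m) * (1 + (b - m) / wr) + err (m - a) * (1 + (m - a) / wl)"
      by (simp add: algebra_simps diff_divide_distrib)
    also have "\<dots> \<le> Q * Br + Q * Bl"
      unfolding Q_def Br_def Bl_def Hr_def Hl_def
      using s a b c d amb by (intro add_mono error_rate_lower_side pos wr wl) auto
    finally show ?thesis by (simp add: algebra_simps)
  qed
  ultimately have "\<eta> * (Bl + Br) \<le> Q * (Bl + Br)" by linarith
  then have "\<eta> \<le> Q" using B0 by (simp add: mult_le_cancel_right)
  then show ?thesis by (simp add: \<eta>_def Q_def)
qed

end

subsection \<open>The extended-real formulation\<close>

text \<open>Finite values at both ends force finite values in between. This is the passage from
  extended-real to real functions.\<close>

lemma concave_ereal_Icc:
  assumes \<phi>: "concave_ereal \<phi>" and lu: "l < u" "\<phi> l \<noteq> -\<infinity>" "\<phi> u \<noteq> -\<infinity>"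
  shows "\<forall>t\<in>{l..u}. \<phi> t = ereal (real_of_ereal (\<phi> t))" "concave_on {l..u} (\<lambda>t. real_of_ereal (\<phi> t))"
proof -
  have ninf: "\<phi> t \<noteq> \<infinity>" for t using \<phi> by (simp add: concave_ereal_def)
  have conc: "ereal (1 - t) * \<phi> x + ereal t * \<phi> y \<le> \<phi> ((1 - t) * x + t * y)" if "0 < t" "t < 1" for x y t
    using \<phi> that by (simp add: concave_ereal_def)
  obtain pl pu where pl: "\<phi> l = ereal pl" and pu: "\<phi> u = ereal pu"
    using lu ninf by (metis ereal_cases)
  have fin: "\<phi> t = ereal (real_of_ereal (\<phi> t))" if t: "t \<in> {l..u}" for t
  proof -
    consider "t = l" | "t = u" | "l < t" "t < u" using t by force
    then show ?thesis
    proof cases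
      case 3
      define s where "s = (t - l) / (u - l)"
      have s: "0 < s" "s < 1" using 3 by (auto simp: s_def)
      have "s * (u - l) = t - l" using lu by (simp add: s_def)
      then have ts: "(1 - s) * l + s * u = t" by (simp add: algebra_simps)
      have "ereal ((1 - s) * pl + s * pu) \<le> \<phi> t"
        using conc[OF s, of l u] unfolding ts pl pu by simp
      then have "\<phi> t \<noteq> -\<infinity>" by auto
      then show ?thesis using ninf[of t] by (cases "\<phi> t") auto
    qed (simp_all add: pl pu)
  qed
  then show "\<forall>t\<in>{l..u}. \<phi> t = ereal (real_of_ereal (\<phi> t))" by blast
  show "concave_on {l..u} (\<lambda>t. real_of_ereal (\<phi> t))"
  proof (rule concave_on_linorderI)
    fix t x y :: real assume t: "0 < t" "t < 1" and xy: "x \<in> {l..u}" "y \<in> {l..u}"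
    have m: "(1 - t) * x + t * y \<in> {l..u}"
      using convexD_alt[of "{l..u}" x y t] xy t by simp
    have "ereal (1 - t) * \<phi> x + ereal t * \<phi> y
      = ereal ((1 - t) * real_of_ereal (\<phi> x) + t * real_of_ereal (\<phi> y))"
      by (subst fin[OF xy(1)], subst fin[OF xy(2)]) simp
    with conc[OF t, of x y] have "ereal ((1 - t) * real_of_ereal (\<phi> x) + t * real_of_ereal (\<phi> y))
        \<le> ereal (real_of_ereal (\<phi> ((1 - t) * x + t * y)))"
      using fin[OF m] by simp
    then show "(1 - t) * real_of_ereal (\<phi> x) + t * real_of_ereal (\<phi> y) \<le> real_of_ereal (\<phi> ((1 - t) *\<^sub>R x + t *\<^sub>R y))"
      by simp
  qed simp
qed

text \<open>Makes a real function on \<open>{l..u}\<close> a competitor in the extended-real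
  problem.\<close>

definition truncated :: "real \<Rightarrow> real \<Rightarrow> (real \<Rightarrow> real) \<Rightarrow> real \<Rightarrow> ereal" where
  "truncated l u k t = (if t \<in> {l..u} then ereal (k t) else -\<infinity>)"

lemma concave_ereal_truncated:
  assumes "concave_on {l..u} k"
  shows "concave_ereal (truncated l u k)"
  unfolding concave_ereal_def
proof (intro conjI allI impI)
  show "truncated l u k x \<noteq> \<infinity>" for x by (simp add: truncated_def)
  fix x y t :: real assume t: "0 < t \<and> t < 1"
  show "ereal (1 - t) * truncated l u k x + ereal t * truncated l u k y \<le> truncated l u k ((1 - t) * x + t * y)"
  proof (cases "x \<in> {l..u} \<and> y \<in> {l..u}")
    case True
    have "(1 - t) * x + t * y \<in> {l..u}"
      using convexD_alt[of "{l..u}" x y t] True t by simp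
    then show ?thesis
      using concave_onD[OF assms, of t x y] True t by (simp add: truncated_def)
  next
    case False
    then have eq: "ereal (1 - t) * truncated l u k x + ereal t * truncated l u k y = -\<infinity>"
      using t by (auto simp: truncated_def)
    show ?thesis unfolding eq by simp
  qed
qed

lemma log_lik_truncated:
  assumes k: "concave_on {l..u} k" and n: "0 < n" and x: "\<And>i. i < n \<Longrightarrow> x i \<in> {l..u}"
  shows "log_lik n x (truncated l u k) = ereal ((\<Sum>i<n. k (x i)) / n - (\<integral>t. exp (k t) \<partial>lebesgue_Icc l u))"
proof -
  have "(\<Sum>i<n. truncated l u k (x i)) = (\<Sum>i<n. ereal (k (x i)))"
    using x by (intro sum.cong) (auto simp: truncated_def)
  also have "\<dots> = ereal (\<Sum>i<n. k (x i))" by simp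
  finally have 1: "(\<Sum>i<n. truncated l u k (x i)) / ereal (real n) = ereal ((\<Sum>i<n. k (x i)) / n)"
    using n by simp
  have int: "integrable (lebesgue_Icc l u) (\<lambda>t. exp (k t))"
    using integrable_exp_concave[OF k, of "\<lambda>_. 1" 1] by simp
  have "(\<integral>\<^sup>+ t. exp_ereal (truncated l u k t) \<partial>lborel) = (\<integral>\<^sup>+ t. ennreal (exp (k t)) * indicator {l..u} t \<partial>lborel)"
    by (intro nn_integral_cong) (auto simp: truncated_def exp_ereal_def)
  also have "\<dots> = (\<integral>\<^sup>+ t. ennreal (exp (k t)) \<partial>lebesgue_Icc l u)"
    by (subst nn_integral_restrict_space) auto
  also have "\<dots> = ennreal (\<integral>t. exp (k t) \<partial>lebesgue_Icc l u)"
    using int by (intro nn_integral_eq_integral) auto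
  finally have 2: "enn2ereal (\<integral>\<^sup>+ t. exp_ereal (truncated l u k t) \<partial>lborel) = ereal (\<integral>t. exp (k t) \<partial>lebesgue_Icc l u)"
    by (simp add: enn2ereal_ennreal integral_nonneg_AE)
  show ?thesis unfolding log_lik_def 1 2 by simp
qed

text \<open>A maximiser is finite at every observation, since otherwise the functional would be
  -\<infinity> and a constant on \<open>{l..u}\<close> would do better. Cutting the maximiser off
  outside the sample range keeps the sum and can only reduce the integral, so the restriction is
  optimal among real concave functions on \<open>{l..u}\<close>.\<close>

lemma log_concave_mle_imp_concave_mle:
  assumes mle: "log_concave_mle n x \<psi>" and n: "0 < n" and lu: "l < u"
    and x: "\<And>i. i < n \<Longrightarrow> x i \<in> {l..u}" and ends: "l \<in> x ` {..<n}" "u \<in> x ` {..<n}"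
  shows "\<forall>t\<in>{l..u}. \<psi> t = ereal (real_of_ereal (\<psi> t))" "concave_mle n x l u (\<lambda>t. real_of_ereal (\<psi> t))"
proof -
  have \<psi>: "concave_ereal \<psi>" and max: "concave_ereal k \<Longrightarrow> log_lik n x k \<le> log_lik n x \<psi>" for k
    using mle unfolding log_concave_mle_def is_arg_max_def by (auto simp: not_less)
  have ninf: "\<psi> t \<noteq> \<infinity>" for t using \<psi> by (simp add: concave_ereal_def)
  have lik: "log_lik n x (truncated l u k) = ereal ((\<Sum>i<n. k (x i)) / n - (\<integral>t. exp (k t) \<partial>lebesgue_Icc l u))"
    if "concave_on {l..u} k" for k
    using that n x by (rule log_lik_truncated)
  have const: "concave_on {l..u} (\<lambda>_. 0)" by (simp add: concave_on_const)
  have fin: "\<psi> (x i) \<noteq> -\<infinity>" if i: "i < n" for i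
  proof
    assume "\<psi> (x i) = -\<infinity>"
    then have "(\<Sum>i<n. \<psi> (x i)) = -\<infinity>"
      using i ninf by (subst sum.remove[of _ i]) (auto simp: sum_Pinfty)
    then have "(\<Sum>i<n. \<psi> (x i)) / ereal (real n) = -\<infinity>" using n by simp
    moreover have "-\<infinity> - enn2ereal I = -\<infinity>" for I
      using enn2ereal_nonneg[of I] by (cases "enn2ereal I") auto
    ultimately have "log_lik n x \<psi> = -\<infinity>"
      unfolding log_lik_def by simp
    moreover have "log_lik n x (truncated l u (\<lambda>_. 0)) \<noteq> -\<infinity>"
      using lik[OF const] by simp
    ultimately show False
      using max[OF concave_ereal_truncated[OF const]] by simp
  qed
  then have "\<psi> l \<noteq> -\<infinity>" "\<psi> u \<noteq> -\<infinity>" using ends by auto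
  note fin_Icc = concave_ereal_Icc[OF \<psi> lu this]
  then show "\<forall>t\<in>{l..u}. \<psi> t = ereal (real_of_ereal (\<psi> t))" by simp
  define g where "g t = real_of_ereal (\<psi> t)" for t
  have g: "concave_on {l..u} g" using fin_Icc(2) by (simp add: g_def[abs_def])
  have trunc: "truncated l u g t \<le> \<psi> t" for t
    using fin_Icc(1) by (auto simp: truncated_def g_def)
  have eq: "truncated l u g t = \<psi> t" if "t \<in> {l..u}" for t
    using fin_Icc(1) that by (auto simp: truncated_def g_def)
  have mono: "exp_ereal a \<le> exp_ereal b" if "a \<le> b" "b \<noteq> \<infinity>" for a b
    using that by (cases a; cases b) (auto simp: exp_ereal_def intro!: ennreal_leI)
  have "log_lik n x \<psi> \<le> log_lik n x (truncated l u g)"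
    unfolding log_lik_def
  proof (rule ereal_minus_mono)
    have "(\<Sum>i<n. \<psi> (x i)) = (\<Sum>i<n. truncated l u g (x i))"
      using x by (intro sum.cong) (auto simp: eq)
    then show "(\<Sum>i<n. \<psi> (x i)) / ereal (real n) \<le> (\<Sum>i<n. truncated l u g (x i)) / ereal (real n)" by simp
    show "enn2ereal (\<integral>\<^sup>+ t. exp_ereal (truncated l u g t) \<partial>lborel) \<le> enn2ereal (\<integral>\<^sup>+ t. exp_ereal (\<psi> t) \<partial>lborel)"
      using mono[OF trunc ninf] by (simp add: less_eq_ennreal.rep_eq[symmetric] nn_integral_mono)
  qed
  then have opt: "log_lik n x (truncated l u k) \<le> log_lik n x (truncated l u g)" if "concave_on {l..u} k" for k
    using max[OF concave_ereal_truncated[OF that]] by simp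
  show "concave_mle n x l u (\<lambda>t. real_of_ereal (\<psi> t))"
    unfolding g_def[symmetric]
  proof
    fix k assume k: "concave_on {l..u} k"
    show "(\<Sum>i<n. k (x i)) / n - (\<integral>t. exp (k t) \<partial>lebesgue_Icc l u)
        \<le> (\<Sum>i<n. g (x i)) / n - (\<integral>t. exp (g t) \<partial>lebesgue_Icc l u)"
      using opt[OF k] by (simp add: lik k g)
  qed (use n lu x g in auto)
qed

subsection \<open>Hoelder continuity\<close>

text \<open>Unifies the two cases of the class: \<sigma> is 0 for \<beta> = 1, and for \<beta> > 1
  it is the derivative at \<open>t\<close>, with the mean value theorem for the remainder.\<close>

lemma Hoelder_class_expansion:
  assumes f: "f \<in> Hoelder_class \<beta> L {A..B}" and t: "t \<in> {A..B}" and L: "0 \<le> L"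
  shows "\<exists>\<sigma>. \<forall>y\<in>{A..B}. \<bar>f y - f t - \<sigma> * (y - t)\<bar> \<le> L * \<bar>y - t\<bar> powr \<beta>"
proof (cases "\<beta> = 1")
  case True
  then have "\<bar>f y - f t - 0 * (y - t)\<bar> \<le> L * \<bar>y - t\<bar> powr \<beta>" if "y \<in> {A..B}" for y
    using f t that by (auto simp: Hoelder_class_def)
  then show ?thesis by blast
next
  case False
  with f obtain f' where \<beta>: "1 < \<beta>"
    and deriv: "\<And>x. x \<in> {A..B} \<Longrightarrow> (f has_real_derivative f' x) (at x within {A..B})"
    and f': "\<And>x y. x \<in> {A..B} \<Longrightarrow> y \<in> {A..B} \<Longrightarrow> \<bar>f' x - f' y\<bar> \<le> L * \<bar>x - y\<bar> powr (\<beta> - 1)"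
    unfolding Hoelder_class_def by blast
  have "\<bar>f y - f t - f' t * (y - t)\<bar> \<le> L * \<bar>y - t\<bar> powr \<beta>" if y: "y \<in> {A..B}" for y
  proof (cases "y = t")
    case False
    define p where "p = min y t"
    define q where "q = max y t"
    have pq: "p < q" "{p..q} \<subseteq> {A..B}" using False y t by (auto simp: p_def q_def)
    have "(f has_derivative (\<lambda>h. h * f' x)) (at x within {p..q})" if "x \<in> {p..q}" for x
      using deriv[of x] that pq has_field_derivative_subset[of f "f' x" x "{A..B}" "{p..q}"]
      by (auto simp: has_field_derivative_def mult_commute_abs)
    from mvt_very_simple[OF less_imp_le[OF pq(1)] this]
    obtain \<xi> where \<xi>: "\<xi> \<in> {p..q}" "f q - f p = (q - p) * f' \<xi>" by auto
    then have "f y - f t = f' \<xi> * (y - t)" by (auto simp: p_def q_def min_def max_def algebra_simps split: if_splits)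
    then have "\<bar>f y - f t - f' t * (y - t)\<bar> = \<bar>f' \<xi> - f' t\<bar> * \<bar>y - t\<bar>"
      by (simp add: abs_mult flip: left_diff_distrib)
    also have "\<dots> \<le> L * \<bar>\<xi> - t\<bar> powr (\<beta> - 1) * \<bar>y - t\<bar>"
      using f'[of \<xi> t] \<xi> pq t by (intro mult_right_mono) auto
    also have "\<dots> \<le> L * \<bar>y - t\<bar> powr (\<beta> - 1) * \<bar>y - t\<bar>"
      using \<xi> \<beta> L by (intro mult_right_mono mult_left_mono powr_mono2) (auto simp: p_def q_def)
    also have "\<dots> = L * \<bar>y - t\<bar> powr \<beta>"
      using False powr_mult_base[of "\<bar>y - t\<bar>" "\<beta> - 1"] by (simp add: mult_ac)
    finally show ?thesis .
  qed (use L in simp)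
  then show ?thesis by blast
qed

section \<open>From a deviation at one point to a deviation on an interval\<close>

lemma concave_on_subset_Icc:
  "concave_on {l..u} g \<Longrightarrow> l \<le> A \<Longrightarrow> B \<le> u \<Longrightarrow> concave_on {A..B} (g :: real \<Rightarrow> real)"
  unfolding concave_on_def by (rule convex_on_subset) auto

text \<open>\<open>D\<close> is \<open>g\<close> minus the linear approximation of \<open>f\<close>
  at \<open>t\<close>. It is concave and, up to distance \<open>4 * \<delta>\<close>, differs from
  \<open>g - f\<close> by at most \<open>16 * L * \<delta> powr \<beta>\<close>, where 16 bounds
  \<open>4 powr \<beta>\<close>. Either \<open>D\<close> keeps half of the excess up to
  \<open>t + \<delta>\<close>, or it falls so fast that from \<open>t + 3 * \<delta>\<close> on the
  excess has turned into a deficit.\<close>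

lemma excess_interval_right:
  fixes g f :: "real \<Rightarrow> real"
  assumes g: "concave_on {A..B} g" and t: "A \<le> t" "t + 4 * \<delta> \<le> B" and \<delta>: "0 < \<delta>"
    and exc: "f t + \<epsilon> \<le> g t" and \<epsilon>: "0 \<le> \<epsilon>" and \<beta>: "0 \<le> \<beta>" "\<beta> \<le> 2" and L: "0 \<le> L"
    and exp: "\<And>y. y \<in> {A..B} \<Longrightarrow> \<bar>f y - f t - \<sigma> * (y - t)\<bar> \<le> L * \<bar>y - t\<bar> powr \<beta>"
  shows "\<exists>c. A \<le> c \<and> c + \<delta> \<le> B \<and>
    ((\<forall>y\<in>{c..c + \<delta>}. f y + (\<epsilon> / 2 - 16 * L * \<delta> powr \<beta>) \<le> g y) \<or>
     (\<forall>y\<in>{c..c + \<delta>}. g y + (\<epsilon> / 2 - 16 * L * \<delta> powr \<beta>) \<le> f y))"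
proof -
  define D where "D y = g y - f t - \<sigma> * (y - t)" for y
  have D: "(z - y) * D x + (y - x) * D z \<le> (z - x) * D y" if "x \<in> {A..B}" "z \<in> {A..B}" "x < z" "x \<le> y" "y \<le> z" for x y z
    using concave_on_Icc_ineq[OF g that] by (simp add: D_def algebra_simps)
  have close: "\<bar>f y - f t - \<sigma> * (y - t)\<bar> \<le> 16 * L * \<delta> powr \<beta>" if y: "y \<in> {t..t + 4 * \<delta>}" for y
  proof -
    have "\<bar>y - t\<bar> powr \<beta> \<le> (4 * \<delta>) powr \<beta>" using y \<beta> by (intro powr_mono2) auto
    also have "\<dots> = 4 powr \<beta> * \<delta> powr \<beta>" using \<delta> by (simp add: powr_mult)
    also have "\<dots> \<le> 4 powr 2 * \<delta> powr \<beta>" using \<beta> by (intro mult_right_mono powr_mono) auto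
    also have "\<dots> = 16 * \<delta> powr \<beta>" by simp
    finally have "L * \<bar>y - t\<bar> powr \<beta> \<le> L * (16 * \<delta> powr \<beta>)" using L by (intro mult_left_mono)
    with exp[of y] y t show ?thesis by simp
  qed
  have Dt: "\<epsilon> \<le> D t" using exc by (simp add: D_def)
  show ?thesis
  proof (cases "\<epsilon> / 2 \<le> D (t + \<delta>)")
    case True
    have "f y + (\<epsilon> / 2 - 16 * L * \<delta> powr \<beta>) \<le> g y" if y: "y \<in> {t..t + \<delta>}" for y
    proof -
      have "\<delta> * (\<epsilon> / 2) = (t + \<delta> - y) * (\<epsilon> / 2) + (y - t) * (\<epsilon> / 2)"
        by (simp flip: distrib_right)
      also have "\<dots> \<le> (t + \<delta> - y) * D t + (y - t) * D (t + \<delta>)"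
        using y Dt True \<epsilon> by (intro add_mono mult_left_mono) auto
      also have "\<dots> \<le> \<delta> * D y" using D[of t "t + \<delta>" y] y t \<delta> by simp
      finally have "\<epsilon> / 2 \<le> D y" using \<delta> by simp
      then show ?thesis using close[of y] y \<delta> by (simp add: D_def)
    qed
    then show ?thesis using t \<delta> by (intro exI[of _ t]) auto
  next
    case False
    have "g y + (\<epsilon> / 2 - 16 * L * \<delta> powr \<beta>) \<le> f y" if y: "y \<in> {t + 3 * \<delta>..t + 3 * \<delta> + \<delta>}" for y
    proof -
      have "(y - (t + \<delta>)) * D t + \<delta> * D y \<le> (y - t) * D (t + \<delta>)"
        using D[of t y "t + \<delta>"] y t \<delta> by simp
      moreover have "(y - (t + \<delta>)) * \<epsilon> \<le> (y - (t + \<delta>)) * D t" using y Dt \<delta> by (intro mult_left_mono) auto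
      moreover have "(y - t) * D (t + \<delta>) \<le> (y - t) * (\<epsilon> / 2)" using y False \<delta> by (intro mult_left_mono) auto
      ultimately have "\<delta> * D y \<le> (y - t) * (\<epsilon> / 2) - (y - (t + \<delta>)) * \<epsilon>" by linarith
      also have "\<dots> = \<delta> * \<epsilon> - (y - t) * (\<epsilon> / 2)" by (simp add: field_simps)
      \<comment> \<open>A loss of more than \<epsilon> / 2 per step \<delta> leads in three steps
        from \<epsilon> below \<open>- \<epsilon> / 2\<close>.\<close>
      also have "\<dots> \<le> \<delta> * \<epsilon> - (3 * \<delta>) * (\<epsilon> / 2)"
        using y \<epsilon> by (intro diff_left_mono mult_right_mono) auto
      also have "\<dots> = \<delta> * (- (\<epsilon> / 2))" by (simp add: algebra_simps)
      finally have "D y \<le> - (\<epsilon> / 2)" using \<delta> by (simp only: mult_le_cancel_left_pos)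
      then show ?thesis using close[of y] y \<delta> by (simp add: D_def)
    qed
    then show ?thesis using t \<delta> by (intro exI[of _ "t + 3 * \<delta>"]) auto
  qed
qed

text \<open>Room of length \<open>4 * \<delta>\<close> is needed on one side of \<open>t\<close>
  only, and \<open>8 * \<delta> \<le> B - A\<close> provides it for every \<open>t\<close>. This is
  why the upper bound reaches the end points of \<open>{A..B}\<close>.\<close>

lemma excess_interval:
  fixes g f :: "real \<Rightarrow> real"
  assumes g: "concave_on {A..B} g" and t: "t \<in> {A..B}" and \<delta>: "0 < \<delta>" "8 * \<delta> \<le> B - A"
    and exc: "f t + \<epsilon> \<le> g t" and \<epsilon>: "0 \<le> \<epsilon>" and \<beta>: "0 \<le> \<beta>" "\<beta> \<le> 2" and L: "0 \<le> L"
    and f: "f \<in> Hoelder_class \<beta> L {A..B}"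
  shows "\<exists>c. A \<le> c \<and> c + \<delta> \<le> B \<and>
    ((\<forall>y\<in>{c..c + \<delta>}. f y + (\<epsilon> / 2 - 16 * L * \<delta> powr \<beta>) \<le> g y) \<or>
     (\<forall>y\<in>{c..c + \<delta>}. g y + (\<epsilon> / 2 - 16 * L * \<delta> powr \<beta>) \<le> f y))"
proof -
  obtain \<sigma> where exp: "\<And>y. y \<in> {A..B} \<Longrightarrow> \<bar>f y - f t - \<sigma> * (y - t)\<bar> \<le> L * \<bar>y - t\<bar> powr \<beta>"
    using Hoelder_class_expansion[OF f t L] by blast
  show ?thesis
  proof (cases "t + 4 * \<delta> \<le> B")
    case True
    show ?thesis
      by (rule excess_interval_right[OF g _ True \<delta>(1) exc \<epsilon> \<beta> L exp]) (use t in auto)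
  next
    case False
    have "\<bar>f (-y) - f (- (-t)) - (-\<sigma>) * (y - (-t))\<bar> \<le> L * \<bar>y - (-t)\<bar> powr \<beta>" if "y \<in> {-B..-A}" for y
    proof -
      have "\<bar>f (-y) - f t - \<sigma> * (-y - t)\<bar> \<le> L * \<bar>-y - t\<bar> powr \<beta>" using exp[of "-y"] that by simp
      moreover have "\<bar>-y - t\<bar> = \<bar>y - (-t)\<bar>" by simp
      moreover have "\<sigma> * (-y - t) = (-\<sigma>) * (y - (-t))" by (simp add: algebra_simps)
      ultimately show ?thesis by simp
    qed
    note r = excess_interval_right[OF concave_on_uminus_arg[OF g] _ _ \<delta>(1) _ \<epsilon> \<beta> L this]
    have "\<exists>c. -B \<le> c \<and> c + \<delta> \<le> -A \<and>
      ((\<forall>y\<in>{c..c + \<delta>}. f (-y) + (\<epsilon> / 2 - 16 * L * \<delta> powr \<beta>) \<le> g (-y)) \<or>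
       (\<forall>y\<in>{c..c + \<delta>}. g (-y) + (\<epsilon> / 2 - 16 * L * \<delta> powr \<beta>) \<le> f (-y)))"
      by (rule r) (use t False \<delta> exc in auto)
    then obtain c where c: "-B \<le> c" "c + \<delta> \<le> -A"
      and or: "(\<forall>y\<in>{c..c + \<delta>}. f (-y) + (\<epsilon> / 2 - 16 * L * \<delta> powr \<beta>) \<le> g (-y)) \<or>
       (\<forall>y\<in>{c..c + \<delta>}. g (-y) + (\<epsilon> / 2 - 16 * L * \<delta> powr \<beta>) \<le> f (-y))" by blast
    have flip: "-y \<in> {c..c + \<delta>}" if "y \<in> {- c - \<delta>..- c - \<delta> + \<delta>}" for y using that by auto
    from or have "(\<forall>y\<in>{- c - \<delta>..- c - \<delta> + \<delta>}. f y + (\<epsilon> / 2 - 16 * L * \<delta> powr \<beta>) \<le> g y) \<or>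
       (\<forall>y\<in>{- c - \<delta>..- c - \<delta> + \<delta>}. g y + (\<epsilon> / 2 - 16 * L * \<delta> powr \<beta>) \<le> f y)"
      using flip by (metis minus_minus)
    then show ?thesis using c by (intro exI[of _ "- c - \<delta>"]) auto
  qed
qed

text \<open>A concave function cannot exceed its value at \<open>t\<close> on both sides of
  \<open>t\<close>, so the deficit persists on one of the two adjacent intervals. Which one is
  unknown, hence \<open>t\<close> keeps distance \<delta> from both ends; this is the origin of the
  inner interval.\<close>

lemma deficit_interval:
  fixes g f :: "real \<Rightarrow> real"
  assumes g: "concave_on {A..B} g" and t: "t \<in> {A + \<delta>..B - \<delta>}" and \<delta>: "0 < \<delta>"
    and def: "g t + \<epsilon> \<le> f t" and \<beta>: "0 \<le> \<beta>" and L: "0 \<le> L"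
    and f: "f \<in> Hoelder_class \<beta> L {A..B}"
  shows "\<exists>c. A \<le> c \<and> c + \<delta> \<le> B \<and> (\<forall>y\<in>{c..c + \<delta>}. g y + (\<epsilon> - L * \<delta> powr \<beta>) \<le> f y)"
proof -
  have tAB: "t \<in> {A..B}" using t \<delta> by auto
  obtain \<sigma> where exp: "\<And>y. y \<in> {A..B} \<Longrightarrow> \<bar>f y - f t - \<sigma> * (y - t)\<bar> \<le> L * \<bar>y - t\<bar> powr \<beta>"
    using Hoelder_class_expansion[OF f tAB L] by blast
  define D where "D y = g y - f t - \<sigma> * (y - t)" for y
  have D: "(z - y) * D x + (y - x) * D z \<le> (z - x) * D y" if "x \<in> {A..B}" "z \<in> {A..B}" "x < z" "x \<le> y" "y \<le> z" for x y z
    using concave_on_Icc_ineq[OF g that] by (simp add: D_def algebra_simps)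
  have Dt: "D t \<le> - \<epsilon>" using def by (simp add: D_def)
  have fin: "g y + (\<epsilon> - L * \<delta> powr \<beta>) \<le> f y" if y: "y \<in> {A..B}" "\<bar>y - t\<bar> \<le> \<delta>" "D y \<le> D t" for y
  proof -
    have "L * \<bar>y - t\<bar> powr \<beta> \<le> L * \<delta> powr \<beta>"
      using y \<beta> L by (intro mult_left_mono powr_mono2) auto
    then show ?thesis using exp[OF y(1)] y(3) Dt by (simp add: D_def)
  qed
  show ?thesis
  proof (cases "\<forall>y\<in>{t..t + \<delta>}. D y \<le> D t")
    case True
    then show ?thesis using t \<delta> fin by (intro exI[of _ t]) auto
  next
    case False
    then obtain z where z: "z \<in> {t..t + \<delta>}" "D t < D z" by auto
    then have tz: "t < z" by (cases "z = t") auto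
    have "D y \<le> D t" if y: "y \<in> {t - \<delta>..t}" for y
    proof (rule ccontr)
      assume "\<not> D y \<le> D t"
      then have Dy: "D t < D y" by simp
      then have yt: "y < t" using y by (cases "y = t") auto
      have "(z - t) * D y + (t - y) * D z \<le> (z - y) * D t"
        using D[of y z t] y z t tz \<delta> by auto
      moreover have "(z - t) * D t < (z - t) * D y" "(t - y) * D t < (t - y) * D z"
        using tz yt Dy z by auto
      ultimately show False by (simp add: algebra_simps)
    qed
    then show ?thesis using t \<delta> fin by (intro exI[of _ "t - \<delta>"]) auto
  qed
qed

subsection \<open>Uniform deviations of the empirical measure\<close>

text \<open>The exponent is proportional to \<open>p\<close>, which dominates the variance. This is
  what makes the deviations small on short intervals.\<close>

lemma (in prob_space) bernoulli_factor_mgf: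
  fixes \<theta> :: real
  assumes Y [measurable]: "random_variable borel Y" and S [measurable]: "S \<in> sets borel"
    and p: "prob {\<omega> \<in> space M. Y \<omega> \<in> S} = p" and \<theta>: "\<bar>\<theta>\<bar> \<le> 1"
  shows "(\<integral>\<^sup>+\<omega>. ennreal (exp (\<theta> * (indicator S (Y \<omega>) - p))) \<partial>M) \<le> ennreal (exp (p * \<theta>\<^sup>2))"
proof -
  have p0: "0 \<le> p" unfolding p[symmetric] by simp
  have eq: "exp (\<theta> * (indicator S (Y \<omega>) - p)) = exp (- \<theta> * p) * (1 + (exp \<theta> - 1) * indicator {\<omega> \<in> space M. Y \<omega> \<in> S} \<omega>)"
    if "\<omega> \<in> space M" for \<omega>
    using that by (auto simp: indicator_def right_diff_distrib exp_diff exp_minus field_simps)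
  have int: "integrable M (\<lambda>\<omega>. exp (- \<theta> * p) * (1 + (exp \<theta> - 1) * indicator {\<omega> \<in> space M. Y \<omega> \<in> S} \<omega>))"
    by (intro integrable_mult_right Bochner_Integration.integrable_add integrable_real_indicator) (auto simp: emeasure_eq_measure)
  have "(\<integral>\<^sup>+\<omega>. ennreal (exp (\<theta> * (indicator S (Y \<omega>) - p))) \<partial>M)
      = (\<integral>\<^sup>+\<omega>. ennreal (exp (- \<theta> * p) * (1 + (exp \<theta> - 1) * indicator {\<omega> \<in> space M. Y \<omega> \<in> S} \<omega>)) \<partial>M)"
    by (intro nn_integral_cong) (simp only: eq)
  also have "\<dots> = ennreal (\<integral>\<omega>. exp (- \<theta> * p) * (1 + (exp \<theta> - 1) * indicator {\<omega> \<in> space M. Y \<omega> \<in> S} \<omega>) \<partial>M)"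
    by (rule nn_integral_eq_integral[OF int]) (auto simp: indicator_def)
  also have "(\<integral>\<omega>. exp (- \<theta> * p) * (1 + (exp \<theta> - 1) * indicator {\<omega> \<in> space M. Y \<omega> \<in> S} \<omega>) \<partial>M)
      = exp (- \<theta> * p) * (1 + (exp \<theta> - 1) * p)"
  proof -
    have "integrable M (indicat_real {\<omega> \<in> space M. Y \<omega> \<in> S})"
      by (intro integrable_real_indicator) (auto simp: emeasure_eq_measure)
    moreover have "(\<integral>\<omega>. indicat_real {\<omega> \<in> space M. Y \<omega> \<in> S} \<omega> \<partial>M) = p"
      using p by (simp add: Int_def conj_commute cong: conj_cong)
    ultimately show ?thesis using prob_space by simp
  qed
  also have "ennreal (exp (- \<theta> * p) * (1 + (exp \<theta> - 1) * p)) \<le> ennreal (exp (p * \<theta>\<^sup>2))"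
  proof (rule ennreal_leI)
    have "exp \<theta> - 1 \<le> \<theta> + \<theta>\<^sup>2" using exp_le_quadratic[OF \<theta>] by simp
    then have "(exp \<theta> - 1) * p \<le> (\<theta> + \<theta>\<^sup>2) * p" using p0 by (rule mult_right_mono)
    moreover have "1 + (\<theta> + \<theta>\<^sup>2) * p \<le> exp ((\<theta> + \<theta>\<^sup>2) * p)" by (rule exp_ge_add_one_self)
    ultimately have "1 + (exp \<theta> - 1) * p \<le> exp ((\<theta> + \<theta>\<^sup>2) * p)" by linarith
    then have "exp (- \<theta> * p) * (1 + (exp \<theta> - 1) * p) \<le> exp (- \<theta> * p) * exp ((\<theta> + \<theta>\<^sup>2) * p)"
      by (rule mult_left_mono) simp
    also have "\<dots> = exp (p * \<theta>\<^sup>2)" unfolding exp_add[symmetric] by (simp add: algebra_simps)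
    finally show "exp (- \<theta> * p) * (1 + (exp \<theta> - 1) * p) \<le> exp (p * \<theta>\<^sup>2)" .
  qed
  finally show ?thesis .
qed

text \<open>The sign \<sigma> lets one Chernoff argument serve both tails.\<close>

lemma (in prob_space) bernoulli_sum_upper_tail:
  fixes \<theta> :: real and n :: nat and Y :: "nat \<Rightarrow> 'a \<Rightarrow> real"
  assumes indep: "indep_vars (\<lambda>_. borel) Y {..<n}" and S [measurable]: "S \<in> sets borel"
    and p: "\<And>i. i < n \<Longrightarrow> prob {\<omega> \<in> space M. Y i \<omega> \<in> S} = p" and \<sigma>: "\<bar>\<sigma>\<bar> = 1"
    and \<theta>: "0 < \<theta>" "\<theta> \<le> 1"
  shows "emeasure M {\<omega> \<in> space M. b \<le> \<sigma> * (\<Sum>i<n. indicator S (Y i \<omega>) - p)}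
    \<le> ennreal (exp (n * (p * \<theta>\<^sup>2) - \<theta> * b))"
proof -
  have Y [measurable]: "i \<in> {..<n} \<Longrightarrow> random_variable borel (Y i)" for i
    using indep unfolding indep_vars_def by auto
  have \<theta>': "\<bar>\<theta> * \<sigma>\<bar> \<le> 1" "(\<theta> * \<sigma>)\<^sup>2 = \<theta>\<^sup>2" 
  proof -
    have "\<sigma>\<^sup>2 = \<bar>\<sigma>\<bar>\<^sup>2" by simp
    then have "\<sigma>\<^sup>2 = 1" unfolding \<sigma> by simp
    then show "(\<theta> * \<sigma>)\<^sup>2 = \<theta>\<^sup>2" by (simp add: power_mult_distrib)
    show "\<bar>\<theta> * \<sigma>\<bar> \<le> 1" using \<sigma> \<theta> by (simp add: abs_mult)
  qed
  have "(\<integral>\<^sup>+\<omega>. ennreal (exp (\<theta> * (\<sigma> * (\<Sum>i<n. indicator S (Y i \<omega>) - p)))) * indicator (space M) \<omega> \<partial>M)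
     = (\<integral>\<^sup>+\<omega>. (\<Prod>i<n. ennreal (exp (\<theta> * \<sigma> * (indicator S (Y i \<omega>) - p)))) \<partial>M)"
  proof (intro nn_integral_cong)
    fix \<omega> assume "\<omega> \<in> space M"
    have "\<theta> * (\<sigma> * (\<Sum>i<n. indicator S (Y i \<omega>) - p)) = (\<Sum>i<n. \<theta> * \<sigma> * (indicator S (Y i \<omega>) - p))"
      by (simp add: sum_distrib_left mult.assoc)
    then show "ennreal (exp (\<theta> * (\<sigma> * (\<Sum>i<n. indicator S (Y i \<omega>) - p)))) * indicator (space M) \<omega>
       = (\<Prod>i<n. ennreal (exp (\<theta> * \<sigma> * (indicator S (Y i \<omega>) - p))))"
      using \<open>\<omega> \<in> space M\<close> by (simp only: exp_sum[OF finite_lessThan] prod_ennreal[OF exp_ge_zero] indicator_simps mult_1_right)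
  qed
  also have "\<dots> = (\<Prod>i<n. \<integral>\<^sup>+\<omega>. ennreal (exp (\<theta> * \<sigma> * (indicator S (Y i \<omega>) - p))) \<partial>M)"
  proof (rule indep_vars_nn_integral)
    show "indep_vars (\<lambda>_. borel) (\<lambda>i \<omega>. ennreal (exp (\<theta> * \<sigma> * (indicator S (Y i \<omega>) - p)))) {..<n}"
      by (rule indep_vars_compose2[OF indep]) measurable
  qed auto
  also have "\<dots> \<le> (\<Prod>i<n. ennreal (exp (p * \<theta>\<^sup>2)))"
  proof (rule prod_mono_ennreal)
    fix i assume "i \<in> {..<n}"
    then show "(\<integral>\<^sup>+\<omega>. ennreal (exp (\<theta> * \<sigma> * (indicator S (Y i \<omega>) - p))) \<partial>M) \<le> ennreal (exp (p * \<theta>\<^sup>2))"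
      using bernoulli_factor_mgf[OF Y S p \<theta>'(1), of i] \<theta>'(2) by simp
  qed
  also have "\<dots> = ennreal (exp (n * (p * \<theta>\<^sup>2)))"
    by (simp add: ennreal_power exp_of_nat_mult)
  finally have mgf: "(\<integral>\<^sup>+\<omega>. ennreal (exp (\<theta> * (\<sigma> * (\<Sum>i<n. indicator S (Y i \<omega>) - p)))) * indicator (space M) \<omega> \<partial>M)
     \<le> ennreal (exp (n * (p * \<theta>\<^sup>2)))" .
  have "emeasure M {\<omega> \<in> space M. b \<le> \<sigma> * (\<Sum>i<n. indicator S (Y i \<omega>) - p)}
    \<le> ennreal (exp (- \<theta> * b)) * (\<integral>\<^sup>+\<omega>. ennreal (exp (\<theta> * (\<sigma> * (\<Sum>i<n. indicator S (Y i \<omega>) - p)))) * indicator (space M) \<omega> \<partial>M)"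
    by (rule Chernoff_ineq_nn_integral_ge[OF \<theta>(1)]) measurable
  also have "\<dots> \<le> ennreal (exp (- \<theta> * b)) * ennreal (exp (n * (p * \<theta>\<^sup>2)))"
    by (rule mult_left_mono[OF mgf]) simp
  also have "\<dots> = ennreal (exp (n * (p * \<theta>\<^sup>2) - \<theta> * b))"
    by (simp add: ennreal_mult[symmetric] flip: exp_add)
  finally show ?thesis .
qed

lemma (in prob_space) empirical_deviation_tail:
  fixes n :: nat and Y :: "nat \<Rightarrow> 'a \<Rightarrow> real" and \<rho> v :: real
  assumes indep: "indep_vars (\<lambda>_. borel) Y {..<n}" and S [measurable]: "S \<in> sets borel"
    and p: "\<And>i. i < n \<Longrightarrow> prob {\<omega> \<in> space M. Y i \<omega> \<in> S} = p"
    and v: "p \<le> v" "0 \<le> v" and \<rho>: "0 < \<rho>" and n: "0 < n"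
  shows "emeasure M {\<omega> \<in> space M. 7 * (sqrt (v * \<rho>) + \<rho>) \<le> \<bar>(\<Sum>i<n. indicator S (Y i \<omega>)) / n - p\<bar>}
    \<le> ennreal (2 * exp (- 6 * (n * \<rho>)))"
proof -
  have Y [measurable]: "i \<in> {..<n} \<Longrightarrow> random_variable borel (Y i)" for i
    using indep unfolding indep_vars_def by auto
  \<comment> \<open>The Chernoff parameter of optimal order, capped at 1, where the quadratic bound
    of \<open>exp\<close> ends. In both cases \<open>v * \<theta>\<^sup>2 \<le> \<rho>\<close> and
    \<open>\<rho> \<le> \<theta> * (sqrt (v * \<rho>) + \<rho>)\<close>, so the factor 7 of the
    threshold leaves 6 in the exponent.\<close>
  define \<theta> where "\<theta> = (if \<rho> \<le> v then sqrt (\<rho> / v) else 1)"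
  have \<theta>: "0 < \<theta>" "\<theta> \<le> 1" using \<rho> by (auto simp: \<theta>_def)
  have v\<theta>: "v * \<theta>\<^sup>2 \<le> \<rho>" using \<rho> v by (auto simp: \<theta>_def)
  have "\<rho> \<le> \<theta> * (sqrt (v * \<rho>) + \<rho>)"
  proof (cases "\<rho> \<le> v")
    case True
    have "\<theta> * sqrt (v * \<rho>) = sqrt ((\<rho> / v) * (v * \<rho>))" using True by (simp add: \<theta>_def flip: real_sqrt_mult)
    also have "(\<rho> / v) * (v * \<rho>) = \<rho>\<^sup>2" using True \<rho> by (simp add: power2_eq_square)
    finally have "\<theta> * sqrt (v * \<rho>) = \<rho>" using \<rho> by simp
    then show ?thesis using \<theta> \<rho> by (simp add: distrib_left)
  next
    case False
    then show ?thesis using \<rho> v by (simp add: \<theta>_def)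
  qed
  define t where "t = 7 * (sqrt (v * \<rho>) + \<rho>)"
  have "n * (p * \<theta>\<^sup>2) \<le> n * (v * \<theta>\<^sup>2)" using v by (intro mult_left_mono mult_right_mono) auto
  also have "\<dots> \<le> n * \<rho>" using v\<theta> by (intro mult_left_mono) auto
  finally have 1: "n * (p * \<theta>\<^sup>2) \<le> n * \<rho>" .
  have "\<theta> * t = 7 * (\<theta> * (sqrt (v * \<rho>) + \<rho>))" by (simp add: t_def)
  then have "7 * \<rho> \<le> \<theta> * t" using \<open>\<rho> \<le> \<theta> * (sqrt (v * \<rho>) + \<rho>)\<close> by linarith
  then have "n * (7 * \<rho>) \<le> n * (\<theta> * t)" by (intro mult_left_mono) auto
  with 1 have expo: "n * (p * \<theta>\<^sup>2) - \<theta> * (n * t) \<le> - 6 * (n * \<rho>)" by (simp add: algebra_simps)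
  have tail: "emeasure M {\<omega> \<in> space M. n * t \<le> \<sigma> * (\<Sum>i<n. indicator S (Y i \<omega>) - p)} \<le> ennreal (exp (- 6 * (n * \<rho>)))"
    if "\<bar>\<sigma>\<bar> = 1" for \<sigma>
    by (rule order_trans[OF bernoulli_sum_upper_tail[OF indep S p that \<theta>]]) (use expo in \<open>auto intro!: ennreal_leI\<close>)
  have "{\<omega> \<in> space M. t \<le> \<bar>(\<Sum>i<n. indicator S (Y i \<omega>)) / n - p\<bar>}
     \<subseteq> {\<omega> \<in> space M. n * t \<le> 1 * (\<Sum>i<n. indicator S (Y i \<omega>) - p)} \<union> {\<omega> \<in> space M. n * t \<le> (-1) * (\<Sum>i<n. indicator S (Y i \<omega>) - p)}"
  proof (intro subsetI, elim CollectE conjE)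
    fix \<omega> assume \<omega>: "\<omega> \<in> space M" and le: "t \<le> \<bar>(\<Sum>i<n. indicator S (Y i \<omega>)) / n - p\<bar>"
    have eq: "(\<Sum>i<n. indicator S (Y i \<omega>) - p) = n * ((\<Sum>i<n. indicator S (Y i \<omega>)) / n - p)"
      using n by (simp add: sum_subtractf right_diff_distrib)
    from le n have "n * t \<le> n * \<bar>(\<Sum>i<n. indicator S (Y i \<omega>)) / n - p\<bar>" by simp
    then have "n * t \<le> \<bar>\<Sum>i<n. indicator S (Y i \<omega>) - p\<bar>" unfolding eq by (simp add: abs_mult)
    then show "\<omega> \<in> {\<omega> \<in> space M. n * t \<le> 1 * (\<Sum>i<n. indicator S (Y i \<omega>) - p)} \<union> {\<omega> \<in> space M. n * t \<le> (-1) * (\<Sum>i<n. indicator S (Y i \<omega>) - p)}"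
      using \<omega> by auto
  qed
  then have "emeasure M {\<omega> \<in> space M. t \<le> \<bar>(\<Sum>i<n. indicator S (Y i \<omega>)) / n - p\<bar>}
     \<le> emeasure M ({\<omega> \<in> space M. n * t \<le> 1 * (\<Sum>i<n. indicator S (Y i \<omega>) - p)} \<union> {\<omega> \<in> space M. n * t \<le> (-1) * (\<Sum>i<n. indicator S (Y i \<omega>) - p)})"
    by (rule emeasure_mono) measurable
  also have "\<dots> \<le> emeasure M {\<omega> \<in> space M. n * t \<le> 1 * (\<Sum>i<n. indicator S (Y i \<omega>) - p)} + emeasure M {\<omega> \<in> space M. n * t \<le> (-1) * (\<Sum>i<n. indicator S (Y i \<omega>) - p)}"
    by (rule emeasure_subadditive) measurable
  also have "\<dots> \<le> ennreal (exp (- 6 * (n * \<rho>))) + ennreal (exp (- 6 * (n * \<rho>)))"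
    by (intro add_mono tail) auto
  also have "\<dots> = ennreal (2 * exp (- 6 * (n * \<rho>)))" by (simp flip: ennreal_plus)
  finally show ?thesis by (simp add: t_def)
qed

text \<open>A union bound over the grid of mesh \<open>1 / n\<close> on
  \<open>{- real n..real n}\<close>: at most \<open>9 * n ^ 4\<close> pairs of grid points, each of
  which fails with probability at most \<open>2 / n ^ 6\<close>, since
  \<open>n * rho n = ln n\<close>.\<close>

lemma (in prob_space) grid_deviation:
  fixes n :: nat and Y :: "nat \<Rightarrow> 'a \<Rightarrow> real"
  assumes indep: "indep_vars (\<lambda>_. borel) Y {..<n}"
    and p: "\<And>i a b. i < n \<Longrightarrow> prob {\<omega> \<in> space M. Y i \<omega> \<in> {a..b}} = P a b"
    and K: "\<And>a b. a \<le> b \<Longrightarrow> P a b \<le> K * (b - a)" "0 \<le> K" and n: "1 < n"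
  shows "\<exists>G\<in>sets M. emeasure M G \<le> ennreal (18 / (real n)\<^sup>2) \<and> (\<forall>\<omega>\<in>space M - G. \<forall>j k :: int.
    \<bar>j\<bar> \<le> int (n\<^sup>2) \<and> \<bar>k\<bar> \<le> int (n\<^sup>2) \<and> j \<le> k \<longrightarrow>
    \<bar>(\<Sum>i<n. indicator {j / n..k / n} (Y i \<omega>)) / n - P (j / n) (k / n)\<bar>
      \<le> 7 * (sqrt (K * (k / n - j / n) * rho n) + rho n))"
proof -
  have Y [measurable]: "i \<in> {..<n} \<Longrightarrow> random_variable borel (Y i)" for i
    using indep unfolding indep_vars_def by auto
  have \<rho>: "0 < rho n" "n * rho n = ln n" using n by (auto simp: rho_def)
  define J where "J = {(j, k). j \<in> {- int (n\<^sup>2)..int (n\<^sup>2)} \<and> k \<in> {- int (n\<^sup>2)..int (n\<^sup>2)} \<and> j \<le> k}"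
  define G where "G = (\<lambda>(j :: int, k :: int). {\<omega> \<in> space M. 7 * (sqrt (K * (k / n - j / n) * rho n) + rho n)
      \<le> \<bar>(\<Sum>i<n. indicator {j / n..k / n} (Y i \<omega>)) / n - P (j / n) (k / n)\<bar>})"
  have J: "finite J" "card J \<le> (2 * n\<^sup>2 + 1)\<^sup>2"
  proof -
    have sub: "J \<subseteq> {- int (n\<^sup>2)..int (n\<^sup>2)} \<times> {- int (n\<^sup>2)..int (n\<^sup>2)}" by (auto simp: J_def)
    then show "finite J" by (rule finite_subset) simp
    have "card J \<le> card ({- int (n\<^sup>2)..int (n\<^sup>2)} \<times> {- int (n\<^sup>2)..int (n\<^sup>2)})"
      by (rule card_mono[OF _ sub]) simp
    also have "\<dots> = (2 * n\<^sup>2 + 1)\<^sup>2"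
    proof -
      have "nat (int (n\<^sup>2) - - int (n\<^sup>2) + 1) = 2 * n\<^sup>2 + 1" by linarith
      then show ?thesis by (simp only: card_cartesian_product card_atLeastAtMost_int power2_eq_square[of "2 * n\<^sup>2 + 1"])
    qed
    finally show "card J \<le> (2 * n\<^sup>2 + 1)\<^sup>2" .
  qed
  have meas: "G x \<in> sets M" for x
    unfolding G_def by (cases x) (simp; measurable)
  have "emeasure M (G x) \<le> ennreal (2 * exp (- 6 * ln n))" if "x \<in> J" for x
  proof -
    obtain j k where x: "x = (j, k)" by (cases x)
    have jk: "j / n \<le> k / n" using that by (auto simp: J_def x intro!: divide_right_mono)
    show ?thesis
      unfolding G_def x prod.case \<rho>(2)[symmetric]
      by (rule empirical_deviation_tail[OF indep]) (use p K jk \<rho> n in auto)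
  qed
  then have "emeasure M (\<Union>x\<in>J. G x) \<le> (\<Sum>x\<in>J. ennreal (2 * exp (- 6 * ln n)))"
    using meas J by (intro order_trans[OF emeasure_subadditive_finite] sum_mono) auto
  also have "\<dots> = ennreal (real (card J) * (2 * exp (- 6 * ln n)))"
    by (simp add: ennreal_mult ennreal_of_nat_eq_real_of_nat)
  also have "\<dots> \<le> ennreal (18 / (real n)\<^sup>2)"
  proof (rule ennreal_leI)
    have "real (card J) \<le> real ((2 * n\<^sup>2 + 1)\<^sup>2)" using J(2) by (rule of_nat_mono)
    also have "\<dots> \<le> (3 * (real n)\<^sup>2)\<^sup>2"
    proof -
      have "1 \<le> (real n)\<^sup>2" using n by (intro one_le_power) simp
      then have "2 * (real n)\<^sup>2 + 1 \<le> 3 * (real n)\<^sup>2" by simp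
      then have "(2 * (real n)\<^sup>2 + 1)\<^sup>2 \<le> (3 * (real n)\<^sup>2)\<^sup>2" by (rule power_mono) simp
      then show ?thesis by (simp add: add.commute)
    qed
    also have "(3 * (real n)\<^sup>2)\<^sup>2 = 9 * real n ^ 4" by (simp add: power_mult_distrib)
    finally have c: "real (card J) \<le> 9 * real n ^ 4" .
    have "exp (- 6 * ln n) = 1 / real n ^ 6"
    proof -
      have "exp (of_nat 6 * ln (real n)) = exp (ln (real n)) ^ 6" by (rule exp_of_nat_mult)
      then have "exp (6 * ln (real n)) = real n ^ 6" using n by simp
      moreover have "exp (- 6 * ln (real n)) = inverse (exp (6 * ln (real n)))"
        by (simp flip: exp_minus)
      ultimately show ?thesis by (simp add: inverse_eq_divide)
    qed
    then have "real (card J) * (2 * exp (- 6 * ln n)) \<le> 9 * real n ^ 4 * (2 * (1 / real n ^ 6))"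
      using c by (simp add: divide_right_mono)
    also have "\<dots> = 18 / (real n)\<^sup>2" using n by (simp add: field_simps eval_nat_numeral)
    finally show "real (card J) * (2 * exp (- 6 * ln n)) \<le> 18 / (real n)\<^sup>2" .
  qed
  finally have small: "emeasure M (\<Union>x\<in>J. G x) \<le> ennreal (18 / (real n)\<^sup>2)" by simp
  show ?thesis
  proof (rule bexI[of _ "\<Union>x\<in>J. G x"], rule conjI[OF small], intro ballI allI impI)
    fix \<omega> and j k :: int
    assume \<omega>: "\<omega> \<in> space M - (\<Union>x\<in>J. G x)" and jk: "\<bar>j\<bar> \<le> int (n\<^sup>2) \<and> \<bar>k\<bar> \<le> int (n\<^sup>2) \<and> j \<le> k"
    then have "(j, k) \<in> J" by (auto simp: J_def)
    with \<omega> have "\<omega> \<in> space M" "\<omega> \<notin> G (j, k)" by auto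
    then show "\<bar>(\<Sum>i<n. indicator {j / n..k / n} (Y i \<omega>)) / n - P (j / n) (k / n)\<bar>
      \<le> 7 * (sqrt (K * (k / n - j / n) * rho n) + rho n)"
      by (simp add: G_def not_le)
  qed (use meas J in auto)
qed

text \<open>Outer and inner grid intervals differ from the given one by two pieces of length at most
  \<open>1 / n\<close>, whose mass \<rho> dominates up to the factor \<open>K\<close>. The constant
  is 23 = 2 + 7 * (2 + 1): two for these pieces, the rest from the grid bound at the changed
  length.\<close>

lemma grid_to_intervals:
  fixes y :: "nat \<Rightarrow> real"
  assumes \<mu>: "finite_measure \<mu>" "sets \<mu> = sets borel"
    and K: "\<And>a b. a \<le> b \<Longrightarrow> measure \<mu> {a..b} \<le> K * (b - a)" "1 \<le> K"
    and n: "0 < n" and \<rho>: "1 / n \<le> \<rho>"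
    and grid: "\<And>j k :: int. \<bar>j\<bar> \<le> int (n\<^sup>2) \<Longrightarrow> \<bar>k\<bar> \<le> int (n\<^sup>2) \<Longrightarrow> j \<le> k \<Longrightarrow>
      \<bar>(\<Sum>i<n. indicator {j / n..k / n} (y i)) / n - measure \<mu> {j / n..k / n}\<bar>
        \<le> 7 * (sqrt (K * (k / n - j / n) * \<rho>) + \<rho>)"
    and ab: "- real n \<le> a" "a \<le> b" "b \<le> n"
  shows "\<bar>(\<Sum>i<n. indicator {a..b} (y i)) / n - measure \<mu> {a..b}\<bar> \<le> 23 * K * (sqrt (\<rho> * (b - a)) + \<rho>)"
proof -
  interpret finite_measure \<mu> by fact
  have \<rho>0: "0 < \<rho>" using \<rho> n by (meson divide_pos_pos less_le_trans of_nat_0_less_iff zero_less_one)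
  have grid_point: "\<lfloor>n * t\<rfloor> / n \<le> t" "t - 1 / n \<le> \<lfloor>n * t\<rfloor> / n" "t \<le> \<lceil>n * t\<rceil> / n" "\<lceil>n * t\<rceil> / n \<le> t + 1 / n" for t :: real
  proof -
    have t: "t = (n * t) / n" "t - 1 / n = (n * t - 1) / n" "t + 1 / n = (n * t + 1) / n"
      using n by (auto simp: diff_divide_distrib add_divide_distrib)
    have "\<lfloor>n * t\<rfloor> / n \<le> (n * t) / n" "(n * t - 1) / n \<le> \<lfloor>n * t\<rfloor> / n"
      "(n * t) / n \<le> \<lceil>n * t\<rceil> / n" "\<lceil>n * t\<rceil> / n \<le> (n * t + 1) / n"
      by (intro divide_right_mono; linarith)+
    then show "\<lfloor>n * t\<rfloor> / n \<le> t" "t - 1 / n \<le> \<lfloor>n * t\<rfloor> / n" "t \<le> \<lceil>n * t\<rceil> / n" "\<lceil>n * t\<rceil> / n \<le> t + 1 / n"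
      using t by argo+
  qed
  have floor_bounds: "- int (n\<^sup>2) \<le> \<lfloor>n * t\<rfloor>" "\<lceil>n * t\<rceil> \<le> int (n\<^sup>2)" if "- real n \<le> t" "t \<le> n" for t :: real
  proof -
    have "n * (- real n) \<le> n * t" "n * t \<le> n * real n" using that by (intro mult_left_mono; simp)+
    then show "- int (n\<^sup>2) \<le> \<lfloor>n * t\<rfloor>" "\<lceil>n * t\<rceil> \<le> int (n\<^sup>2)"
      by (simp_all add: le_floor_iff ceiling_le_iff power2_eq_square)
  qed
  have floor_ceiling: "\<lfloor>n * a\<rfloor> \<le> \<lceil>n * b\<rceil>"
    using mult_left_mono[OF ab(2), of n] by linarith
  have K\<rho>: "\<rho> \<le> K * \<rho>" using K \<rho>0 by simp
  have Kn: "K * (1 / n) \<le> K * \<rho>" using \<rho> K by (intro mult_left_mono) auto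
  have sqrtK: "sqrt (K * c) \<le> K * sqrt c" if "0 \<le> c" for c
  proof -
    have "K \<le> K\<^sup>2" using K by (simp add: power2_eq_square)
    then have "K * c \<le> K\<^sup>2 * c" using that by (intro mult_right_mono)
    then have "sqrt (K * c) \<le> sqrt (K\<^sup>2 * c)" by simp
    also have "\<dots> = K * sqrt c" using K by (subst real_sqrt_mult) simp
    finally show ?thesis .
  qed
  have up: "(\<Sum>i<n. indicator {a..b} (y i)) / n \<le> measure \<mu> {a..b} + 23 * K * (sqrt (\<rho> * (b - a)) + \<rho>)"
  proof -
    define j where "j = \<lfloor>n * a\<rfloor>"
    define k where "k = \<lceil>n * b\<rceil>"
    have jk: "\<bar>j\<bar> \<le> int (n\<^sup>2)" "\<bar>k\<bar> \<le> int (n\<^sup>2)" "j \<le> k"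
      using floor_bounds[of a] floor_bounds[of b] floor_ceiling ab unfolding j_def k_def by linarith+
    have jl: "j / n \<le> a" "a - 1 / n \<le> j / n" "b \<le> k / n" "k / n \<le> b + 1 / n"
      using grid_point[of a] grid_point[of b] by (auto simp: j_def k_def)
    have "(\<Sum>i<n. indicator {a..b} (y i)) / n \<le> (\<Sum>i<n. indicat_real {j / n..k / n} (y i)) / n"
      using jl by (intro divide_right_mono sum_mono) (auto simp: indicator_def)
    also have "\<dots> \<le> measure \<mu> {j / n..k / n} + 7 * (sqrt (K * (k / n - j / n) * \<rho>) + \<rho>)"
      using grid[OF jk] by linarith
    also have "measure \<mu> {j / n..k / n} \<le> measure \<mu> {a..b} + 2 * (K * \<rho>)"
    proof -
      have "measure \<mu> {j / n..k / n} \<le> measure \<mu> ({j / n..a} \<union> ({a..b} \<union> {b..k / n}))"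
        by (intro finite_measure_mono) (use ab \<mu> in auto)
      also have "\<dots> \<le> measure \<mu> {j / n..a} + measure \<mu> ({a..b} \<union> {b..k / n})"
        by (intro measure_Un_le) (use \<mu> in auto)
      also have "measure \<mu> ({a..b} \<union> {b..k / n}) \<le> measure \<mu> {a..b} + measure \<mu> {b..k / n}"
        by (intro measure_Un_le) (use \<mu> in auto)
      also have "measure \<mu> {j / n..a} \<le> K * (1 / n)"
        using K(1)[OF jl(1)] jl mult_left_mono[of "a - j / n" "1 / n" K] K(2) by linarith
      also have "measure \<mu> {b..k / n} \<le> K * (1 / n)"
        using K(1)[OF jl(3)] jl mult_left_mono[of "k / n - b" "1 / n" K] K(2) by linarith
      finally show ?thesis using Kn by linarith
    qed
    also have "sqrt (K * (k / n - j / n) * \<rho>) \<le> K * sqrt (\<rho> * (b - a)) + 2 * (K * \<rho>)"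
    proof -
      have "k / n - j / n \<le> (b - a) + 2 * \<rho>" using jl \<rho> by linarith
      then have "(k / n - j / n) * \<rho> \<le> ((b - a) + 2 * \<rho>) * \<rho>" using \<rho>0 by (intro mult_right_mono) auto
      also have "\<dots> \<le> \<rho> * (b - a) + (2 * \<rho>)\<^sup>2" using \<rho>0 by (simp add: algebra_simps power2_eq_square)
      finally have "sqrt ((k / n - j / n) * \<rho>) \<le> sqrt (\<rho> * (b - a) + (2 * \<rho>)\<^sup>2)" by simp
      also have "\<dots> \<le> sqrt (\<rho> * (b - a)) + sqrt ((2 * \<rho>)\<^sup>2)"
        using ab \<rho>0 by (intro sqrt_add_le_add_sqrt) auto
      also have "\<dots> = sqrt (\<rho> * (b - a)) + 2 * \<rho>" using \<rho>0 by (subst real_sqrt_abs) simp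
      finally have "K * sqrt ((k / n - j / n) * \<rho>) \<le> K * (sqrt (\<rho> * (b - a)) + 2 * \<rho>)"
        using K by (intro mult_left_mono) auto
      moreover have "sqrt (K * ((k / n - j / n) * \<rho>)) \<le> K * sqrt ((k / n - j / n) * \<rho>)"
        using jl ab \<rho>0 by (intro sqrtK mult_nonneg_nonneg) auto
      ultimately show ?thesis by (simp add: algebra_simps)
    qed
    finally have "(\<Sum>i<n. indicator {a..b} (y i)) / n
      \<le> measure \<mu> {a..b} + 2 * (K * \<rho>) + 7 * (K * sqrt (\<rho> * (b - a)) + 2 * (K * \<rho>) + \<rho>)"
      by this simp_all
    moreover have "0 \<le> K * sqrt (\<rho> * (b - a))" using K ab \<rho>0 by simp
    ultimately show ?thesis using K\<rho> by (simp add: distrib_left mult.assoc)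
  qed
  have low: "measure \<mu> {a..b} - 23 * K * (sqrt (\<rho> * (b - a)) + \<rho>) \<le> (\<Sum>i<n. indicator {a..b} (y i)) / n"
  proof -
    define j where "j = \<lceil>n * a\<rceil>"
    define k where "k = \<lfloor>n * b\<rfloor>"
    have jl: "a \<le> j / n" "j / n \<le> a + 1 / n" "k / n \<le> b" "b - 1 / n \<le> k / n"
      using grid_point[of a] grid_point[of b] by (auto simp: j_def k_def)
    have s0: "0 \<le> K * sqrt (\<rho> * (b - a))" using K ab \<rho>0 by simp
    have p0: "0 \<le> (\<Sum>i<n. indicat_real {a..b} (y i)) / n" by (intro divide_nonneg_nonneg sum_nonneg) auto
    show ?thesis
    proof (cases "j \<le> k")
      case True
      have jk: "\<bar>j\<bar> \<le> int (n\<^sup>2)" "\<bar>k\<bar> \<le> int (n\<^sup>2)"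
        using floor_bounds[of a] floor_bounds[of b] True ab unfolding j_def k_def by linarith+
      have "measure \<mu> {a..b} \<le> measure \<mu> {j / n..k / n} + 2 * (K * \<rho>)"
      proof -
        have "measure \<mu> {a..b} \<le> measure \<mu> ({a..j / n} \<union> ({j / n..k / n} \<union> {k / n..b}))"
          by (intro finite_measure_mono) (use ab \<mu> in auto)
        also have "\<dots> \<le> measure \<mu> {a..j / n} + measure \<mu> ({j / n..k / n} \<union> {k / n..b})"
          by (intro measure_Un_le) (use \<mu> in auto)
        also have "measure \<mu> ({j / n..k / n} \<union> {k / n..b}) \<le> measure \<mu> {j / n..k / n} + measure \<mu> {k / n..b}"
          by (intro measure_Un_le) (use \<mu> in auto)
        also have "measure \<mu> {a..j / n} \<le> K * (1 / n)"
          using K(1)[OF jl(1)] jl mult_left_mono[of "j / n - a" "1 / n" K] K(2) by linarith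
        also have "measure \<mu> {k / n..b} \<le> K * (1 / n)"
          using K(1)[OF jl(3)] jl mult_left_mono[of "b - k / n" "1 / n" K] K(2) by linarith
        finally show ?thesis using Kn by linarith
      qed
      also have "measure \<mu> {j / n..k / n} \<le> (\<Sum>i<n. indicat_real {j / n..k / n} (y i)) / n + 7 * (sqrt (K * (k / n - j / n) * \<rho>) + \<rho>)"
        using grid[OF jk True] by linarith
      also have "(\<Sum>i<n. indicat_real {j / n..k / n} (y i)) / n \<le> (\<Sum>i<n. indicator {a..b} (y i)) / n"
        using jl by (intro divide_right_mono sum_mono) (auto simp: indicator_def)
      also have "sqrt (K * (k / n - j / n) * \<rho>) \<le> K * sqrt (\<rho> * (b - a))"
      proof -
        have kj: "j / n \<le> k / n" using True by (simp add: divide_right_mono)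
        have "(k / n - j / n) * \<rho> \<le> (b - a) * \<rho>" using jl \<rho>0 by (intro mult_right_mono) auto
        then have "K * sqrt ((k / n - j / n) * \<rho>) \<le> K * sqrt (\<rho> * (b - a))"
          using K by (intro mult_left_mono real_sqrt_le_mono) (auto simp: mult.commute)
        moreover have "sqrt (K * ((k / n - j / n) * \<rho>)) \<le> K * sqrt ((k / n - j / n) * \<rho>)"
          using kj \<rho>0 by (intro sqrtK mult_nonneg_nonneg) auto
        ultimately show ?thesis by (simp add: mult.assoc)
      qed
      finally have "measure \<mu> {a..b} \<le> (\<Sum>i<n. indicator {a..b} (y i)) / n + 7 * (K * sqrt (\<rho> * (b - a)) + \<rho>) + 2 * (K * \<rho>)"
        by this simp_all
      then show ?thesis using K\<rho> \<rho>0 s0 unfolding distrib_left mult.assoc by linarith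
    next
      case False
      \<comment> \<open>No grid interval fits inside; then \<open>b - a \<le> 1 / n\<close>, and the
        mass of the interval is itself below the error.\<close>
      then have "k + 1 \<le> j" by simp
      then have "real_of_int k + 1 \<le> j" by linarith
      then have "(k + 1) / n \<le> j / n" by (intro divide_right_mono) auto
      then have "k / n + 1 / n \<le> j / n" by (simp add: add_divide_distrib)
      then have "b - a \<le> 1 / n" using jl by linarith
      then have "K * (b - a) \<le> K * (1 / n)" using K by (intro mult_left_mono) auto
      then have "measure \<mu> {a..b} \<le> K * \<rho>" using K(1)[OF ab(2)] Kn by linarith
      then show ?thesis using p0 s0 K\<rho> \<rho>0 unfolding distrib_left mult.assoc by linarith
    qed
  qed
  show ?thesis using up low by linarith
qed

subsection \<open>Tails of log-concave densities\<close>

lemma exp_ereal_mono: "a \<le> b \<Longrightarrow> exp_ereal a \<le> exp_ereal b"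
  by (cases a; cases b) (auto simp: exp_ereal_def intro!: ennreal_leI)

lemma exp_ereal_pos_iff: "0 < exp_ereal a \<longleftrightarrow> a \<noteq> -\<infinity>"
  by (cases a) (auto simp: exp_ereal_def)

text \<open>Somewhere to the right of \<open>q\<close> the log-density drops below its value at
  \<open>q\<close>, as the mass is finite; from there on it lies below a line of negative slope.
  Before that point it lies below the continued chord from \<open>p\<close> to
  \<open>q\<close>.\<close>

lemma log_concave_density_exp_decay_right:
  assumes \<phi>: "concave_ereal \<phi>" and int: "(\<integral>\<^sup>+x. exp_ereal (\<phi> x) \<partial>lborel) = 1"
    and pq: "p < q" "\<phi> p \<noteq> -\<infinity>" "\<phi> q \<noteq> -\<infinity>"
  shows "\<exists>K \<kappa>. 0 < K \<and> 0 < \<kappa> \<and> (\<forall>x\<ge>q. exp_ereal (\<phi> x) \<le> ennreal (K * exp (- \<kappa> * x)))"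
proof -
  have ninf: "\<phi> t \<noteq> \<infinity>" for t using \<phi> by (simp add: concave_ereal_def)
  obtain r rp where r: "\<phi> q = ereal r" and rp: "\<phi> p = ereal rp"
    using pq ninf by (metis ereal_cases)
  have "\<exists>y>q. \<phi> y < ereal r"
  proof (rule ccontr)
    assume "\<not> ?thesis"
    then have ge: "ereal r \<le> \<phi> x" if "q < x" for x using that by (metis not_less)
    \<comment> \<open>A rectangle of height \<open>exp r\<close> and area 2 below the density
      contradicts total mass 1.\<close>
    define N where "N = 2 / exp r"
    have "ennreal (exp r) * ennreal N = (\<integral>\<^sup>+x. ennreal (exp r) * indicator {q<..<q + N} x \<partial>lborel)"
      by (subst nn_integral_cmult_indicator) (auto simp: N_def)
    also have "\<dots> \<le> (\<integral>\<^sup>+x. exp_ereal (\<phi> x) \<partial>lborel)"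
    proof (rule nn_integral_mono)
      fix x
      show "ennreal (exp r) * indicator {q<..<q + N} x \<le> exp_ereal (\<phi> x)"
        using exp_ereal_mono[OF ge[of x]] by (auto simp: indicator_def exp_ereal_def)
    qed
    finally have "ennreal 2 \<le> ennreal 1" unfolding int by (simp add: N_def flip: ennreal_mult)
    then show False by simp
  qed
  then obtain y where y: "q < y" "\<phi> y < ereal r" by blast
  \<comment> \<open>\<open>\<phi> y\<close> may be -\<infinity>; \<open>v\<close> is a finite upper
    bound still below \<open>r\<close>.\<close>
  obtain v where v: "\<phi> y \<le> ereal v" "v < r"
  proof (cases "\<phi> y")
    case (real c)
    then show ?thesis using that[of c] y by simp
  next
    case MInf
    then show ?thesis using that[of "r - 1"] by simp
  qed (use ninf in auto)
  define \<kappa> where "\<kappa> = (r - v) / (y - q)"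
  define \<sigma> where "\<sigma> = (r - rp) / (q - p)"
  define c where "c = r + \<bar>\<sigma>\<bar> * (y - q) + \<kappa> * (y - q)"
  have \<kappa>: "0 < \<kappa>" "\<kappa> * (y - q) = r - v" using y v by (auto simp: \<kappa>_def)
  have \<sigma>: "\<sigma> * (q - p) = r - rp" using pq by (simp add: \<sigma>_def)
  have "exp_ereal (\<phi> x) \<le> ennreal (exp (c + \<kappa> * q) * exp (- \<kappa> * x))" if x: "q \<le> x" for x
  proof (cases "\<phi> x")
    case (real z)
    have px: "p < x" using pq x by simp
    note conc = concave_ereal_Icc[OF \<phi> px pq(2)]
    have fin: "\<phi> x \<noteq> -\<infinity>" using real by simp
    have "z \<le> c - \<kappa> * (x - q)"
    proof (cases "y \<le> x")
      case True
      have "y \<in> {p..x}" using True y pq by simp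
      then obtain vy where vy: "\<phi> y = ereal vy" using conc(1)[OF fin] by blast
      have "(x - y) * real_of_ereal (\<phi> q) + (y - q) * real_of_ereal (\<phi> x) \<le> (x - q) * real_of_ereal (\<phi> y)"
        by (rule concave_on_Icc_ineq[OF conc(2)[OF fin]]) (use True y pq in auto)
      then have "(x - y) * r + (y - q) * z \<le> (x - q) * vy" by (simp add: r real vy)
      also have "\<dots> \<le> (x - q) * v" using v vy True y by (intro mult_left_mono) auto
      also have "\<dots> = (x - q) * (r - \<kappa> * (y - q))" using \<kappa> by simp
      finally have "(y - q) * z \<le> (y - q) * (r - \<kappa> * (x - q))" by (simp add: algebra_simps)
      then have "z \<le> r - \<kappa> * (x - q)" using y by simp
      moreover have "0 \<le> \<bar>\<sigma>\<bar> * (y - q) + \<kappa> * (y - q)" using y \<kappa> by (intro add_nonneg_nonneg mult_nonneg_nonneg) auto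
      ultimately show ?thesis by (simp add: c_def)
    next
      case False
      have "(x - q) * real_of_ereal (\<phi> p) + (q - p) * real_of_ereal (\<phi> x) \<le> (x - p) * real_of_ereal (\<phi> q)"
        by (rule concave_on_Icc_ineq[OF conc(2)[OF fin]]) (use False y pq x in auto)
      then have "(x - q) * rp + (q - p) * z \<le> (x - p) * r" by (simp add: r real rp)
      then have "(q - p) * z \<le> (q - p) * r + (x - q) * (r - rp)" by (simp add: algebra_simps)
      also have "\<dots> = (q - p) * (r + \<sigma> * (x - q))" unfolding \<sigma>[symmetric] by (simp add: algebra_simps)
      finally have "z \<le> r + \<sigma> * (x - q)" using pq by simp
      also have "\<sigma> * (x - q) \<le> \<bar>\<sigma>\<bar> * (x - q)" using x by (intro mult_right_mono) auto
      also have "\<bar>\<sigma>\<bar> * (x - q) \<le> \<bar>\<sigma>\<bar> * (y - q)" using False by (intro mult_left_mono) auto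
      finally have "z \<le> r + \<bar>\<sigma>\<bar> * (y - q)" by simp
      moreover have "\<kappa> * (x - q) \<le> \<kappa> * (y - q)" using False \<kappa> by (intro mult_left_mono) auto
      ultimately show ?thesis by (simp add: c_def)
    qed
    then have "exp z \<le> exp ((c + \<kappa> * q) + (- \<kappa> * x))" by (simp add: algebra_simps)
    then have "exp z \<le> exp (c + \<kappa> * q) * exp (- \<kappa> * x)" by (simp only: exp_add)
    then show ?thesis using real by (simp add: exp_ereal_def ennreal_leI)
  qed (use ninf in \<open>auto simp: exp_ereal_def\<close>)
  then show ?thesis using \<kappa> by (intro exI[of _ "exp (c + \<kappa> * q)"] exI[of _ \<kappa>]) auto
qed

lemma concave_ereal_uminus_arg:
  assumes "concave_ereal \<phi>"
  shows "concave_ereal (\<lambda>x. \<phi> (- x))"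
  unfolding concave_ereal_def
proof (intro conjI allI impI)
  show "\<phi> (- x) \<noteq> \<infinity>" for x using assms by (simp add: concave_ereal_def)
  fix x y t :: real assume "0 < t \<and> t < 1"
  then have "ereal (1 - t) * \<phi> (- x) + ereal t * \<phi> (- y) \<le> \<phi> ((1 - t) * (- x) + t * (- y))"
    using assms unfolding concave_ereal_def by blast
  then show "ereal (1 - t) * \<phi> (- x) + ereal t * \<phi> (- y) \<le> \<phi> (- ((1 - t) * x + t * y))"
    by simp
qed

text \<open>The one-sided bounds start at the midpoint \<open>m\<close> and decay in
  \<open>x\<close> or \<open>- x\<close>. The factors with \<open>\<bar>m\<bar>\<close> pay for the
  passage to \<open>\<bar>x\<bar>\<close> on the stretch between 0 and \<open>m\<close>.\<close>

lemma log_concave_density_exp_decay: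
  assumes \<phi>: "concave_ereal \<phi>" and meas: "(\<lambda>x. exp_ereal (\<phi> x)) \<in> borel_measurable borel"
    and int: "(\<integral>\<^sup>+x. exp_ereal (\<phi> x) \<partial>lborel) = 1"
    and AB: "A < B" "\<phi> A \<noteq> -\<infinity>" "\<phi> B \<noteq> -\<infinity>"
  shows "\<exists>K \<kappa>. 0 < K \<and> 0 < \<kappa> \<and> (\<forall>x. exp_ereal (\<phi> x) \<le> ennreal (K * exp (- \<kappa> * \<bar>x\<bar>)))"
proof -
  define m where "m = (A + B) / 2"
  have m: "A < m" "m < B" using AB by (auto simp: m_def)
  have fin: "\<phi> m \<noteq> -\<infinity>"
  proof -
    have "\<phi> m = ereal (real_of_ereal (\<phi> m))" using concave_ereal_Icc(1)[OF \<phi> AB] m by auto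
    then show ?thesis by (metis MInfty_neq_ereal(1))
  qed
  obtain K1 \<kappa>1 where 1: "0 < K1" "0 < \<kappa>1" "\<And>x. m \<le> x \<Longrightarrow> exp_ereal (\<phi> x) \<le> ennreal (K1 * exp (- \<kappa>1 * x))"
    using log_concave_density_exp_decay_right[OF \<phi> int m(1) AB(2) fin] by blast
  have "(\<integral>\<^sup>+x. exp_ereal (\<phi> (- x)) \<partial>lborel) = 1"
    using nn_integral_real_affine[OF meas, of "-1" 0] int by simp
  from log_concave_density_exp_decay_right[OF concave_ereal_uminus_arg[OF \<phi>] this, of "-B" "-m"] m AB fin
  obtain K2 \<kappa>2 where 2: "0 < K2" "0 < \<kappa>2" "\<And>x. - m \<le> x \<Longrightarrow> exp_ereal (\<phi> (- x)) \<le> ennreal (K2 * exp (- \<kappa>2 * x))"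
    by auto
  define \<kappa> where "\<kappa> = min \<kappa>1 \<kappa>2"
  define K where "K = K1 * exp ((\<kappa>1 + \<kappa>) * \<bar>m\<bar>) + K2 * exp ((\<kappa>2 + \<kappa>) * \<bar>m\<bar>)"
  have \<kappa>: "0 < \<kappa>" "\<kappa> \<le> \<kappa>1" "\<kappa> \<le> \<kappa>2" using 1 2 by (auto simp: \<kappa>_def)
  have bound: "k * exp (- \<eta> * x) \<le> (k * exp ((\<eta> + \<kappa>) * \<bar>m\<bar>)) * exp (- \<kappa> * \<bar>x\<bar>)"
    if "0 < k" "\<kappa> \<le> \<eta>" "- \<bar>m\<bar> \<le> x" for k \<eta> x
  proof -
    have "- \<eta> * x \<le> (\<eta> + \<kappa>) * \<bar>m\<bar> + - \<kappa> * \<bar>x\<bar>"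
    proof (cases "0 \<le> x")
      case True
      have "\<kappa> * x \<le> \<eta> * x" using True that by (intro mult_right_mono) auto
      moreover have "0 \<le> (\<eta> + \<kappa>) * \<bar>m\<bar>" using that \<kappa> by simp
      ultimately show ?thesis using True by simp
    next
      case False
      have "(\<eta> + \<kappa>) * (- x) \<le> (\<eta> + \<kappa>) * \<bar>m\<bar>" using that \<kappa> by (intro mult_left_mono) auto
      then show ?thesis using False by (simp add: algebra_simps)
    qed
    then have "exp (- \<eta> * x) \<le> exp ((\<eta> + \<kappa>) * \<bar>m\<bar>) * exp (- \<kappa> * \<bar>x\<bar>)"
      unfolding exp_add[symmetric] by simp
    then show ?thesis using that by simp
  qed
  have "exp_ereal (\<phi> x) \<le> ennreal (K * exp (- \<kappa> * \<bar>x\<bar>))" for x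
  proof -
    have nn: "0 \<le> K1 * exp ((\<kappa>1 + \<kappa>) * \<bar>m\<bar>) * exp (- \<kappa> * \<bar>x\<bar>)" "0 \<le> K2 * exp ((\<kappa>2 + \<kappa>) * \<bar>m\<bar>) * exp (- \<kappa> * \<bar>x\<bar>)"
      using 1 2 by auto
    have K: "K * exp (- \<kappa> * \<bar>x\<bar>) = K1 * exp ((\<kappa>1 + \<kappa>) * \<bar>m\<bar>) * exp (- \<kappa> * \<bar>x\<bar>) + K2 * exp ((\<kappa>2 + \<kappa>) * \<bar>m\<bar>) * exp (- \<kappa> * \<bar>x\<bar>)"
      by (simp add: K_def distrib_right)
    show ?thesis
    proof (cases "m \<le> x")
      case True
      have "K1 * exp (- \<kappa>1 * x) \<le> K * exp (- \<kappa> * \<bar>x\<bar>)"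
        using bound[OF 1(1) \<kappa>(2), of x] True nn unfolding K by linarith
      then show ?thesis using 1(3)[OF True] by (meson ennreal_leI order_trans)
    next
      case False
      have "K2 * exp (- \<kappa>2 * (- x)) \<le> K * exp (- \<kappa> * \<bar>x\<bar>)"
        using bound[OF 2(1) \<kappa>(3), of "- x"] False nn unfolding K abs_minus_cancel by linarith
      moreover have "exp_ereal (\<phi> x) \<le> ennreal (K2 * exp (- \<kappa>2 * (- x)))"
        using 2(3)[of "- x"] False by simp
      ultimately show ?thesis by (meson ennreal_leI order_trans)
    qed
  qed
  moreover have "0 < K" using 1 2 by (simp add: K_def add_pos_pos)
  ultimately show ?thesis using \<kappa> by blast
qed

lemma exp_decay_tail_integral:
  assumes h: "\<And>x. h x \<le> ennreal (K * exp (- \<kappa> * \<bar>x\<bar>))" and K: "0 < K" and \<kappa>: "0 < \<kappa>" and s: "0 \<le> s"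
  shows "(\<integral>\<^sup>+x. h x * indicator {x. s < \<bar>x\<bar>} x \<partial>lborel) \<le> ennreal (2 * K / \<kappa> * exp (- \<kappa> * s))"
proof -
  define e where "e x = ennreal (K * exp (- \<kappa> * x)) * indicator {s..} x" for x
  have [measurable]: "e \<in> borel_measurable borel" unfolding e_def by measurable
  have "(\<integral>\<^sup>+x. e x \<partial>lborel) = ennreal (0 - (- K / \<kappa> * exp (- \<kappa> * s)))"
    unfolding e_def
  proof (rule nn_integral_FTC_atLeast)
    show "((\<lambda>x. - K / \<kappa> * exp (- \<kappa> * x)) has_real_derivative K * exp (- \<kappa> * x)) (at x)" for x
      using \<kappa> by (auto intro!: derivative_eq_intros)
    have "((\<lambda>x. exp (- \<kappa> * x)) \<longlongrightarrow> 0) at_top"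
      using \<kappa> by (intro filterlim_compose[OF exp_at_bot] filterlim_tendsto_neg_mult_at_bot[OF tendsto_const] filterlim_ident) auto
    from tendsto_mult[OF tendsto_const[of "- K / \<kappa>"] this]
    show "((\<lambda>x. - K / \<kappa> * exp (- \<kappa> * x)) \<longlongrightarrow> 0) at_top" by simp
  qed (use K in auto)
  then have e: "(\<integral>\<^sup>+x. e x \<partial>lborel) = ennreal (K / \<kappa> * exp (- \<kappa> * s))" by simp
  have "(\<integral>\<^sup>+x. h x * indicator {x. s < \<bar>x\<bar>} x \<partial>lborel) \<le> (\<integral>\<^sup>+x. e x + e (- x) \<partial>lborel)"
  proof (rule nn_integral_mono)
    fix x :: real
    show "h x * indicator {x. s < \<bar>x\<bar>} x \<le> e x + e (- x)"
    proof (cases "s < \<bar>x\<bar>")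
      case True
      show ?thesis
      proof (cases "0 \<le> x")
        case True
        then have "h x \<le> e x" using h[of x] \<open>s < \<bar>x\<bar>\<close> by (simp add: e_def)
        then show ?thesis using \<open>s < \<bar>x\<bar>\<close> by (simp add: add_increasing2)
      next
        case False
        then have "h x \<le> e (- x)" using h[of x] \<open>s < \<bar>x\<bar>\<close> by (simp add: e_def)
        then show ?thesis using \<open>s < \<bar>x\<bar>\<close> by (simp add: add_increasing)
      qed
    qed simp
  qed
  also have "\<dots> = (\<integral>\<^sup>+x. e x \<partial>lborel) + (\<integral>\<^sup>+x. e (- x) \<partial>lborel)"
    by (rule nn_integral_add) measurable
  also have "(\<integral>\<^sup>+x. e (- x) \<partial>lborel) = (\<integral>\<^sup>+x. e x \<partial>lborel)"
    using nn_integral_real_affine[of e "-1" 0] by simp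
  also have "(\<integral>\<^sup>+x. e x \<partial>lborel) + (\<integral>\<^sup>+x. e x \<partial>lborel) = ennreal (2 * K / \<kappa> * exp (- \<kappa> * s))"
    unfolding e using K \<kappa> by (simp flip: ennreal_plus)
  finally show ?thesis .
qed

text \<open>Identifies the probability of an interval with the integral to which
  \<open>mle_deviation\<close> compares the empirical measure.\<close>

lemma measure_density_Icc:
  assumes \<phi>: "concave_ereal \<phi>" and meas: "(\<lambda>x. exp_ereal (\<phi> x)) \<in> borel_measurable borel"
    and lu: "l < u" "\<phi> l \<noteq> -\<infinity>" "\<phi> u \<noteq> -\<infinity>" and yz: "l \<le> y" "z \<le> u"
  shows "measure (density lborel (\<lambda>x. exp_ereal (\<phi> x))) {y..z}
    = (\<integral>t. indicator {y..z} t * exp (real_of_ereal (\<phi> t)) \<partial>lebesgue_Icc l u)"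
proof -
  note conc = concave_ereal_Icc[OF \<phi> lu]
  have int: "integrable (lebesgue_Icc l u) (\<lambda>t. indicator {y..z} t * exp (real_of_ereal (\<phi> t)))"
  proof (rule integrable_exp_concave[OF conc(2), where K = 1])
    show "indicat_real {y..z} \<in> borel_measurable (lebesgue_Icc l u)"
      by (rule measurable_restrict_space1) simp
  qed (simp add: indicator_def)
  have "emeasure (density lborel (\<lambda>x. exp_ereal (\<phi> x))) {y..z} = (\<integral>\<^sup>+x. exp_ereal (\<phi> x) * indicator {y..z} x \<partial>lborel)"
    using meas by (intro emeasure_density) auto
  also have "\<dots> = (\<integral>\<^sup>+x. ennreal (indicator {y..z} x * exp (real_of_ereal (\<phi> x))) * indicator {l..u} x \<partial>lborel)"
  proof (rule nn_integral_cong)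
    fix x
    show "exp_ereal (\<phi> x) * indicator {y..z} x = ennreal (indicator {y..z} x * exp (real_of_ereal (\<phi> x))) * indicator {l..u} x"
    proof (cases "x \<in> {y..z}")
      case True
      then have x: "x \<in> {l..u}" using yz by auto
      obtain c where "\<phi> x = ereal c" using conc(1) x by blast
      then show ?thesis using True x by (simp add: exp_ereal_def)
    qed simp
  qed
  also have "\<dots> = (\<integral>\<^sup>+x. ennreal (indicator {y..z} x * exp (real_of_ereal (\<phi> x))) \<partial>lebesgue_Icc l u)"
    by (subst nn_integral_restrict_space) auto
  also have "\<dots> = ennreal (\<integral>t. indicator {y..z} t * exp (real_of_ereal (\<phi> t)) \<partial>lebesgue_Icc l u)"
    by (rule nn_integral_eq_integral[OF int]) auto
  finally show ?thesis
    by (simp add: measure_def integral_nonneg_AE)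
qed

subsection \<open>Rates\<close>

text \<open>The deterministic core, for one sample with small interval deviations. The margin
  \<open>2 * H\<close> has two halves: the outer one contains observations on either side, so that
  the sample range covers the inner one, and the inner one is the neighbourhood on which the
  interval bounds need the density bound.\<close>

lemma mle_uniform_bound:
  fixes x :: "nat \<Rightarrow> real" and \<phi> :: "real \<Rightarrow> ereal"
  defines "f r \<equiv> real_of_ereal (\<phi> r)"
  assumes \<phi>: "concave_ereal \<phi>" and meas: "(\<lambda>r. exp_ereal (\<phi> r)) \<in> borel_measurable borel"
    and mle: "log_concave_mle n x \<psi>" and n: "0 < n"
    and fin: "\<And>i. i < n \<Longrightarrow> \<phi> (x i) \<noteq> -\<infinity>" and xs: "\<And>i. i < n \<Longrightarrow> \<bar>x i\<bar> \<le> s"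
    and C: "0 \<le> C" and \<rho>: "0 \<le> \<rho>"
    and dev: "\<And>a b. - s \<le> a \<Longrightarrow> a \<le> b \<Longrightarrow> b \<le> s \<Longrightarrow>
      \<bar>(\<Sum>i<n. indicator {a..b} (x i)) / n - measure (density lborel (\<lambda>r. exp_ereal (\<phi> r))) {a..b}\<bar>
        \<le> C * (sqrt (\<rho> * (b - a)) + \<rho>)"
    and AB: "A < B" and H: "0 < H" and ends: "\<phi> (A - 2 * H) \<noteq> -\<infinity>" "\<phi> (B + 2 * H) \<noteq> -\<infinity>"
    and sAB: "- s \<le> A - 2 * H" "B + 2 * H \<le> s"
    and f\<^sub>0: "0 < f\<^sub>0" "\<And>t. t \<in> {A - 2 * H..B + 2 * H} \<Longrightarrow> f\<^sub>0 \<le> exp (f t)"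
    and small: "C * (sqrt (\<rho> * H) + \<rho>) < f\<^sub>0 * H"
    and hoelder: "f \<in> Hoelder_class \<beta> L {A..B}" and \<beta>: "0 \<le> \<beta>" "\<beta> \<le> 2" and L: "0 \<le> L"
    and \<delta>: "0 < \<delta>" "8 * \<delta> \<le> B - A"
    and \<epsilon>: "0 \<le> \<epsilon>" "error_rate C \<rho> (\<delta> / 2) H f\<^sub>0 s < 1 - exp (- \<epsilon>)"
  shows "\<And>t. t \<in> {A..B} \<Longrightarrow> \<phi> t = ereal (f t)"
    and "\<And>t. t \<in> {A..B} \<Longrightarrow> \<psi> t = ereal (real_of_ereal (\<psi> t))"
    and "\<And>t. t \<in> {A..B} \<Longrightarrow> real_of_ereal (\<psi> t) \<le> f t + 2 * (\<epsilon> + 16 * L * \<delta> powr \<beta>)"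
    and "\<And>t. t \<in> {A + \<delta>..B - \<delta>} \<Longrightarrow> f t \<le> real_of_ereal (\<psi> t) + (\<epsilon> + L * \<delta> powr \<beta>)"
proof -
  define g where "g t = real_of_ereal (\<psi> t)" for t
  define \<mu> where "\<mu> = density lborel (\<lambda>r. exp_ereal (\<phi> r))"
  have AB': "A - 2 * H < B + 2 * H" using AB H by simp
  note conc_AB = concave_ereal_Icc[OF \<phi> AB' ends]
  have mass: "f\<^sub>0 * (z - y) \<le> measure \<mu> {y..z}" if "A - 2 * H \<le> y" "y \<le> z" "z \<le> B + 2 * H" for y z
  proof -
    have "f\<^sub>0 * (z - y) \<le> (\<integral>t. indicator {y..z} t * exp (real_of_ereal (\<phi> t)) \<partial>lebesgue_Icc (A - 2 * H) (B + 2 * H))"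
    proof (rule integral_lebesgue_Icc_ge)
      show "integrable (lebesgue_Icc (A - 2 * H) (B + 2 * H)) (\<lambda>t. indicator {y..z} t * exp (real_of_ereal (\<phi> t)))"
      proof (rule integrable_exp_concave[OF conc_AB(2), where K = 1])
        show "indicat_real {y..z} \<in> borel_measurable (lebesgue_Icc (A - 2 * H) (B + 2 * H))"
          by (rule measurable_restrict_space1) simp
      qed (simp add: indicator_def)
      show "f\<^sub>0 \<le> indicator {y..z} t * exp (real_of_ereal (\<phi> t))" if "t \<in> {y..z}" for t
        using f\<^sub>0(2)[of t] that \<open>A - 2 * H \<le> y\<close> \<open>z \<le> B + 2 * H\<close> by (simp add: f_def)
    qed (use that in auto)
    also have "\<dots> = measure \<mu> {y..z}"
      unfolding \<mu>_def by (rule measure_density_Icc[OF \<phi> meas AB' ends, symmetric]) (use that in auto)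
    finally show ?thesis .
  qed
  \<comment> \<open>An interval of length \<open>H\<close> has mass at least
    \<open>f\<^sub>0 * H\<close>, which is more than the deviation bound allows for an empty
    one.\<close>
  have hit: "\<exists>i<n. x i \<in> {y..y + H}" if y: "A - 2 * H \<le> y" "y + H \<le> B + 2 * H" for y
  proof (rule ccontr)
    assume "\<not> ?thesis"
    then have "(\<Sum>i<n. indicat_real {y..y + H} (x i)) = 0" by (intro sum.neutral) auto
    then have "measure \<mu> {y..y + H} \<le> C * (sqrt (\<rho> * H) + \<rho>)"
      using dev[of y "y + H"] y sAB H unfolding \<mu>_def[symmetric] by simp
    moreover have "f\<^sub>0 * H \<le> measure \<mu> {y..y + H}" using mass[of y "y + H"] y H by simp
    ultimately show False using small by linarith
  qed
  define l where "l = Min (x ` {..<n})"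
  define u where "u = Max (x ` {..<n})"
  have ne: "finite (x ` {..<n})" "x ` {..<n} \<noteq> {}" using n by auto
  have xlu: "x i \<in> {l..u}" if "i < n" for i using that ne by (simp add: l_def u_def)
  have lu_in: "l \<in> x ` {..<n}" "u \<in> x ` {..<n}"
    unfolding l_def u_def using Min_in[OF ne] Max_in[OF ne] by auto
  obtain i1 where i1: "i1 < n" "x i1 \<le> A - H" using hit[of "A - 2 * H"] AB H by auto
  obtain i2 where i2: "i2 < n" "B + H \<le> x i2" using hit[of "B + H"] AB H by auto
  have lA: "l \<le> A - H" using xlu[OF i1(1)] i1 by auto
  have uB: "B + H \<le> u" using xlu[OF i2(1)] i2 by auto
  have lu: "l < u" using lA uB AB H by simp
  have su: "- s \<le> l" "u \<le> s"
    using lu_in xs by (force simp: abs_le_iff)+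
  then have su2: "u - l \<le> 2 * s" by simp
  have lu_fin: "\<phi> l \<noteq> -\<infinity>" "\<phi> u \<noteq> -\<infinity>" using lu_in fin by auto
  note conc_\<phi> = concave_ereal_Icc[OF \<phi> lu lu_fin]
  note mle' = log_concave_mle_imp_concave_mle[OF mle n lu xlu lu_in]
  interpret concave_mle n x l u g
    using mle'(2) unfolding g_def[abs_def] .
  interpret mle_deviation n x l u g f C \<rho>
  proof
    show "concave_on {l..u} f" using conc_\<phi>(2) by (simp add: f_def[abs_def])
    fix y z assume yz: "l \<le> y" "y \<le> z" "z \<le> u"
    show "\<bar>(\<Sum>i<n. indicator {y..z} (x i)) / n - (\<integral>t. indicator {y..z} t * exp (f t) \<partial>lebesgue_Icc l u)\<bar>
        \<le> C * (sqrt (\<rho> * (z - y)) + \<rho>)"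
      using dev[of y z] measure_density_Icc[OF \<phi> meas lu lu_fin yz(1,3)] yz su by (simp add: f_def)
  qed (use C \<rho> in auto)
  have sub: "{A..B} \<subseteq> {l..u}" using lA uB H by auto
  have gAB: "concave_on {A..B} g"
    by (rule concave_on_subset_Icc[OF concave]) (use lA uB H in auto)
  have no_excess: False
    if c: "A \<le> c" "c + \<delta> \<le> B" and ge: "\<And>t. t \<in> {c..c + \<delta>} \<Longrightarrow> f t + \<epsilon> \<le> g t" for c
  proof -
    \<comment> \<open>The rate is taken at \<open>\<delta> / 2\<close> because a node inside an
      interval of length \<delta> is only sure to be that far from one of the ends.\<close>
    have "\<epsilon> \<le> error_rate C \<rho> (\<delta> / 2) H f\<^sub>0 s"
      by (rule excess_bound[where c = c and d = "c + \<delta>"]) (use c \<delta> H f\<^sub>0 lA uB su2 \<epsilon> ge in auto)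
    moreover have "1 + - \<epsilon> \<le> exp (- \<epsilon>)" by (rule exp_ge_add_one_self)
    ultimately show False using \<epsilon> by linarith
  qed
  have no_deficit: False
    if c: "A \<le> c" "c + \<delta> \<le> B" and ge: "\<And>t. t \<in> {c..c + \<delta>} \<Longrightarrow> g t + \<epsilon> \<le> f t" for c
  proof -
    have "1 - exp (- \<epsilon>) \<le> error_rate C \<rho> (\<delta> / 2) H f\<^sub>0 s"
      by (rule deficit_bound[where c = c and d = "c + \<delta>"]) (use c \<delta> H f\<^sub>0 lA uB su2 \<epsilon> ge in auto)
    then show False using \<epsilon> by linarith
  qed
  show "\<phi> t = ereal (f t)" if "t \<in> {A..B}" for t
    using conc_\<phi>(1) that sub unfolding f_def by blast
  show "\<psi> t = ereal (real_of_ereal (\<psi> t))" if "t \<in> {A..B}" for t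
    using mle'(1) that sub by blast
  show "real_of_ereal (\<psi> t) \<le> f t + 2 * (\<epsilon> + 16 * L * \<delta> powr \<beta>)" if t: "t \<in> {A..B}" for t
  proof (rule ccontr)
    assume "\<not> ?thesis"
    then have exc: "f t + 2 * (\<epsilon> + 16 * L * \<delta> powr \<beta>) \<le> g t" by (simp add: g_def)
    have nn: "0 \<le> 2 * (\<epsilon> + 16 * L * \<delta> powr \<beta>)" using \<epsilon> L by simp
    \<comment> \<open>The threshold is chosen such that halving it and subtracting the approximation
      error leaves exactly \<epsilon>.\<close>
    have half: "2 * (\<epsilon> + 16 * L * \<delta> powr \<beta>) / 2 - 16 * L * \<delta> powr \<beta> = \<epsilon>"
      by (simp add: add_divide_distrib)
    from excess_interval[OF gAB t \<delta> exc nn \<beta> L hoelder]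
    obtain c where c: "A \<le> c" "c + \<delta> \<le> B"
      and or: "(\<forall>y\<in>{c..c + \<delta>}. f y + \<epsilon> \<le> g y) \<or> (\<forall>y\<in>{c..c + \<delta>}. g y + \<epsilon> \<le> f y)"
      unfolding half by blast
    from or show False
    proof
      assume "\<forall>y\<in>{c..c + \<delta>}. f y + \<epsilon> \<le> g y"
      then show False using no_excess[OF c] by blast
    next
      assume "\<forall>y\<in>{c..c + \<delta>}. g y + \<epsilon> \<le> f y"
      then show False using no_deficit[OF c] by blast
    qed
  qed
  show "f t \<le> real_of_ereal (\<psi> t) + (\<epsilon> + L * \<delta> powr \<beta>)" if t: "t \<in> {A + \<delta>..B - \<delta>}" for t
  proof (rule ccontr)
    assume "\<not> ?thesis"
    then have def: "g t + (\<epsilon> + L * \<delta> powr \<beta>) \<le> f t" by (simp add: g_def)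
    have cancel: "\<epsilon> + L * \<delta> powr \<beta> - L * \<delta> powr \<beta> = \<epsilon>" by simp
    from deficit_interval[OF gAB t \<delta>(1) def \<beta>(1) L hoelder]
    obtain c where c: "A \<le> c" "c + \<delta> \<le> B" and ge: "\<forall>y\<in>{c..c + \<delta>}. g y + \<epsilon> \<le> f y"
      unfolding cancel by blast
    then show False using no_deficit[OF c] by blast
  qed
qed

text \<open>
  The sample is contained in \<open>{-s..s}\<close> for any polynomially growing \<open>s\<close>. The exponent \<open>-1/20\<close> is small enough
  for \<open>s powr (3/2) * sqrt \<rho>\<close> not to exceed \<open>\<rho> powr (2/5)\<close>, the best rate, attained for \<open>\<beta> = 2\<close>.
\<close>

lemma error_rate_le:
  assumes \<rho>: "0 < \<rho>" "\<rho> \<le> 1" and \<beta>: "1 \<le> \<beta>" "\<beta> \<le> 2" and pos: "0 \<le> C" "0 < f\<^sub>0" "0 < H"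
  shows "error_rate C \<rho> (\<rho> powr (1 / (2 * \<beta> + 1)) / 2) H f\<^sub>0 (\<rho> powr (- 1 / 20))
    \<le> (1024 * C / f\<^sub>0 + 3072 * C / (f\<^sub>0 * H\<^sup>2)) * \<rho> powr (\<beta> / (2 * \<beta> + 1))"
proof -
  define a where "a = \<rho> powr (\<beta> / (2 * \<beta> + 1))"
  define \<delta> where "\<delta> = \<rho> powr (1 / (2 * \<beta> + 1))"
  define s where "s = \<rho> powr (- 1 / 20)"
  have a: "0 < a" "a \<le> 1" using \<rho> \<beta> by (auto simp: a_def intro!: powr_le1)
  have \<delta>: "0 < \<delta>" using \<rho> by (simp add: \<delta>_def)
  have le_a: "\<rho> powr e \<le> a" if "\<beta> / (2 * \<beta> + 1) \<le> e" for e
    unfolding a_def using that \<rho> by (intro powr_mono') auto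
  have exponent: "\<beta> / (2 * \<beta> + 1) \<le> 2 / 5" using \<beta> by (simp add: field_simps)
  have le_a': "\<rho> powr e \<le> a" if "2 / 5 \<le> e" for e
    using exponent that by (intro le_a) (rule order_trans)
  have ratio: "\<rho> / \<delta> = \<rho> powr (2 * \<beta> / (2 * \<beta> + 1))"
  proof -
    have "1 - 1 / (2 * \<beta> + 1) = 2 * \<beta> / (2 * \<beta> + 1)" using \<beta> by (simp add: field_simps)
    moreover have "\<rho> / \<delta> = \<rho> powr (1 - 1 / (2 * \<beta> + 1))"
      using \<rho> unfolding \<delta>_def powr_diff by simp
    ultimately show ?thesis by simp
  qed
  have "\<rho> powr ((2 * \<beta> / (2 * \<beta> + 1)) / 2) = sqrt (\<rho> powr (2 * \<beta> / (2 * \<beta> + 1)))"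
    using \<rho> by (intro powr_half_sqrt_powr) simp
  moreover have "2 * \<beta> / (2 * \<beta> + 1) / 2 = \<beta> / (2 * \<beta> + 1)" using \<beta> by (simp add: field_simps)
  ultimately have sqrt_ratio: "sqrt (\<rho> / \<delta>) = a" unfolding ratio a_def by metis
  have ratio_le: "\<rho> / \<delta> \<le> a"
    unfolding ratio using \<beta> by (intro le_a divide_right_mono) auto
  have "sqrt (\<rho> / (\<delta> / 2)) = sqrt 2 * a" unfolding sqrt_ratio[symmetric] by (simp flip: real_sqrt_mult)
  also have "\<dots> \<le> 2 * a" using a sqrt_le_D[of 2 2] by (intro mult_right_mono real_le_lsqrt) auto
  finally have "sqrt (\<rho> / (\<delta> / 2)) \<le> 2 * a" .
  moreover have "\<rho> / (\<delta> / 2) \<le> 2 * a" using ratio_le \<delta> by (simp add: field_simps)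
  ultimately have "sqrt (\<rho> / (\<delta> / 2)) + \<rho> / (\<delta> / 2) \<le> 2 * a + 2 * a" by (rule add_mono)
  also have "\<dots> = 4 * a" by simp
  finally have first: "sqrt (\<rho> / (\<delta> / 2)) + \<rho> / (\<delta> / 2) \<le> 4 * a" .
  have s: "0 < s" using \<rho> by (simp add: s_def)
  have \<rho>s: "\<rho> * s = \<rho> powr (19 / 20)"
    using \<rho> powr_add[of \<rho> 1 "- 1 / 20"] by (simp add: s_def)
  have "\<rho> powr ((19 / 20) / 2) = sqrt (\<rho> powr (19 / 20))"
    using \<rho> by (intro powr_half_sqrt_powr) simp
  then have sqrt_\<rho>s: "sqrt (\<rho> * s) = \<rho> powr (19 / 40)" unfolding \<rho>s by simp
  \<comment> \<open>The exponent 19/40 - 1/20 = 17/40 exceeds 2/5, and larger exponents give smaller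
    powers because \<open>\<rho> \<le> 1\<close>.\<close>
  have "s * sqrt (\<rho> * s) = s * \<rho> powr (19 / 40)" by (simp only: sqrt_\<rho>s)
  also have "\<dots> = \<rho> powr (- 1 / 20 + 19 / 40)" by (simp only: s_def powr_add)
  also have "\<dots> \<le> a" by (rule le_a') simp
  finally have 1: "s * sqrt (\<rho> * s) \<le> a" .
  have 2: "\<rho> * s \<le> a" unfolding \<rho>s by (rule le_a') simp
  have "sqrt (2 * \<rho> * s) = sqrt 2 * sqrt (\<rho> * s)" by (simp add: real_sqrt_mult mult.assoc)
  also have "\<dots> \<le> 2 * sqrt (\<rho> * s)" using \<rho> s by (intro mult_right_mono real_le_lsqrt) auto
  finally have "s * sqrt (2 * \<rho> * s) \<le> s * (2 * sqrt (\<rho> * s))" using s by (intro mult_left_mono) auto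
  then have second: "s * (sqrt (2 * \<rho> * s) + \<rho>) \<le> 3 * a" using 1 2 by (simp add: algebra_simps)
  have "256 * C / f\<^sub>0 * (sqrt (\<rho> / (\<delta> / 2)) + \<rho> / (\<delta> / 2)) \<le> 256 * C / f\<^sub>0 * (4 * a)"
    using first pos by (intro mult_left_mono) auto
  moreover have "1024 * C / (f\<^sub>0 * H\<^sup>2) * (s * (sqrt (2 * \<rho> * s) + \<rho>)) \<le> 1024 * C / (f\<^sub>0 * H\<^sup>2) * (3 * a)"
    using second pos by (intro mult_left_mono) auto
  ultimately have "256 * C / f\<^sub>0 * (sqrt (\<rho> / (\<delta> / 2)) + \<rho> / (\<delta> / 2)) + 1024 * C / (f\<^sub>0 * H\<^sup>2) * (s * (sqrt (2 * \<rho> * s) + \<rho>))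
    \<le> (1024 * C / f\<^sub>0 + 3072 * C / (f\<^sub>0 * H\<^sup>2)) * a"
    by (simp add: distrib_right)
  then show ?thesis
    unfolding error_rate_def \<delta>_def[symmetric] s_def[symmetric] a_def[symmetric] by (simp add: mult.assoc)
qed

text \<open>The exceptional set joins the failure of the grid bound to the event that some
  observation leaves \<open>{-s..s}\<close> or hits a point of zero density, the latter having
  probability 0. From \<open>2 < n\<close> follows \<open>ln n \<ge> 1\<close>, hence
  \<open>1 / n \<le> rho n\<close>: the mesh is below the noise level.\<close>

lemma (in prob_space) good_sample_event:
  fixes n :: nat and Y :: "nat \<Rightarrow> 'a \<Rightarrow> real" and s K \<kappa> :: real
  assumes \<phi>: "concave_ereal \<phi>"
    and indep: "indep_vars (\<lambda>_. borel) Y {..<n}"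
    and Y: "\<And>i. i < n \<Longrightarrow> distributed M lborel (Y i) (\<lambda>r. exp_ereal (\<phi> r))"
    and K: "\<And>r. exp_ereal (\<phi> r) \<le> ennreal (K * exp (- \<kappa> * \<bar>r\<bar>))" "1 \<le> K" "0 < \<kappa>"
    and n: "2 < n" and s: "0 \<le> s" "s \<le> n"
  shows "\<exists>E\<in>sets M. emeasure M E \<le> ennreal (18 / (real n)\<^sup>2 + n * (2 * K / \<kappa> * exp (- \<kappa> * s))) \<and>
    (\<forall>\<omega>\<in>space M - E. (\<forall>i<n. \<phi> (Y i \<omega>) \<noteq> -\<infinity> \<and> \<bar>Y i \<omega>\<bar> \<le> s) \<and>
      (\<forall>a b. - s \<le> a \<longrightarrow> a \<le> b \<longrightarrow> b \<le> s \<longrightarrow>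
        \<bar>(\<Sum>i<n. indicator {a..b} (Y i \<omega>)) / n - measure (density lborel (\<lambda>r. exp_ereal (\<phi> r))) {a..b}\<bar>
          \<le> 23 * K * (sqrt (rho n * (b - a)) + rho n)))"
proof -
  define h where "h r = exp_ereal (\<phi> r)" for r
  define \<mu> where "\<mu> = density lborel h"
  have n0: "0 < n" using n by simp
  have Yh: "distributed M lborel (Y i) h" if "i < n" for i using Y[OF that] by (simp add: h_def[abs_def])
  have h_meas [measurable]: "h \<in> borel_measurable borel" using Yh[OF n0] distributed_borel_measurable by fastforce
  have Y_meas [measurable]: "Y i \<in> borel_measurable M" if "i < n" for i
    using distributed_measurable[OF Yh[OF that]] by simp
  have prob: "emeasure M {\<omega> \<in> space M. Y i \<omega> \<in> S} = (\<integral>\<^sup>+r. h r * indicator S r \<partial>lborel)"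
    if "i < n" "S \<in> sets borel" for i S
    using distributed_emeasure[OF Yh[OF that(1)], of S] that(2) by (simp add: vimage_def Int_def conj_commute)
  have \<mu>: "emeasure \<mu> S = (\<integral>\<^sup>+r. h r * indicator S r \<partial>lborel)" if "S \<in> sets borel" for S
    unfolding \<mu>_def using that by (intro emeasure_density) auto
  have fin: "finite_measure \<mu>"
  proof
    have "emeasure \<mu> UNIV = emeasure M {\<omega> \<in> space M. Y 0 \<omega> \<in> UNIV}" using prob[OF n0, of UNIV] \<mu>[of UNIV] by simp
    then show "emeasure \<mu> (space \<mu>) \<noteq> \<infinity>" by (simp add: \<mu>_def emeasure_eq_measure)
  qed
  have P: "prob {\<omega> \<in> space M. Y i \<omega> \<in> {a..b}} = measure \<mu> {a..b}" if "i < n" for i a b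
    using prob[OF that, of "{a..b}"] \<mu>[of "{a..b}"] by (simp add: measure_def)
  have len: "measure \<mu> {a..b} \<le> K * (b - a)" if "a \<le> b" for a b
  proof -
    have "emeasure \<mu> {a..b} \<le> (\<integral>\<^sup>+r. ennreal K * indicator {a..b} r \<partial>lborel)"
      unfolding \<mu>[of "{a..b}", simplified]
    proof (rule nn_integral_mono)
      fix r
      have "K * exp (- \<kappa> * \<bar>r\<bar>) \<le> K * 1" using K by (intro mult_left_mono) auto
      then have "h r \<le> ennreal K" unfolding h_def using K(1)[of r] by (metis ennreal_leI mult_1_right order_trans)
      then show "h r * indicator {a..b} r \<le> ennreal K * indicator {a..b} r" by (rule mult_right_mono) simp
    qed
    also have "\<dots> = ennreal (K * (b - a))"
      using that K by (subst nn_integral_cmult_indicator) (auto simp: ennreal_mult)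
    finally show ?thesis
      using that K by (simp add: finite_measure.emeasure_eq_measure[OF fin])
  qed
  obtain G where G: "G \<in> sets M" "emeasure M G \<le> ennreal (18 / (real n)\<^sup>2)"
    and grid: "\<And>\<omega> j k. \<omega> \<in> space M - G \<Longrightarrow> \<bar>j\<bar> \<le> int (n\<^sup>2) \<and> \<bar>k\<bar> \<le> int (n\<^sup>2) \<and> j \<le> k \<Longrightarrow>
      \<bar>(\<Sum>i<n. indicator {j / n..k / n} (Y i \<omega>)) / n - measure \<mu> {j / n..k / n}\<bar>
        \<le> 7 * (sqrt (K * (k / n - j / n) * rho n) + rho n)"
    using grid_deviation[OF indep P len] K n by (auto simp: Ball_def)
  have tail: "emeasure M {\<omega> \<in> space M. s < \<bar>Y i \<omega>\<bar>} \<le> ennreal (2 * K / \<kappa> * exp (- \<kappa> * s))" if "i < n" for i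
  proof -
    have "emeasure M {\<omega> \<in> space M. s < \<bar>Y i \<omega>\<bar>} = (\<integral>\<^sup>+r. h r * indicator {r. s < \<bar>r\<bar>} r \<partial>lborel)"
      using prob[OF that, of "{r. s < \<bar>r\<bar>}"] by simp
    also have "\<dots> \<le> ennreal (2 * K / \<kappa> * exp (- \<kappa> * s))"
      by (rule exp_decay_tail_integral) (use K s in \<open>auto simp: h_def\<close>)
    finally show ?thesis .
  qed
  have zero: "emeasure M {\<omega> \<in> space M. h (Y i \<omega>) = 0} = 0" if "i < n" for i
  proof -
    have "emeasure M {\<omega> \<in> space M. Y i \<omega> \<in> {r. h r = 0}} = (\<integral>\<^sup>+r. h r * indicator {r. h r = 0} r \<partial>lborel)"
      by (rule prob[OF that]) measurable
    also have "\<dots> = (\<integral>\<^sup>+(r::real). 0 \<partial>lborel)" by (intro nn_integral_cong) (auto simp: indicator_def)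
    finally show ?thesis by simp
  qed
  define T where "T = (\<Union>i<n. {\<omega> \<in> space M. s < \<bar>Y i \<omega>\<bar>} \<union> {\<omega> \<in> space M. h (Y i \<omega>) = 0})"
  have T_meas: "{\<omega> \<in> space M. s < \<bar>Y i \<omega>\<bar>} \<in> sets M" "{\<omega> \<in> space M. h (Y i \<omega>) = 0} \<in> sets M" if "i < n" for i
    using that by measurable
  have TM: "T \<in> sets M" unfolding T_def using T_meas by (intro sets.finite_UN) auto
  have "emeasure M T \<le> (\<Sum>i<n. emeasure M ({\<omega> \<in> space M. s < \<bar>Y i \<omega>\<bar>} \<union> {\<omega> \<in> space M. h (Y i \<omega>) = 0}))"
    unfolding T_def using T_meas by (intro emeasure_subadditive_finite) auto
  also have "\<dots> \<le> (\<Sum>i<n. ennreal (2 * K / \<kappa> * exp (- \<kappa> * s)))"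
  proof (rule sum_mono)
    fix i assume "i \<in> {..<n}"
    then have i: "i < n" by simp
    have "emeasure M ({\<omega> \<in> space M. s < \<bar>Y i \<omega>\<bar>} \<union> {\<omega> \<in> space M. h (Y i \<omega>) = 0})
      \<le> emeasure M {\<omega> \<in> space M. s < \<bar>Y i \<omega>\<bar>} + emeasure M {\<omega> \<in> space M. h (Y i \<omega>) = 0}"
      by (rule emeasure_subadditive[OF T_meas[OF i]])
    then show "emeasure M ({\<omega> \<in> space M. s < \<bar>Y i \<omega>\<bar>} \<union> {\<omega> \<in> space M. h (Y i \<omega>) = 0}) \<le> ennreal (2 * K / \<kappa> * exp (- \<kappa> * s))"
      using tail[OF i] zero[OF i] by simp
  qed
  also have "\<dots> = ennreal (n * (2 * K / \<kappa> * exp (- \<kappa> * s)))"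
    using K by (simp only: sum_constant card_lessThan ennreal_of_nat_eq_real_of_nat) (simp only: ennreal_mult'[OF of_nat_0_le_iff])
  finally have Tsmall: "emeasure M T \<le> ennreal (n * (2 * K / \<kappa> * exp (- \<kappa> * s)))" .
  have "emeasure M (G \<union> T) \<le> ennreal (18 / (real n)\<^sup>2) + ennreal (n * (2 * K / \<kappa> * exp (- \<kappa> * s)))"
    using emeasure_subadditive[OF G(1) TM] add_mono[OF G(2) Tsmall] by (rule order_trans)
  also have "\<dots> = ennreal (18 / (real n)\<^sup>2 + n * (2 * K / \<kappa> * exp (- \<kappa> * s)))"
    using K by (intro ennreal_plus[symmetric]) auto
  finally have small: "emeasure M (G \<union> T) \<le> ennreal (18 / (real n)\<^sup>2 + n * (2 * K / \<kappa> * exp (- \<kappa> * s)))" .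
  have \<rho>: "1 / n \<le> rho n"
  proof -
    have "exp 1 \<le> real n" using exp_le n by linarith
    then have "1 \<le> ln (real n)" using n by (subst ln_ge_iff) auto
    then show ?thesis by (simp add: rho_def divide_right_mono)
  qed
  show ?thesis
  proof (rule bexI[of _ "G \<union> T"], rule conjI[OF small], rule ballI, rule conjI)
    fix \<omega> assume \<omega>: "\<omega> \<in> space M - (G \<union> T)"
    show "\<forall>i<n. \<phi> (Y i \<omega>) \<noteq> -\<infinity> \<and> \<bar>Y i \<omega>\<bar> \<le> s"
    proof (intro allI impI)
      fix i assume i: "i < n"
      then have "\<not> s < \<bar>Y i \<omega>\<bar>" "h (Y i \<omega>) \<noteq> 0" using \<omega> by (auto simp: T_def)
      then show "\<phi> (Y i \<omega>) \<noteq> -\<infinity> \<and> \<bar>Y i \<omega>\<bar> \<le> s"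
        using exp_ereal_pos_iff[of "\<phi> (Y i \<omega>)"] by (auto simp: h_def)
    qed
    show "\<forall>a b. - s \<le> a \<longrightarrow> a \<le> b \<longrightarrow> b \<le> s \<longrightarrow>
        \<bar>(\<Sum>i<n. indicator {a..b} (Y i \<omega>)) / n - measure (density lborel (\<lambda>r. exp_ereal (\<phi> r))) {a..b}\<bar>
          \<le> 23 * K * (sqrt (rho n * (b - a)) + rho n)"
      unfolding h_def[symmetric] \<mu>_def[symmetric]
    proof (intro allI impI)
      fix a b assume ab: "- s \<le> a" "a \<le> b" "b \<le> s"
      show "\<bar>(\<Sum>i<n. indicator {a..b} (Y i \<omega>)) / n - measure \<mu> {a..b}\<bar> \<le> 23 * K * (sqrt (rho n * (b - a)) + rho n)"
      proof (rule grid_to_intervals[OF fin _ len K(2) n0 \<rho>])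
        show "sets \<mu> = sets borel" by (simp add: \<mu>_def)
        show "\<bar>(\<Sum>i<n. indicator {j / n..k / n} (Y i \<omega>)) / n - measure \<mu> {j / n..k / n}\<bar>
            \<le> 7 * (sqrt (K * (k / n - j / n) * rho n) + rho n)"
          if "\<bar>j\<bar> \<le> int (n\<^sup>2)" "\<bar>k\<bar> \<le> int (n\<^sup>2)" "j \<le> k" for j k
          by (rule grid) (use \<omega> that in auto)
      qed (use ab s in auto)
    qed
  qed (use G TM in auto)
qed

lemma rho_tendsto_zero: "(\<lambda>n. rho n) \<longlonglongrightarrow> 0"
  unfolding rho_def by real_asymp

lemma rho_nonneg: "0 \<le> rho n"
  by (cases "n = 0") (auto simp: rho_def)

text \<open>\<open>rho n powr (- 1 / 20)\<close> is a power of \<open>n / ln n\<close>, so its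
  exponential beats the factor \<open>n\<close> that stems from the union over the
  observations.\<close>

lemma good_sample_error_tendsto_zero:
  assumes "0 < \<kappa>"
  shows "(\<lambda>n. 18 / (real n)\<^sup>2 + n * (2 * K / \<kappa> * exp (- \<kappa> * rho n powr (- 1 / 20)))) \<longlonglongrightarrow> 0"
proof -
  have "(\<lambda>n. 18 / (real n)\<^sup>2) \<longlonglongrightarrow> 0" by real_asymp
  moreover have "(\<lambda>n. real n * exp (- \<kappa> * rho n powr (- 1 / 20))) \<longlonglongrightarrow> 0"
    unfolding rho_def using assms by real_asymp
  from tendsto_mult[OF tendsto_const[of "2 * K / \<kappa>"] this]
  have "(\<lambda>n. n * (2 * K / \<kappa> * exp (- \<kappa> * rho n powr (- 1 / 20)))) \<longlonglongrightarrow> 0"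
    by (simp add: mult_ac)
  ultimately show ?thesis using tendsto_add by fastforce
qed

lemma ereal_abs_leI: "ereal (- c) \<le> z \<Longrightarrow> z \<le> ereal c \<Longrightarrow> \<bar>z\<bar> \<le> ereal c"
  by (cases z) auto

theorem theorem4p1:
  fixes f :: "real \<Rightarrow> ennreal" and \<phi> :: "real \<Rightarrow> ereal"
    and M :: "'a measure" and X :: "nat \<Rightarrow> nat \<Rightarrow> 'a \<Rightarrow> real"
    and \<phi>hat :: "nat \<Rightarrow> 'a \<Rightarrow> real \<Rightarrow> ereal"
    and \<beta> L A B :: real
  assumes "concave_ereal \<phi>"
    and "f = (\<lambda>x. exp_ereal (\<phi> x))"
    and "(\<integral>\<^sup>+ x. f x \<partial>lborel) = 1"
    and "prob_space M"
    and "\<And>n. n > 1 \<Longrightarrow> prob_space.indep_vars M (\<lambda>_. borel) (X n) {..<n}"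
    and "\<And>n i. n > 1 \<Longrightarrow> i < n \<Longrightarrow> distributed M lborel (X n i) f"
    and "\<And>n. n > 1 \<Longrightarrow> AE \<omega> in M. log_concave_mle n (\<lambda>i. X n i \<omega>) (\<phi>hat n \<omega>)"
    and "1 \<le> \<beta>" and "\<beta> \<le> 2" and "L > 0"
    and "A < B" and "{A..B} \<subseteq> interior {x. f x > 0}"
    and "(\<lambda>x. real_of_ereal (\<phi> x)) \<in> Hoelder_class \<beta> L {A..B}"
  shows "bigO_prob M (\<lambda>n \<omega>. SUP t\<in>{A..B}. \<phi>hat n \<omega> t - \<phi> t)
           (\<lambda>n. rho n powr (\<beta> / (2 * \<beta> + 1))) \<and>
         bigO_prob M (\<lambda>n \<omega>. SUP t\<in>inner_interval A B \<beta> n. \<phi> t - \<phi>hat n \<omega> t)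
           (\<lambda>n. rho n powr (\<beta> / (2 * \<beta> + 1)))"
proof -
  interpret prob_space M by fact
  note \<phi> = assms(1) and \<beta> = assms(8,9) and L = assms(10) and AB = assms(11)
  have int: "(\<integral>\<^sup>+ x. exp_ereal (\<phi> x) \<partial>lborel) = 1" using assms(2,3) by simp
  have dist: "distributed M lborel (X n i) (\<lambda>x. exp_ereal (\<phi> x))" if "n > 1" "i < n" for n i
    using assms(6)[OF that] assms(2) by simp
  have meas: "(\<lambda>x. exp_ereal (\<phi> x)) \<in> borel_measurable borel"
    using distributed_borel_measurable[OF dist[of 2 0]] by simp
  have pos: "{x. f x > 0} = {x. \<phi> x \<noteq> -\<infinity>}" using assms(2) exp_ereal_pos_iff by auto
  \<comment> \<open>The interior leaves room beyond \<open>A\<close> and \<open>B\<close>;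
    finiteness at the two outer points carries over to everything in between by concavity.\<close>
  obtain H where H: "0 < H" "\<phi> (A - 2 * H) \<noteq> -\<infinity>" "\<phi> (B + 2 * H) \<noteq> -\<infinity>"
  proof -
    have "A \<in> interior {x. f x > 0}" "B \<in> interior {x. f x > 0}" using assms(11,12) by auto
    then obtain e1 e2 where e: "0 < e1" "cball A e1 \<subseteq> {x. f x > 0}" "0 < e2" "cball B e2 \<subseteq> {x. f x > 0}"
      unfolding mem_interior_cball by auto
    define H where "H = min e1 e2 / 2"
    have "A - 2 * H \<in> cball A e1" "B + 2 * H \<in> cball B e2" "0 < H"
      using e by (auto simp: H_def dist_real_def)
    with e that[of H] show ?thesis unfolding pos by blast
  qed
  have AB': "A - 2 * H < B + 2 * H" using AB H by simp
  note conc = concave_ereal_Icc[OF \<phi> AB' H(2,3)]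
  obtain K0 \<kappa> where K0: "0 < K0" "0 < \<kappa>" "\<And>x. exp_ereal (\<phi> x) \<le> ennreal (K0 * exp (- \<kappa> * \<bar>x\<bar>))"
    using log_concave_density_exp_decay[OF \<phi> meas int AB' H(2,3)] by blast
  define K where "K = max 1 K0"
  have K: "1 \<le> K" "exp_ereal (\<phi> x) \<le> ennreal (K * exp (- \<kappa> * \<bar>x\<bar>))" for x
  proof -
    show "1 \<le> K" by (simp add: K_def)
    have "K0 * exp (- \<kappa> * \<bar>x\<bar>) \<le> K * exp (- \<kappa> * \<bar>x\<bar>)" by (intro mult_right_mono) (auto simp: K_def)
    then show "exp_ereal (\<phi> x) \<le> ennreal (K * exp (- \<kappa> * \<bar>x\<bar>))"
      using K0(3)[of x] by (meson ennreal_leI order_trans)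
  qed
  define \<phi>r where "\<phi>r x = real_of_ereal (\<phi> x)" for x
  \<comment> \<open>A concave function is at least the smaller of its two end values, so this is a
    positive lower bound of the density.\<close>
  define f\<^sub>0 where "f\<^sub>0 = exp (min (\<phi>r (A - 2 * H)) (\<phi>r (B + 2 * H)))"
  have f\<^sub>0: "0 < f\<^sub>0" "f\<^sub>0 \<le> exp (\<phi>r t)" if "t \<in> {A - 2 * H..B + 2 * H}" for t
    using concave_on_Icc_ge_min[OF conc(2) that] by (auto simp: f\<^sub>0_def \<phi>r_def)
  have f0: "0 < f\<^sub>0" by (simp add: f\<^sub>0_def)
  define C where "C = 23 * K"
  have C: "0 \<le> C" using K by (simp add: C_def)
  define Q where "Q = 1024 * C / f\<^sub>0 + 3072 * C / (f\<^sub>0 * H\<^sup>2)"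
  have Q: "0 \<le> Q" using C f0 by (simp add: Q_def)
  define a where "a n = rho n powr (\<beta> / (2 * \<beta> + 1))" for n
  define \<delta> where "\<delta> n = rho n powr (1 / (2 * \<beta> + 1))" for n
  define s where "s n = rho n powr (- 1 / 20)" for n
  \<comment> \<open>This is \<open>2 * (\<epsilon> + 16 * L * a n)\<close> divided by
    \<open>a n\<close>, for \<open>\<epsilon> = (2 * Q + 1) * a n\<close>.\<close>
  define C1 where "C1 = 4 * Q + 2 + 32 * L"
  define bound where "bound n = 18 / (real n)\<^sup>2 + n * (2 * K / \<kappa> * exp (- \<kappa> * s n))" for n
  have bound_lim: "(\<lambda>n. ennreal (bound n)) \<longlonglongrightarrow> 0"
    using good_sample_error_tendsto_zero[OF K0(2), of K] tendsto_ennrealI[of bound 0]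
    by (simp add: bound_def[abs_def] s_def)
  have a_lim: "a \<longlonglongrightarrow> 0" "\<delta> \<longlonglongrightarrow> 0"
    unfolding a_def \<delta>_def using \<beta>
    by (auto intro!: tendsto_zero_powrI rho_tendsto_zero tendsto_const simp: rho_nonneg)
  have s_lim: "filterlim s at_top sequentially"
    unfolding s_def rho_def by real_asymp
  have lim_small: "(\<lambda>n. C * (sqrt (rho n * H) + rho n)) \<longlonglongrightarrow> C * (sqrt (0 * H) + 0)"
    by (intro tendsto_intros rho_tendsto_zero)
  have ev: "\<forall>\<^sub>F n in sequentially. 2 < n \<and> rho n \<le> 1 \<and> 8 * \<delta> n \<le> B - A \<and> (2 * Q + 1) * a n \<le> 1 / 2 \<and>
      max \<bar>A - 2 * H\<bar> \<bar>B + 2 * H\<bar> \<le> s n \<and> C * (sqrt (rho n * H) + rho n) < f\<^sub>0 * H"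
  proof (intro eventually_conj)
    show "\<forall>\<^sub>F n in sequentially. 2 < n" by (rule eventually_gt_at_top)
    show "\<forall>\<^sub>F n in sequentially. rho n \<le> 1"
      using order_tendstoD(2)[OF rho_tendsto_zero, of 1] by (auto elim: eventually_mono)
    have "(\<lambda>n. 8 * \<delta> n) \<longlonglongrightarrow> 8 * 0" by (intro tendsto_intros a_lim)
    from order_tendstoD(2)[OF this, of "B - A"]
    show "\<forall>\<^sub>F n in sequentially. 8 * \<delta> n \<le> B - A" using AB by (auto elim: eventually_mono)
    have "(\<lambda>n. (2 * Q + 1) * a n) \<longlonglongrightarrow> (2 * Q + 1) * 0" by (intro tendsto_intros a_lim)
    from order_tendstoD(2)[OF this, of "1 / 2"]
    show "\<forall>\<^sub>F n in sequentially. (2 * Q + 1) * a n \<le> 1 / 2" by (auto elim: eventually_mono)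
    show "\<forall>\<^sub>F n in sequentially. max \<bar>A - 2 * H\<bar> \<bar>B + 2 * H\<bar> \<le> s n"
      using s_lim unfolding filterlim_at_top by blast
    show "\<forall>\<^sub>F n in sequentially. C * (sqrt (rho n * H) + rho n) < f\<^sub>0 * H"
      using order_tendstoD(2)[OF lim_small, of "f\<^sub>0 * H"] f0 H by simp
  qed
  have main: "\<exists>E\<in>sets M. emeasure M E \<le> ennreal (bound n) \<and> (\<forall>\<omega>\<in>space M - E.
      \<bar>SUP t\<in>{A..B}. \<phi>hat n \<omega> t - \<phi> t\<bar> \<le> ereal (C1 * a n) \<and>
      \<bar>SUP t\<in>inner_interval A B \<beta> n. \<phi> t - \<phi>hat n \<omega> t\<bar> \<le> ereal (C1 * a n))"
    if n: "2 < n \<and> rho n \<le> 1 \<and> 8 * \<delta> n \<le> B - A \<and> (2 * Q + 1) * a n \<le> 1 / 2 \<and>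
      max \<bar>A - 2 * H\<bar> \<bar>B + 2 * H\<bar> \<le> s n \<and> C * (sqrt (rho n * H) + rho n) < f\<^sub>0 * H" for n
  proof -
    have n1: "1 < n" "0 < n" using n by auto
    have \<rho>: "0 < rho n" "rho n \<le> 1" using n by (auto simp: rho_def)
    have s0: "0 \<le> s n" by (simp add: s_def)
    \<comment> \<open>The grid reaches from \<open>- real n\<close> to \<open>real n\<close>
      only.\<close>
    have sn: "s n \<le> real n"
    proof -
      have "1 \<le> ln (real n)"
      proof -
        have "exp 1 \<le> real n" using exp_le n by linarith
        then show ?thesis using n by (subst ln_ge_iff) auto
      qed
      then have "inverse (rho n) \<le> real n" using n by (simp add: rho_def field_simps)
      moreover have "s n \<le> rho n powr (- 1)"
        unfolding s_def using \<rho> by (intro powr_mono') auto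
      ultimately show ?thesis using \<rho> by (simp add: powr_minus)
    qed
    obtain E where E: "E \<in> sets M" "emeasure M E \<le> ennreal (bound n)"
      and good: "\<And>\<omega> i. \<omega> \<in> space M - E \<Longrightarrow> i < n \<Longrightarrow> \<phi> (X n i \<omega>) \<noteq> -\<infinity> \<and> \<bar>X n i \<omega>\<bar> \<le> s n"
      and dev: "\<And>\<omega> b c. \<omega> \<in> space M - E \<Longrightarrow> - s n \<le> b \<Longrightarrow> b \<le> c \<Longrightarrow> c \<le> s n \<Longrightarrow>
        \<bar>(\<Sum>i<n. indicator {b..c} (X n i \<omega>)) / n - measure (density lborel (\<lambda>r. exp_ereal (\<phi> r))) {b..c}\<bar>
          \<le> C * (sqrt (rho n * (c - b)) + rho n)"
      using good_sample_event[OF \<phi> assms(5)[OF n1(1)] dist[OF n1(1)] K(2,1) K0(2) _ s0 sn] n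
      unfolding C_def bound_def by (auto simp: Ball_def)
    obtain N where N: "{\<omega> \<in> space M. \<not> log_concave_mle n (\<lambda>i. X n i \<omega>) (\<phi>hat n \<omega>)} \<subseteq> N"
      "emeasure M N = 0" "N \<in> sets M"
      using AE_E[OF assms(7)[OF n1(1)]] by blast
    have "emeasure M (E \<union> N) \<le> ennreal (bound n)"
      using emeasure_subadditive[OF E(1) N(3)] E(2) N(2) by (metis add.right_neutral order_trans)
    moreover have "\<bar>SUP t\<in>{A..B}. \<phi>hat n \<omega> t - \<phi> t\<bar> \<le> ereal (C1 * a n) \<and>
      \<bar>SUP t\<in>inner_interval A B \<beta> n. \<phi> t - \<phi>hat n \<omega> t\<bar> \<le> ereal (C1 * a n)" if \<omega>: "\<omega> \<in> space M - (E \<union> N)" for \<omega>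
    proof -
      have \<omega>E: "\<omega> \<in> space M - E" using \<omega> by simp
      have mle: "log_concave_mle n (\<lambda>i. X n i \<omega>) (\<phi>hat n \<omega>)" using \<omega> N(1) by blast
      \<comment> \<open>Slightly more than twice the rate: \<open>\<epsilon> \<le> 1 / 2\<close>
        gives \<open>1 - exp (- \<epsilon>) \<ge> \<epsilon> - \<epsilon>\<^sup>2 \<ge> \<epsilon> /
        2\<close>, and \<open>\<epsilon> / 2\<close> exceeds \<open>Q * a n\<close>.\<close>
      define \<epsilon> where "\<epsilon> = (2 * Q + 1) * a n"
      have a0: "0 < a n" using \<rho> by (simp add: a_def)
      have \<epsilon>: "0 \<le> \<epsilon>" "\<epsilon> \<le> 1 / 2" using n Q a0 by (auto simp: \<epsilon>_def)
      have rate: "error_rate C (rho n) (\<delta> n / 2) H f\<^sub>0 (s n) < 1 - exp (- \<epsilon>)"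
      proof -
        have "error_rate C (rho n) (\<delta> n / 2) H f\<^sub>0 (s n) \<le> Q * a n"
          unfolding \<delta>_def s_def Q_def a_def by (rule error_rate_le[OF \<rho> \<beta> C f0 H(1)])
        also have "\<dots> < \<epsilon> / 2" using a0 by (simp add: \<epsilon>_def algebra_simps)
        also have "\<dots> \<le> \<epsilon> - \<epsilon>\<^sup>2"
        proof -
          have "\<epsilon> * \<epsilon> \<le> \<epsilon> * (1 / 2)" using \<epsilon> by (intro mult_left_mono) auto
          then show ?thesis by (simp add: power2_eq_square)
        qed
        also have "\<dots> \<le> 1 - exp (- \<epsilon>)"
          using exp_le_quadratic[of "- \<epsilon>"] \<epsilon> by simp
        finally show ?thesis .
      qed
      have \<delta>\<beta>: "\<delta> n powr \<beta> = a n" by (simp add: \<delta>_def a_def powr_powr)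
      have \<delta>0: "0 < \<delta> n" "8 * \<delta> n \<le> B - A" using \<rho> n by (auto simp: \<delta>_def)
      have ends: "- s n \<le> A - 2 * H" "B + 2 * H \<le> s n" using n by auto
      have small: "C * (sqrt (rho n * H) + rho n) < f\<^sub>0 * H" using n by blast
      have \<beta>0: "0 \<le> \<beta>" using \<beta> by simp
      note mub = mle_uniform_bound[of \<phi> n "\<lambda>i. X n i \<omega>" "\<phi>hat n \<omega>" "s n" C "rho n" A B H f\<^sub>0 \<beta> L "\<delta> n" \<epsilon>,
          OF \<phi> meas mle n1(2) _ _ C less_imp_le[OF \<rho>(1)] dev[OF \<omega>E] AB H ends f0 _ small assms(13) \<beta>0 \<beta>(2)
            less_imp_le[OF L] \<delta>0 \<epsilon>(1) rate, folded \<phi>r_def, unfolded \<delta>\<beta>]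
      have fin: "\<phi> t = ereal (\<phi>r t)" if "t \<in> {A..B}" for t
        by (rule mub(1)) (use good[OF \<omega>E] f\<^sub>0 that in auto)
      have fin': "\<phi>hat n \<omega> t = ereal (real_of_ereal (\<phi>hat n \<omega> t))" if "t \<in> {A..B}" for t
        by (rule mub(2)) (use good[OF \<omega>E] f\<^sub>0 that in auto)
      have up: "real_of_ereal (\<phi>hat n \<omega> t) \<le> \<phi>r t + 2 * (\<epsilon> + 16 * L * a n)" if "t \<in> {A..B}" for t
        by (rule mub(3)) (use good[OF \<omega>E] f\<^sub>0 that in auto)
      have low: "\<phi>r t \<le> real_of_ereal (\<phi>hat n \<omega> t) + (\<epsilon> + L * a n)" if "t \<in> {A + \<delta> n..B - \<delta> n}" for t
        by (rule mub(4)) (use good[OF \<omega>E] f\<^sub>0 that in auto)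
      have inner: "inner_interval A B \<beta> n = {A + \<delta> n..B - \<delta> n}" by (simp add: inner_interval_def \<delta>_def)
      have C1a: "2 * (\<epsilon> + 16 * L * a n) \<le> C1 * a n" "\<epsilon> + L * a n \<le> C1 * a n"
      proof -
        have "0 \<le> Q * a n" "0 \<le> L * a n" using Q L a0 by auto
        then show "2 * (\<epsilon> + 16 * L * a n) \<le> C1 * a n" "\<epsilon> + L * a n \<le> C1 * a n"
          using a0 by (auto simp: \<epsilon>_def C1_def algebra_simps)
      qed
      have d1: "\<phi>hat n \<omega> t - \<phi> t = ereal (real_of_ereal (\<phi>hat n \<omega> t) - \<phi>r t)"
        "\<phi> t - \<phi>hat n \<omega> t = ereal (\<phi>r t - real_of_ereal (\<phi>hat n \<omega> t))" if "t \<in> {A..B}" for t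
        by (subst fin'[OF that], subst fin[OF that], simp)+
      have sub: "{A + \<delta> n..B - \<delta> n} \<subseteq> {A..B}" using \<delta>0 by auto
      \<comment> \<open>\<open>bigO_prob\<close> concerns absolute values, so the suprema also need
        lower bounds. Each comes from the opposite inequality at a point where both inequalities
        hold, here the midpoint.\<close>
      define t0 where "t0 = (A + B) / 2"
      have t0: "t0 \<in> {A + \<delta> n..B - \<delta> n}" using \<delta>0 by (auto simp: t0_def field_simps)
      have t0': "t0 \<in> {A..B}" using t0 sub by blast
      show ?thesis
      proof
        show "\<bar>SUP t\<in>{A..B}. \<phi>hat n \<omega> t - \<phi> t\<bar> \<le> ereal (C1 * a n)"
        proof (rule ereal_abs_leI)
          show "(SUP t\<in>{A..B}. \<phi>hat n \<omega> t - \<phi> t) \<le> ereal (C1 * a n)"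
          proof (rule SUP_least)
            fix t assume t: "t \<in> {A..B}"
            show "\<phi>hat n \<omega> t - \<phi> t \<le> ereal (C1 * a n)" using up[OF t] C1a unfolding d1[OF t] ereal_less_eq by linarith
          qed
          have "ereal (- (C1 * a n)) \<le> \<phi>hat n \<omega> t0 - \<phi> t0"
            using low[OF t0] C1a unfolding d1[OF t0'] ereal_less_eq by linarith
          then show "ereal (- (C1 * a n)) \<le> (SUP t\<in>{A..B}. \<phi>hat n \<omega> t - \<phi> t)" by (rule SUP_upper2[OF t0'])
        qed
        show "\<bar>SUP t\<in>inner_interval A B \<beta> n. \<phi> t - \<phi>hat n \<omega> t\<bar> \<le> ereal (C1 * a n)"
          unfolding inner
        proof (rule ereal_abs_leI)
          show "(SUP t\<in>{A + \<delta> n..B - \<delta> n}. \<phi> t - \<phi>hat n \<omega> t) \<le> ereal (C1 * a n)"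
          proof (rule SUP_least)
            fix t assume t: "t \<in> {A + \<delta> n..B - \<delta> n}"
            then have t': "t \<in> {A..B}" using sub by blast
            show "\<phi> t - \<phi>hat n \<omega> t \<le> ereal (C1 * a n)" using low[OF t] C1a unfolding d1[OF t'] ereal_less_eq by linarith
          qed
          have "ereal (- (C1 * a n)) \<le> \<phi> t0 - \<phi>hat n \<omega> t0"
            using up[OF t0'] C1a unfolding d1[OF t0'] ereal_less_eq by linarith
          then show "ereal (- (C1 * a n)) \<le> (SUP t\<in>{A + \<delta> n..B - \<delta> n}. \<phi> t - \<phi>hat n \<omega> t)" by (rule SUP_upper2[OF t0])
        qed
      qed
    qed
    ultimately show ?thesis using E(1) N(3) by (intro bexI[of _ "E \<union> N"]) auto
  qed
  have bigO: "bigO_prob M Z a"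
    if Z: "\<forall>\<^sub>F n in sequentially. \<exists>E\<in>sets M. emeasure M E \<le> ennreal (bound n) \<and> (\<forall>\<omega>\<in>space M - E. \<bar>Z n \<omega>\<bar> \<le> ereal (C1 * a n))"
    for Z :: "nat \<Rightarrow> 'a \<Rightarrow> ereal"
    unfolding bigO_prob_def
  proof (rule tendsto_eventually)
    \<comment> \<open>From \<open>C1\<close> on, the event lies in measurable sets whose probability
      tends to 0, so the limsup is already 0 and the limit in the constant is that of an eventually
      constant function.\<close>
    have "limsup (\<lambda>n. outer_measure_of M {\<omega> \<in> space M. \<bar>Z n \<omega>\<bar> > ereal (c * a n)}) = 0" if c: "C1 \<le> c" for c
    proof -
      have "\<forall>\<^sub>F n in sequentially. outer_measure_of M {\<omega> \<in> space M. \<bar>Z n \<omega>\<bar> > ereal (c * a n)} \<le> ennreal (bound n)"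
        using Z
      proof eventually_elim
        case (elim n)
        then obtain E where E: "E \<in> sets M" "emeasure M E \<le> ennreal (bound n)"
          and le: "\<And>\<omega>. \<omega> \<in> space M - E \<Longrightarrow> \<bar>Z n \<omega>\<bar> \<le> ereal (C1 * a n)" by blast
        have "C1 * a n \<le> c * a n" using c by (intro mult_right_mono) (auto simp: a_def)
        then have ca: "ereal (C1 * a n) \<le> ereal (c * a n)" by simp
        have "{\<omega> \<in> space M. \<bar>Z n \<omega>\<bar> > ereal (c * a n)} \<subseteq> E"
        proof (intro subsetI, elim CollectE conjE, rule ccontr)
          fix \<omega> assume "\<omega> \<in> space M" and gt: "ereal (c * a n) < \<bar>Z n \<omega>\<bar>" and "\<omega> \<notin> E"
          then have "\<bar>Z n \<omega>\<bar> \<le> ereal (c * a n)" using le[of \<omega>] ca by (blast intro: order_trans)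
          with gt show False by simp
        qed
        then have "outer_measure_of M {\<omega> \<in> space M. \<bar>Z n \<omega>\<bar> > ereal (c * a n)} \<le> emeasure M E"
          using outer_measure_of_mono[of _ E M] E(1) by simp
        with E(2) show ?case by simp
      qed
      then have "limsup (\<lambda>n. outer_measure_of M {\<omega> \<in> space M. \<bar>Z n \<omega>\<bar> > ereal (c * a n)}) \<le> limsup (\<lambda>n. ennreal (bound n))"
        by (rule Limsup_mono)
      also have "\<dots> = 0" using bound_lim by (intro lim_imp_Limsup) auto
      finally show ?thesis by simp
    qed
    with eventually_ge_at_top[of C1] show "\<forall>\<^sub>F c in at_top. limsup (\<lambda>n. outer_measure_of M {\<omega> \<in> space M. \<bar>Z n \<omega>\<bar> > ereal (c * a n)}) = 0"
      by (rule eventually_mono)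
  qed
  show ?thesis
    unfolding a_def[symmetric]
    by (intro conjI bigO; rule eventually_mono[OF ev]) (use main in blast)+
qed

end
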